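(* Let $1\le p<\infty$. Then $\mathcal H^{(1,p)}\subsetneq (L^1,\ell^p)$; that is, the inclusion of the Hardy-amalgam space $\mathcal H^{(1,p)}$ in the amalgam space $(L^1,\ell^p)$ is strict.
   Context: All spaces are over $\mathbb R^d$. For $k\in\mathbb Z^d$ let $Q_k=k+[0,1)^d$. For $0<q,p\le\infty$ the amalgam space $(L^q,\ell^p)$ consists of the locally integrable (for $q<1$: measurable) functions $f$ with $\|f\|_{q,p}:=\big\|\{\|f\chi_{Q_k}\|_{L^q}\}_{k\in\mathbb Z^d}\big\|_{\ell^p}<\infty$. Fix $\varphi\in\mathcal C^\infty(\mathbb R^d)$ with support in the open unit ball $B(0,1)$ and $\int_{\mathbb R^d}\varphi(x)\,dx=1$; put $\varphi_t(x)=t^{-d}\varphi(t^{-1}x)$ for $t>0$. For $0<q,p<\infty$, the Hardy-amalgam space $\mathcal H^{(q,p)}$ is the space of tempered distributions $f$ on $\mathbb R^d$ such that $\mathcal M_\varphi(f):=\sup_{t>0}|f*\varphi_t|$ satisfies $\|f\|_{\mathcal H^{(q,p)}}:=\|\mathcal M_\varphi(f)\|_{q,p}<\infty$. The space does not depend on the choice of $\varphi$ (up to equivalence of quasi-norms). Functions in $(L^1,\ell^p)$ are identified with the tempered distributions they define. *)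

theory Defs
  imports "HOL-Analysis.Analysis"
begin

section \<open>Schwartz functions and tempered distributions\<close>

text \<open>Multi-indices are rendered as lists of coordinate directions, so
  \<open>iter_partial [i, j, \<dots>]\<close> is the iterated partial derivative
  \<open>\<partial>\<^sub>i \<partial>\<^sub>j \<dots>\<close>.\<close>

definition partial :: "'n::finite \<Rightarrow> (real^'n \<Rightarrow> complex) \<Rightarrow> real^'n \<Rightarrow> complex" where
  "partial i f x = frechet_derivative f (at x) (axis i 1)"

primrec iter_partial :: "'n::finite list \<Rightarrow> (real^'n \<Rightarrow> complex) \<Rightarrow> real^'n \<Rightarrow> complex" where
  "iter_partial [] f = f"
| "iter_partial (i # is) f = partial i (iter_partial is f)"

definition smooth :: "(real^'n::finite \<Rightarrow> complex) \<Rightarrow> bool" where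
  "smooth f \<longleftrightarrow> (\<forall>is x. iter_partial is f differentiable (at x))"

definition schwartz_space :: "(real^'n::finite \<Rightarrow> complex) set" where
  "schwartz_space = {\<psi>. smooth \<psi> \<and>
     (\<forall>N is. bounded (range (\<lambda>x. (1 + norm x) ^ N *\<^sub>R iter_partial is \<psi> x)))}"

definition schwartz_seminorm ::
    "nat \<Rightarrow> 'n::finite list \<Rightarrow> (real^'n \<Rightarrow> complex) \<Rightarrow> real" where
  "schwartz_seminorm N is \<psi> = (SUP x. (1 + norm x) ^ N * norm (iter_partial is \<psi> x))"

definition schwartz_topology :: "(real^'n::finite \<Rightarrow> complex) topology" where
  "schwartz_topology = topology_generated_by
     {{\<psi> \<in> schwartz_space. schwartz_seminorm N is (\<lambda>x. \<psi> x - \<theta> x) < \<epsilon>} |N is \<theta> \<epsilon>.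
        \<theta> \<in> schwartz_space \<and> \<epsilon> > 0}"

text \<open>Functionals are taken to be extensional (\<open>undefined\<close> outside the Schwartz space), so that
  HOL equality of two tempered distributions is equality on all Schwartz functions.\<close>

definition tempered_distributions :: "((real^'n::finite \<Rightarrow> complex) \<Rightarrow> complex) set" where
  "tempered_distributions = {T \<in> extensional schwartz_space.
     (\<forall>\<psi>\<in>schwartz_space. \<forall>\<theta>\<in>schwartz_space. T (\<lambda>x. \<psi> x + \<theta> x) = T \<psi> + T \<theta>) \<and>
     (\<forall>c. \<forall>\<psi>\<in>schwartz_space. T (\<lambda>x. c * \<psi> x) = c * T \<psi>) \<and>
     continuous_map schwartz_topology euclidean T}"

definition distribution_of ::
    "(real^'n::finite \<Rightarrow> complex) \<Rightarrow> (real^'n \<Rightarrow> complex) \<Rightarrow> complex" where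
  "distribution_of f = restrict (\<lambda>\<psi>. \<integral>x. f x * \<psi> x \<partial>lebesgue) schwartz_space"

definition distr_convolution ::
    "((real^'n::finite \<Rightarrow> complex) \<Rightarrow> complex) \<Rightarrow> (real^'n \<Rightarrow> complex) \<Rightarrow> real^'n \<Rightarrow> complex" where
  "distr_convolution T \<psi> x = T (\<lambda>y. \<psi> (x - y))"

section \<open>Amalgam spaces\<close>

definition ennpowr :: "ennreal \<Rightarrow> real \<Rightarrow> ennreal" where
  "ennpowr a r = (if a = \<infinity> then \<infinity> else ennreal (enn2real a powr r))"

definition unit_cube :: "int^'n::finite \<Rightarrow> (real^'n) set" where
  "unit_cube k = {x. \<forall>i. of_int (k $ i) \<le> x $ i \<and> x $ i < of_int (k $ i) + 1}"

text \<open>The quasi-norm is defined on \<open>[0,\<infinity>]\<close>-valued functions because a maximal function can take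
  the value \<open>\<infinity>\<close>; only finite positive exponents are covered.\<close>

definition amalgam_norm :: "real \<Rightarrow> real \<Rightarrow> (real^'n::finite \<Rightarrow> ennreal) \<Rightarrow> ennreal" where
  "amalgam_norm q p F =
     ennpowr (\<integral>\<^sup>+ k. ennpowr (ennpowr (\<integral>\<^sup>+ x \<in> unit_cube k. ennpowr (F x) q \<partial>lebesgue) (1 / q)) p
        \<partial>count_space UNIV) (1 / p)"

definition amalgam_space :: "real \<Rightarrow> real \<Rightarrow> (real^'n::finite \<Rightarrow> complex) set" where
  "amalgam_space q p = {f \<in> borel_measurable lebesgue.
     (q \<ge> 1 \<longrightarrow> (\<forall>K. compact K \<longrightarrow> set_integrable lebesgue K f)) \<and>
     amalgam_norm q p (\<lambda>x. ennreal (norm (f x))) < \<infinity>}"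

section \<open>Hardy-amalgam spaces\<close>

definition dilation :: "(real^'n::finite \<Rightarrow> complex) \<Rightarrow> real \<Rightarrow> real^'n \<Rightarrow> complex" where
  "dilation \<phi> t x = (1 / t ^ CARD('n)) *\<^sub>R \<phi> ((1 / t) *\<^sub>R x)"

definition maximal_function ::
    "(real^'n::finite \<Rightarrow> complex) \<Rightarrow> ((real^'n \<Rightarrow> complex) \<Rightarrow> complex) \<Rightarrow> real^'n \<Rightarrow> ennreal" where
  "maximal_function \<phi> T x =
     (SUP t\<in>{0<..}. ennreal (norm (distr_convolution T (dilation \<phi> t) x)))"

definition hardy_amalgam_space ::
    "(real^'n::finite \<Rightarrow> complex) \<Rightarrow> real \<Rightarrow> real \<Rightarrow> ((real^'n \<Rightarrow> complex) \<Rightarrow> complex) set" where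
  "hardy_amalgam_space \<phi> q p =
     {T \<in> tempered_distributions. amalgam_norm q p (maximal_function \<phi> T) < \<infinity>}"

end

theory Submission
  imports Defs
begin

text \<open>
  Why the inclusion holds.  Let \<open>T\<close> be tempered with maximal function \<open>M\<close> in the amalgam space, and
  put \<open>u\<^sub>t = T * \<phi>\<^sub>t\<close>.  Then \<open>T\<close> is the limit of \<open>u\<^sub>t\<close> in the sense of distributions as \<open>t \<rightarrow> 0\<close>
  (\<open>tempered_approximate_identity\<close>), while \<open>\<bar>u\<^sub>t\<bar> \<le> M\<close> for all \<open>t\<close>.  Since the exponent on the local
  norms is 1, the bound \<open>M\<close> is locally integrable, and after multiplication with a
  polynomially decaying weight it is integrable (\<open>amalgam_finite_imp_weighted\<close>).  A family dominated by
  one integrable function cannot concentrate on null sets, so convergence against Schwartz functions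
  improves to convergence against indicators of Borel sets
  (\<open>convergent_on_borel_indicators\<close>); the limiting set function is a measure, and its Radon-Nikodym
  density (\<open>dominated_weak_limit\<close>) is a function \<open>f\<close> with \<open>\<bar>f\<bar> \<le> 2 M\<close> that represents \<open>T\<close>.  Hence \<open>f\<close>
  inherits membership in the amalgam space from \<open>M\<close>.

  Why it is strict.  For \<open>p > 1\<close> the decay of the maximal function at infinity is harmless, so the
  obstruction has to be local.  The maximal function of a point mass at \<open>c\<close> is of size
  \<open>\<bar>x - c\<bar>\<^sup>-\<^sup>d\<close> on a cone (wherever \<open>\<phi> \<noteq> 0\<close>), which is not integrable near \<open>c\<close>: every dyadic shell
  contributes the same amount.  The function \<open>spike c\<close> is a sum of \<open>2\<^sup>-\<^sup>j\<close> times normalised indicators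
  of balls around \<open>c\<close> whose radii decrease so fast that the \<open>j\<close>-th piece looks like a point mass on about
  \<open>4\<^sup>j\<close> shells before the next piece takes over.  On those shells the maximal function has integral at least a constant
  times \<open>4\<^sup>j \<cdot> 2\<^sup>-\<^sup>j\<close>, which is unbounded, although \<open>spike c\<close> itself is integrable.  The lower bound rests
  on a single point \<open>s0 \<noteq> 0\<close> where \<open>\<phi>\<close> does not vanish, so cancellation in \<open>\<phi>\<close> is harmless
  (\<open>spike_conv_lower_bound\<close>, \<open>spike_not_hardy\<close>).
\<close>

section \<open>Iterated partial derivatives\<close>

lemma partial_eq:
  assumes "(f has_derivative D) (at x)"
  shows "partial i f x = D (axis i 1)"
  using frechet_derivative_at[OF assms] by (simp add: partial_def)

lemma frechet_derivative_eq_sum_partial: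
  assumes "f differentiable (at x)"
  shows "frechet_derivative f (at x) h = (\<Sum>i\<in>UNIV. h $ i *\<^sub>R partial i f x)"
proof -
  let ?D = "frechet_derivative f (at x)"
  have lin: "linear ?D"
    using assms by (rule linear_frechet_derivative)
  have "?D h = ?D (\<Sum>i\<in>UNIV. h $ i *\<^sub>R axis i 1)"
    using basis_expansion[of h] by (simp add: scalar_mult_eq_scaleR)
  also have "\<dots> = (\<Sum>i\<in>UNIV. h $ i *\<^sub>R partial i f x)"
    by (simp add: linear_sum[OF lin] linear_cmul[OF lin] partial_def)
  finally show ?thesis .
qed

lemma smooth_differentiable: "smooth f \<Longrightarrow> iter_partial is f differentiable (at x)"
  by (simp add: smooth_def)

lemma smooth_has_derivative:
  "smooth f \<Longrightarrow>
    (iter_partial is f has_derivative frechet_derivative (iter_partial is f) (at x)) (at x)"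
  using frechet_derivative_works smooth_differentiable by blast

lemma smooth_continuous_on: "smooth f \<Longrightarrow> continuous_on A (iter_partial is f)"
  by (meson continuous_at_imp_continuous_on differentiable_imp_continuous_within smooth_differentiable)

lemma iter_partial_add:
  assumes "smooth f" "smooth g"
  shows "iter_partial is (\<lambda>x. f x + g x) = (\<lambda>x. iter_partial is f x + iter_partial is g x)"
proof (induction "is")
  case (Cons i "is")
  have "partial i (\<lambda>x. iter_partial is f x + iter_partial is g x) x
      = partial i (iter_partial is f) x + partial i (iter_partial is g) x" for x
    using partial_eq[OF has_derivative_add[OF smooth_has_derivative[OF assms(1)] smooth_has_derivative[OF assms(2)]]]
    by (simp add: partial_def)
  then show ?case using Cons by auto
qed auto

lemma iter_partial_cmult:
  assumes "smooth f"
  shows "iter_partial is (\<lambda>x. c * f x) = (\<lambda>x. c * iter_partial is f x)"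
proof (induction "is")
  case (Cons i "is")
  have "partial i (\<lambda>x. c * iter_partial is f x) x = c * partial i (iter_partial is f) x" for x
    using partial_eq[OF has_derivative_mult_right[OF smooth_has_derivative[OF assms], of c]]
    by (simp add: partial_def)
  then show ?case using Cons by auto
qed auto

lemma iter_partial_affine:
  fixes f :: "real^'n::finite \<Rightarrow> complex"
  assumes "smooth f"
  shows "iter_partial is (\<lambda>x. f (a *\<^sub>R x + v))
    = (\<lambda>x. a ^ length is *\<^sub>R iter_partial is f (a *\<^sub>R x + v))"
proof (induction "is")
  case (Cons i "is")
  let ?g = "iter_partial is f"
  have "partial i (\<lambda>x. a ^ length is *\<^sub>R ?g (a *\<^sub>R x + v)) x
      = a ^ length (i # is) *\<^sub>R partial i ?g (a *\<^sub>R x + v)" for x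
  proof -
    let ?D = "frechet_derivative ?g (at (a *\<^sub>R x + v))"
    have lin: "linear ?D"
      using smooth_differentiable[OF assms] by (rule linear_frechet_derivative)
    have "((\<lambda>x. a *\<^sub>R x + v) has_derivative (\<lambda>h. a *\<^sub>R h)) (at x)"
      by (auto intro!: derivative_eq_intros)
    from has_derivative_compose[OF this smooth_has_derivative[OF assms]]
    have "((\<lambda>x. ?g (a *\<^sub>R x + v)) has_derivative (\<lambda>h. ?D (a *\<^sub>R h))) (at x)" .
    from has_derivative_scaleR_right[OF this, of "a ^ length is"]
    have "((\<lambda>x. a ^ length is *\<^sub>R ?g (a *\<^sub>R x + v)) has_derivative
      (\<lambda>h. a ^ length is *\<^sub>R ?D (a *\<^sub>R h))) (at x)" .
    from partial_eq[OF this, of i] show ?thesis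
      by (simp add: partial_def linear_cmul[OF lin] mult.commute)
  qed
  then show ?case using Cons by auto
qed auto

lemma smooth_add: "smooth f \<Longrightarrow> smooth g \<Longrightarrow> smooth (\<lambda>x. f x + g x)"
  unfolding smooth_def[of "\<lambda>x. f x + g x"]
  by (auto simp: iter_partial_add intro!: differentiable_add smooth_differentiable)

lemma smooth_cmult: "smooth f \<Longrightarrow> smooth (\<lambda>x. c * f x)"
  unfolding smooth_def[of "\<lambda>x. c * f x"]
  by (auto simp: iter_partial_cmult intro!: differentiable_mult smooth_differentiable)

lemma smooth_affine:
  fixes f :: "real^'n::finite \<Rightarrow> complex"
  assumes "smooth f"
  shows "smooth (\<lambda>x. f (a *\<^sub>R x + v))"
  unfolding smooth_def
proof (intro allI)
  fix "is" and x :: "real^'n"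
  have "(\<lambda>x. a *\<^sub>R x + v) differentiable (at x)"
    by (auto intro!: derivative_intros)
  then have "(\<lambda>x. iter_partial is f (a *\<^sub>R x + v)) differentiable (at x)"
    using differentiable_compose smooth_differentiable[OF assms] by blast
  then show "iter_partial is (\<lambda>x. f (a *\<^sub>R x + v)) differentiable (at x)"
    by (auto simp: iter_partial_affine[OF assms] intro!: derivative_intros)
qed

lemma iter_partial_zero: "iter_partial is (\<lambda>x. 0) = (\<lambda>x::real^'n::finite. 0)"
proof (induction "is")
  case (Cons i "is")
  have "partial i (\<lambda>x. 0) x = 0" for x :: "real^'n"
    by (subst partial_eq[OF has_derivative_const]) simp
  with Cons show ?case by auto
qed auto

lemma smooth_zero: "smooth (\<lambda>x. 0)"
  by (simp add: smooth_def iter_partial_zero)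

section \<open>The Schwartz space\<close>

lemma schwartzI:
  assumes "smooth \<psi>"
    and "\<And>N is. \<exists>B. \<forall>x. (1 + norm x) ^ N * norm (iter_partial is \<psi> x) \<le> B"
  shows "\<psi> \<in> schwartz_space"
  using assms(1) assms(2) unfolding schwartz_space_def bounded_iff by (simp add: abs_mult)

lemma schwartz_smooth: "\<psi> \<in> schwartz_space \<Longrightarrow> smooth \<psi>"
  by (simp add: schwartz_space_def)

lemma seminorm_upper:
  assumes "\<psi> \<in> schwartz_space"
  shows "(1 + norm x) ^ N * norm (iter_partial is \<psi> x) \<le> schwartz_seminorm N is \<psi>"
proof -
  have "bounded (range (\<lambda>x. (1 + norm x) ^ N *\<^sub>R iter_partial is \<psi> x))"
    using assms by (simp add: schwartz_space_def)
  then obtain B where "\<And>x. norm ((1 + norm x) ^ N *\<^sub>R iter_partial is \<psi> x) \<le> B"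
    unfolding bounded_iff by auto
  then have "bdd_above (range (\<lambda>x. (1 + norm x) ^ N * norm (iter_partial is \<psi> x)))"
    by (auto simp: bdd_above_def)
  then show ?thesis
    unfolding schwartz_seminorm_def by (intro cSUP_upper) auto
qed

lemma seminorm_least:
  assumes "\<And>x. (1 + norm x) ^ N * norm (iter_partial is \<psi> x) \<le> B"
  shows "schwartz_seminorm N is \<psi> \<le> B"
  unfolding schwartz_seminorm_def by (rule cSUP_least) (use assms in auto)

lemma seminorm_nonneg: "\<psi> \<in> schwartz_space \<Longrightarrow> 0 \<le> schwartz_seminorm N is \<psi>"
  by (rule order_trans[OF _ seminorm_upper[where x=0]]) auto

lemma schwartz_pointwise:
  assumes "\<psi> \<in> schwartz_space"
  shows "norm (iter_partial is \<psi> x) \<le> schwartz_seminorm N is \<psi> / (1 + norm x) ^ N"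
proof -
  have "0 < (1 + norm x) ^ N"
    by (simp add: add_pos_nonneg)
  then show ?thesis
    using seminorm_upper[OF assms, of x N "is"] by (simp add: field_simps)
qed

lemma schwartz_bounded:
  assumes "\<psi> \<in> schwartz_space"
  shows "norm (iter_partial is \<psi> x) \<le> schwartz_seminorm 0 is \<psi>"
  using seminorm_upper[OF assms, of x 0] by simp

lemma seminorm_add_le:
  assumes "\<psi> \<in> schwartz_space" "\<theta> \<in> schwartz_space"
  shows "schwartz_seminorm N is (\<lambda>x. \<psi> x + \<theta> x) \<le> schwartz_seminorm N is \<psi> + schwartz_seminorm N is \<theta>"
    and "(\<lambda>x. \<psi> x + \<theta> x) \<in> schwartz_space"
proof -
  have *: "(1 + norm x) ^ N * norm (iter_partial is (\<lambda>x. \<psi> x + \<theta> x) x)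
      \<le> schwartz_seminorm N is \<psi> + schwartz_seminorm N is \<theta>" for N x "is"
  proof -
    have "(1 + norm x) ^ N * norm (iter_partial is (\<lambda>x. \<psi> x + \<theta> x) x)
      \<le> (1 + norm x) ^ N * (norm (iter_partial is \<psi> x) + norm (iter_partial is \<theta> x))"
      using assms by (auto simp: iter_partial_add schwartz_smooth norm_triangle_ineq intro!: mult_left_mono)
    also have "\<dots> \<le> schwartz_seminorm N is \<psi> + schwartz_seminorm N is \<theta>"
      using seminorm_upper[OF assms(1), of x N "is"] seminorm_upper[OF assms(2), of x N "is"]
      by (simp add: algebra_simps)
    finally show ?thesis .
  qed
  show "schwartz_seminorm N is (\<lambda>x. \<psi> x + \<theta> x) \<le> schwartz_seminorm N is \<psi> + schwartz_seminorm N is \<theta>"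
    using * by (rule seminorm_least)
  show "(\<lambda>x. \<psi> x + \<theta> x) \<in> schwartz_space"
    using * by (intro schwartzI) (auto simp: smooth_add schwartz_smooth assms)
qed

lemmas schwartz_add = seminorm_add_le(2)

lemma seminorm_cmult_le:
  assumes "\<psi> \<in> schwartz_space"
  shows "schwartz_seminorm N is (\<lambda>x. c * \<psi> x) \<le> norm c * schwartz_seminorm N is \<psi>"
    and "(\<lambda>x. c * \<psi> x) \<in> schwartz_space"
proof -
  have *: "(1 + norm x) ^ N * norm (iter_partial is (\<lambda>x. c * \<psi> x) x) \<le> norm c * schwartz_seminorm N is \<psi>" for N x "is"
    using mult_left_mono[OF seminorm_upper[OF assms, of x N "is"], of "norm c"] assms
    by (simp add: iter_partial_cmult schwartz_smooth norm_mult mult.left_commute)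
  show "schwartz_seminorm N is (\<lambda>x. c * \<psi> x) \<le> norm c * schwartz_seminorm N is \<psi>"
    using * by (rule seminorm_least)
  show "(\<lambda>x. c * \<psi> x) \<in> schwartz_space"
    using * by (intro schwartzI) (auto simp: smooth_cmult schwartz_smooth assms)
qed

lemmas schwartz_cmult = seminorm_cmult_le(2)

lemma schwartz_diff:
  assumes "\<psi> \<in> schwartz_space" "\<theta> \<in> schwartz_space"
  shows "(\<lambda>x. \<psi> x - \<theta> x) \<in> schwartz_space"
  using schwartz_add[OF assms(1) schwartz_cmult[OF assms(2), of "-1"]] by simp

lemma iter_partial_diff:
  assumes "smooth f" "smooth g"
  shows "iter_partial is (\<lambda>x. f x - g x) = (\<lambda>x. iter_partial is f x - iter_partial is g x)"
  using iter_partial_add[OF assms(1) smooth_cmult[OF assms(2), of "-1"], of "is"]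
  iter_partial_cmult[OF assms(2), of "is" "-1"] by simp

lemma schwartz_zero: "(\<lambda>x. 0) \<in> schwartz_space"
  by (rule schwartzI) (auto simp: smooth_zero iter_partial_zero)

lemma schwartz_sum:
  assumes "finite I" "\<And>i. i \<in> I \<Longrightarrow> \<psi> i \<in> schwartz_space"
  shows "(\<lambda>x. \<Sum>i\<in>I. \<psi> i x) \<in> schwartz_space"
  using assms by (induction I) (auto simp: schwartz_zero intro!: schwartz_add)

lemma iter_partial_sum:
  assumes "finite I" "\<And>i. i \<in> I \<Longrightarrow> \<psi> i \<in> schwartz_space"
  shows "iter_partial is (\<lambda>x. \<Sum>i\<in>I. \<psi> i x) = (\<lambda>x. \<Sum>i\<in>I. iter_partial is (\<psi> i) x)"
  using assms
  by (induction I) (auto simp: iter_partial_zero iter_partial_add schwartz_smooth schwartz_sum)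

lemma one_plus_norm_add_le: "1 + norm (x + y) \<le> (1 + norm x) * (1 + norm y)"
proof -
  have "0 \<le> norm x * norm y" by simp
  with norm_triangle_ineq[of x y] show ?thesis
    unfolding distrib_left distrib_right mult_1_left mult_1_right by linarith
qed

lemma schwartz_affine:
  assumes "\<psi> \<in> schwartz_space" "a \<noteq> 0"
  shows "(\<lambda>x. \<psi> (a *\<^sub>R x + v)) \<in> schwartz_space"
proof (rule schwartzI)
  show "smooth (\<lambda>x. \<psi> (a *\<^sub>R x + v))"
    using assms by (simp add: smooth_affine schwartz_smooth)
  fix N "is"
  define C where "C = 1 + (1 + norm v) / \<bar>a\<bar>"
  have "(1 + norm x) ^ N * norm (iter_partial is (\<lambda>x. \<psi> (a *\<^sub>R x + v)) x)
      \<le> (C ^ N * \<bar>a\<bar> ^ length is) * schwartz_seminorm N is \<psi>" for x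
  proof -
    let ?y = "a *\<^sub>R x + v"
    have "x = (1/a) *\<^sub>R (?y - v)"
      using assms(2) by simp
    then have "norm x = norm (?y - v) / \<bar>a\<bar>"
      using assms(2) by simp
    also have "\<dots> \<le> (norm ?y + norm v) / \<bar>a\<bar>"
      by (intro divide_right_mono norm_triangle_ineq4) auto
    finally have "1 + norm x \<le> 1 + (norm ?y + norm v) / \<bar>a\<bar>"
      by simp
    also have "\<dots> \<le> C * (1 + norm ?y)"
      using assms(2) by (simp add: C_def field_simps)
    finally have "(1 + norm x) ^ N \<le> C ^ N * (1 + norm ?y) ^ N"
      unfolding power_mult_distrib[symmetric] by (rule power_mono) simp
    then have "(1 + norm x) ^ N * (\<bar>a\<bar> ^ length is * norm (iter_partial is \<psi> ?y))
        \<le> (C ^ N * (1 + norm ?y) ^ N) * (\<bar>a\<bar> ^ length is * norm (iter_partial is \<psi> ?y))"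
      by (intro mult_right_mono) auto
    also have "\<dots> = (C ^ N * \<bar>a\<bar> ^ length is) * ((1 + norm ?y) ^ N * norm (iter_partial is \<psi> ?y))"
      by simp
    also have "\<dots> \<le> (C ^ N * \<bar>a\<bar> ^ length is) * schwartz_seminorm N is \<psi>"
      by (intro mult_left_mono seminorm_upper assms) (auto simp: C_def)
    finally show ?thesis
      by (simp add: iter_partial_affine schwartz_smooth assms(1) power_abs)
  qed
  then show "\<exists>B. \<forall>x. (1 + norm x) ^ N * norm (iter_partial is (\<lambda>x. \<psi> (a *\<^sub>R x + v)) x) \<le> B" by blast
qed

definition translate :: "'a::real_normed_vector \<Rightarrow> ('a \<Rightarrow> complex) \<Rightarrow> 'a \<Rightarrow> complex" where
  "translate v \<psi> y = \<psi> (y - v)"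

lemma schwartz_translate: "\<psi> \<in> schwartz_space \<Longrightarrow> translate v \<psi> \<in> schwartz_space"
  using schwartz_affine[of \<psi> 1 "- v"] by (simp add: translate_def[abs_def])

lemma iter_partial_translate:
  "smooth \<psi> \<Longrightarrow> iter_partial is (translate v \<psi>) = translate v (iter_partial is \<psi>)"
  using iter_partial_affine[of \<psi> "is" 1 "- v"] by (simp add: translate_def[abs_def])

lemma seminorm_translate_le:
  assumes "\<psi> \<in> schwartz_space"
  shows "schwartz_seminorm N is (translate v \<psi>) \<le> (1 + norm v) ^ N * schwartz_seminorm N is \<psi>"
proof (rule seminorm_least)
  fix x
  have "(1 + norm x) ^ N \<le> ((1 + norm v) * (1 + norm (x - v))) ^ N"
    using one_plus_norm_add_le[of v "x - v"] by (intro power_mono) auto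
  then have "(1 + norm x) ^ N * norm (iter_partial is \<psi> (x - v))
      \<le> ((1 + norm v) * (1 + norm (x - v))) ^ N * norm (iter_partial is \<psi> (x - v))"
    by (rule mult_right_mono) simp
  also have "\<dots> \<le> (1 + norm v) ^ N * schwartz_seminorm N is \<psi>"
    using seminorm_upper[OF assms, of "x - v" N "is"]
    by (auto simp: power_mult_distrib mult.assoc intro!: mult_left_mono)
  finally show "(1 + norm x) ^ N * norm (iter_partial is (translate v \<psi>) x)
      \<le> (1 + norm v) ^ N * schwartz_seminorm N is \<psi>"
    using assms by (simp add: iter_partial_translate schwartz_smooth translate_def)
qed

lemma onorm_frechet_derivative_le:
  fixes f :: "real^'n::finite \<Rightarrow> complex"
  assumes "\<And>x. f differentiable (at x)"
  shows "onorm (frechet_derivative f (at x)) \<le> (\<Sum>i\<in>UNIV. norm (partial i f x))"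
    and "onorm (\<lambda>h. frechet_derivative f (at x) h - frechet_derivative f (at y) h)
      \<le> (\<Sum>i\<in>UNIV. norm (partial i f x - partial i f y))"
proof -
  have *: "norm (\<Sum>i\<in>UNIV. h $ i *\<^sub>R c i) \<le> (\<Sum>i\<in>UNIV. norm (c i)) * norm h"
    for h :: "real^'n" and c :: "'n \<Rightarrow> complex"
  proof -
    have "norm (\<Sum>i\<in>UNIV. h $ i *\<^sub>R c i) \<le> (\<Sum>i\<in>UNIV. norm h * norm (c i))"
      by (intro sum_norm_le) (auto intro!: mult_right_mono component_le_norm_cart)
    then show ?thesis by (simp add: sum_distrib_left mult.commute)
  qed
  show "onorm (frechet_derivative f (at x)) \<le> (\<Sum>i\<in>UNIV. norm (partial i f x))"
    by (rule onorm_le) (use * in \<open>simp add: frechet_derivative_eq_sum_partial assms\<close>)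
  show "onorm (\<lambda>h. frechet_derivative f (at x) h - frechet_derivative f (at y) h)
      \<le> (\<Sum>i\<in>UNIV. norm (partial i f x - partial i f y))"
  proof (rule onorm_le)
    fix h
    show "norm (frechet_derivative f (at x) h - frechet_derivative f (at y) h)
      \<le> (\<Sum>i\<in>UNIV. norm (partial i f x - partial i f y)) * norm h"
      using *[of h "\<lambda>i. partial i f x - partial i f y"]
      by (simp add: frechet_derivative_eq_sum_partial assms sum_subtractf scaleR_right_diff_distrib)
  qed
qed

text \<open>The mean value inequality along the segment from \<open>y - v\<close> to \<open>y - x\<close>.  Every point \<open>z\<close> of the segment
  satisfies \<open>\<bar>y - z\<bar> \<le> \<bar>v\<bar> + \<bar>x\<bar>\<close>, so the weight at \<open>y\<close> is comparable to the weight at \<open>z\<close>.  This one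
  estimate gives continuity of translation in the Schwartz space, the Riemann sum
  approximation of convolutions and the approximate identity.\<close>

lemma schwartz_increment:
  fixes \<psi> :: "real^'n::finite \<Rightarrow> complex"
  assumes "\<psi> \<in> schwartz_space"
  shows "(1 + norm y) ^ N * norm (iter_partial is \<psi> (y - v) - iter_partial is \<psi> (y - x))
    \<le> norm (v - x) * (1 + norm v + norm x) ^ N * (\<Sum>i\<in>UNIV. schwartz_seminorm N (i # is) \<psi>)"
    (is "_ \<le> _ * ?r ^ N * ?C")
proof -
  let ?g = "iter_partial is \<psi>"
  have C0: "0 \<le> ?C" by (intro sum_nonneg seminorm_nonneg assms)
  have pos: "0 < (1 + norm y) ^ N" by (simp add: add_pos_nonneg)
  let ?B = "?r ^ N * ?C / (1 + norm y) ^ N"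
  have "norm (?g (y - v) - ?g (y - x)) \<le> ?B * norm ((y - v) - (y - x))"
  proof (rule differentiable_bound)
    show "convex (closed_segment (y - v) (y - x))" by simp
    fix z assume z: "z \<in> closed_segment (y - v) (y - x)"
    show "(?g has_derivative frechet_derivative ?g (at z)) (at z within closed_segment (y - v) (y - x))"
      by (rule has_derivative_at_withinI[OF smooth_has_derivative[OF schwartz_smooth[OF assms]]])
    obtain u where u: "0 \<le> u" "u \<le> 1" "z = (1 - u) *\<^sub>R (y - v) + u *\<^sub>R (y - x)"
      using z by (auto simp: in_segment)
    then have "y - z = (1 - u) *\<^sub>R v + u *\<^sub>R x"
      by (simp add: algebra_simps)
    also have "norm \<dots> \<le> norm v + norm x"
      using u by (intro order_trans[OF norm_triangle_ineq] add_mono) (auto intro!: mult_left_le_one_le)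
    finally have "1 + norm (y - z) \<le> ?r" by simp
    then have "(1 + norm z) * (1 + norm (y - z)) \<le> (1 + norm z) * ?r"
      by (intro mult_left_mono) auto
    then have "1 + norm y \<le> (1 + norm z) * ?r"
      using one_plus_norm_add_le[of z "y - z"] by simp
    then have r: "(1 + norm y) ^ N \<le> (1 + norm z) ^ N * ?r ^ N"
      unfolding power_mult_distrib[symmetric] by (rule power_mono) simp
    have zpos: "0 < (1 + norm z) ^ N" by (simp add: add_pos_nonneg)
    have "(\<Sum>i\<in>UNIV. norm (partial i ?g z)) \<le> (\<Sum>i\<in>UNIV. schwartz_seminorm N (i # is) \<psi> / (1 + norm z) ^ N)"
      using schwartz_pointwise[OF assms, of "_ # is"] by (intro sum_mono) simp
    also have "\<dots> = ?C / (1 + norm z) ^ N"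
      by (simp add: sum_divide_distrib)
    also have "\<dots> \<le> ?B"
      using mult_right_mono[OF r C0] pos zpos by (simp add: field_simps)
    finally show "onorm (frechet_derivative ?g (at z)) \<le> ?B"
      using onorm_frechet_derivative_le(1)[of ?g z] smooth_differentiable[OF schwartz_smooth[OF assms]]
      by (meson order_trans)
  qed auto
  also have "norm ((y - v) - (y - x)) = norm (v - x)"
    by (simp add: norm_minus_commute)
  finally show ?thesis
    using pos by (simp add: field_simps)
qed

lemma seminorm_translate_diff_le:
  fixes \<psi> :: "real^'n::finite \<Rightarrow> complex"
  assumes "\<psi> \<in> schwartz_space"
  shows "schwartz_seminorm N is (\<lambda>y. translate v \<psi> y - translate x \<psi> y)
    \<le> norm (v - x) * (1 + norm v + norm x) ^ N * (\<Sum>i\<in>UNIV. schwartz_seminorm N (i # is) \<psi>)"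
proof (rule seminorm_least)
  fix y
  have "iter_partial is (\<lambda>y. translate v \<psi> y - translate x \<psi> y) y
      = iter_partial is \<psi> (y - v) - iter_partial is \<psi> (y - x)"
    using assms schwartz_translate[OF assms]
    by (simp add: iter_partial_diff[of "translate v \<psi>" "translate x \<psi>"] iter_partial_translate
        schwartz_smooth translate_def[of _ "iter_partial is \<psi>"])
  then show "(1 + norm y) ^ N * norm (iter_partial is (\<lambda>y. translate v \<psi> y - translate x \<psi> y) y)
    \<le> norm (v - x) * (1 + norm v + norm x) ^ N * (\<Sum>i\<in>UNIV. schwartz_seminorm N (i # is) \<psi>)"
    using schwartz_increment[OF assms, of y N "is" v x] by simp
qed

text \<open>A first-order Taylor formula with a remainder that is uniform in the base point; this uniformity is what permits
  differentiation under the integral sign of a convolution.\<close>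

lemma schwartz_taylor1:
  fixes \<psi> :: "real^'n::finite \<Rightarrow> complex"
  assumes "\<psi> \<in> schwartz_space"
  obtains C where "\<And>z h. norm (iter_partial is \<psi> (z + h) - iter_partial is \<psi> z
      - (\<Sum>i\<in>UNIV. h $ i *\<^sub>R iter_partial (i # is) \<psi> z)) \<le> C * (norm h)\<^sup>2"
proof -
  let ?g = "iter_partial is \<psi>"
  define C where "C = (\<Sum>i\<in>UNIV. \<Sum>j\<in>UNIV. schwartz_seminorm 0 (j # i # is) \<psi>)"
  have diff: "?g differentiable (at x)" for x
    by (intro smooth_differentiable schwartz_smooth assms)
  have "norm (?g (z + h) - ?g z - (\<Sum>i\<in>UNIV. h $ i *\<^sub>R iter_partial (i # is) \<psi> z)) \<le> C * (norm h)\<^sup>2" for z h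
  proof -
    let ?S = "closed_segment z (z + h)"
    have "norm (?g (z + h) - ?g z - frechet_derivative ?g (at z) ((z + h) - z)) \<le> norm ((z + h) - z) * (C * norm h)"
    proof (rule differentiable_bound_linearization[where S = ?S])
      fix x assume x: "x \<in> ?S"
      show "(?g has_derivative frechet_derivative ?g (at x)) (at x within ?S)"
        by (rule has_derivative_at_withinI[OF smooth_has_derivative[OF schwartz_smooth[OF assms]]])
      have "norm (x - z) \<le> norm h"
        using segment_bound1[OF x] by (simp add: norm_minus_commute)
      have "(\<Sum>i\<in>UNIV. norm (partial i ?g x - partial i ?g z)) \<le> (\<Sum>i\<in>UNIV. norm h * (\<Sum>j\<in>UNIV. schwartz_seminorm 0 (j # i # is) \<psi>))"
      proof (rule sum_mono)
        fix i
        have "norm (partial i ?g x - partial i ?g z) \<le> norm (x - z) * (\<Sum>j\<in>UNIV. schwartz_seminorm 0 (j # i # is) \<psi>)"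
          using schwartz_increment[OF assms, of 0 0 "i # is" "- x" "- z"] by (simp add: norm_minus_commute)
        also have "\<dots> \<le> norm h * (\<Sum>j\<in>UNIV. schwartz_seminorm 0 (j # i # is) \<psi>)"
          by (intro mult_right_mono sum_nonneg seminorm_nonneg assms) fact
        finally show "norm (partial i ?g x - partial i ?g z) \<le> norm h * (\<Sum>j\<in>UNIV. schwartz_seminorm 0 (j # i # is) \<psi>)" .
      qed
      then show "onorm (frechet_derivative ?g (at x) - frechet_derivative ?g (at z)) \<le> C * norm h"
        using onorm_frechet_derivative_le(2)[of ?g x z, OF diff]
        by (simp add: C_def sum_distrib_left fun_diff_def mult.commute)
    qed (auto simp: in_segment algebra_simps)
    then show ?thesis
      by (simp add: frechet_derivative_eq_sum_partial[OF diff] power2_eq_square mult.commute mult.left_commute)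
  qed
  then show thesis by (rule that)
qed

section \<open>Affine changes of variables\<close>

lemma lborel_integral_affine:
  fixes f :: "'a::euclidean_space \<Rightarrow> 'b::{banach, second_countable_topology}"
  assumes c: "c \<noteq> 0" and f [measurable]: "f \<in> borel_measurable borel"
  shows "integrable lborel f \<longleftrightarrow> integrable lborel (\<lambda>x. f (v + c *\<^sub>R x))" (is ?int)
    and "integral\<^sup>L lborel f = \<bar>c\<bar> ^ DIM('a) *\<^sub>R (LBINT x. f (v + c *\<^sub>R x))" (is ?eq)
proof -
  let ?g = "\<lambda>x::'a. v + c *\<^sub>R x" and ?d = "\<bar>c\<bar> ^ DIM('a)"
  have L: "lborel = density (distr lborel borel ?g) (\<lambda>_. ennreal ?d)"
    using lborel_affine[OF c, of v] by (simp add: ennreal_power)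
  have g [measurable]: "?g \<in> lborel \<rightarrow>\<^sub>M borel" by measurable
  have "integrable lborel f \<longleftrightarrow> integrable (distr lborel borel ?g) (\<lambda>x. ?d *\<^sub>R f x)"
    by (subst L, subst integrable_density) auto
  also have "\<dots> \<longleftrightarrow> integrable lborel (\<lambda>x. ?d *\<^sub>R f (?g x))"
    by (subst integrable_distr_eq) auto
  also have "\<dots> \<longleftrightarrow> integrable lborel (\<lambda>x. f (?g x))"
    using c integrable_scaleR_right[of "1 / ?d" lborel "\<lambda>x. ?d *\<^sub>R f (?g x)"] by auto
  finally show ?int .
  have "integral\<^sup>L lborel f = integral\<^sup>L (distr lborel borel ?g) (\<lambda>x. ?d *\<^sub>R f x)"
    by (subst L, subst integral_density) auto
  also have "\<dots> = ?d *\<^sub>R (LBINT x. f (?g x))"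
    by (subst integral_distr) auto
  finally show ?eq .
qed

section \<open>Convolution\<close>

definition conv :: "('a::euclidean_space \<Rightarrow> complex) \<Rightarrow> ('a \<Rightarrow> complex) \<Rightarrow> 'a \<Rightarrow> complex" where
  "conv a b y = (LBINT x. a x * b (y - x))"

text \<open>Measurable functions with all polynomial moments.  Besides Schwartz functions this class contains
  bounded functions that vanish outside a bounded set, and it is mapped into the Schwartz space by convolution with
  a Schwartz function.\<close>

definition rapid :: "('a::euclidean_space \<Rightarrow> complex) \<Rightarrow> bool" where
  "rapid a \<longleftrightarrow> a \<in> borel_measurable borel \<and>
     (\<forall>N. integrable lborel (\<lambda>x. (1 + norm x) ^ N * norm (a x)))"

lemma rapid_integrable: "rapid a \<Longrightarrow> integrable lborel a"
  using integrable_norm_iff[of a lborel] by (auto simp: rapid_def dest: spec[of _ 0])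

lemma schwartz_measurable:
  "\<psi> \<in> schwartz_space \<Longrightarrow> iter_partial is \<psi> \<in> borel_measurable borel"
  by (rule borel_measurable_continuous_onI[OF smooth_continuous_on[OF schwartz_smooth]])

lemma integrable_mult_schwartz:
  assumes "integrable lborel a" "\<psi> \<in> schwartz_space" "g \<in> borel \<rightarrow>\<^sub>M borel"
  shows "integrable lborel (\<lambda>x. a x * iter_partial is \<psi> (g x))"
proof (rule Bochner_Integration.integrable_bound)
  show "integrable lborel (\<lambda>x. schwartz_seminorm 0 is \<psi> * norm (a x))"
    using assms(1) by simp
  have [measurable]: "a \<in> borel_measurable borel" "iter_partial is \<psi> \<in> borel_measurable borel"
    using assms schwartz_measurable by auto
  note assms(3)[measurable]
  show "(\<lambda>x. a x * iter_partial is \<psi> (g x)) \<in> borel_measurable lborel"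
    by measurable
  show "AE x in lborel. norm (a x * iter_partial is \<psi> (g x))
      \<le> norm (schwartz_seminorm 0 is \<psi> * norm (a x))"
    using schwartz_bounded[OF assms(2)] seminorm_nonneg[OF assms(2)]
    by (intro AE_I2)
      (simp only: norm_mult real_norm_def abs_mult abs_of_nonneg norm_ge_zero abs_norm_cancel mult.commute mult_left_mono)
qed

lemma conv_commute:
  assumes [measurable]: "a \<in> borel_measurable borel" "b \<in> borel_measurable borel"
  shows "conv a b = conv b a"
proof
  fix y
  show "conv a b y = conv b a y"
    unfolding conv_def
    by (subst lborel_integral_affine(2)[where c = "-1" and v = y]) (auto simp: mult.commute)
qed

text \<open>All derivatives fall on the Schwartz factor, so the other factor only has to be integrable.\<close>

lemma conv_has_derivative:
  fixes a :: "real^'n::finite \<Rightarrow> complex"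
  assumes a: "integrable lborel a" and b: "b \<in> schwartz_space"
  shows "(conv a (iter_partial is b) has_derivative
     (\<lambda>h. \<Sum>i\<in>UNIV. h $ i *\<^sub>R conv a (iter_partial (i # is) b) y)) (at y)" (is "(?f has_derivative ?D) _")
proof -
  obtain C where C: "\<And>z h. norm (iter_partial is b (z + h) - iter_partial is b z
      - (\<Sum>i\<in>UNIV. h $ i *\<^sub>R iter_partial (i # is) b z)) \<le> C * (norm h)\<^sup>2"
    using schwartz_taylor1[OF b] by blast
  have int: "integrable lborel (\<lambda>x. a x * iter_partial js b (z - x))" for js z
    using a b by (rule integrable_mult_schwartz) simp
  define K where "K = (LBINT x. norm (a x)) * C"
  have est: "norm (?f (y + h) - ?f y - ?D h) \<le> K * (norm h)\<^sup>2" for h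
  proof -
    let ?e = "\<lambda>x. iter_partial is b ((y - x) + h) - iter_partial is b (y - x)
      - (\<Sum>i\<in>UNIV. h $ i *\<^sub>R iter_partial (i # is) b (y - x))"
    have "?f (y + h) - ?f y - ?D h =
       (LBINT x. (a x * iter_partial is b (y + h - x) - a x * iter_partial is b (y - x)
         - (\<Sum>i\<in>UNIV. h $ i *\<^sub>R (a x * iter_partial (i # is) b (y - x)))))"
      unfolding conv_def using int[of "_ # is"] by (simp add: int)
    also have "\<dots> = (LBINT x. a x * ?e x)"
      by (intro Bochner_Integration.integral_cong refl)
        (simp add: algebra_simps sum_distrib_left)
    also have "norm \<dots> \<le> (LBINT x. norm (a x) * (C * (norm h)\<^sup>2))"
    proof (rule Bochner_Integration.integral_norm_bound_integral)
      have eq: "(\<lambda>x. a x * ?e x) = (\<lambda>x. (a x * iter_partial is b (y + h - x) - a x * iter_partial is b (y - x)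
         - (\<Sum>i\<in>UNIV. h $ i *\<^sub>R (a x * iter_partial (i # is) b (y - x)))))"
        by (auto simp: algebra_simps sum_distrib_left)
      show "integrable lborel (\<lambda>x. a x * ?e x)"
        unfolding eq using int[of "_ # is"] by (auto intro!: int)
      show "integrable lborel (\<lambda>x. norm (a x) * (C * (norm h)\<^sup>2))"
        using a by simp
      show "norm (a x * ?e x) \<le> norm (a x) * (C * (norm h)\<^sup>2)" for x
        unfolding norm_mult by (intro mult_left_mono C) simp
    qed
    finally show ?thesis by (simp add: K_def mult.assoc)
  qed
  show ?thesis
    unfolding has_derivative_at
  proof
    have "linear ?D"
      by (intro linearI) (auto simp: algebra_simps sum.distrib scaleR_sum_right)
    then show "bounded_linear ?D" by (rule linear_conv_bounded_linear[THEN iffD1])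
    show "(\<lambda>h. norm (?f (y + h) - ?f y - ?D h) / norm h) \<midarrow>0\<rightarrow> 0"
    proof (rule tendsto_sandwich[of "\<lambda>_. 0"])
      show "\<forall>\<^sub>F h in at 0. norm (?f (y + h) - ?f y - ?D h) / norm h \<le> K * norm h"
        using est by (intro eventually_at_filter[THEN iffD2] always_eventually)
          (auto simp: divide_le_eq power2_eq_square mult.assoc)
      show "((\<lambda>h. K * norm h) \<longlongrightarrow> 0) (at 0)"
        by (auto intro!: tendsto_eq_intros)
    qed (auto simp: eventually_at_filter)
  qed
qed

lemma iter_partial_conv:
  fixes a :: "real^'n::finite \<Rightarrow> complex"
  assumes "integrable lborel a" "b \<in> schwartz_space"
  shows "iter_partial is (conv a b) = conv a (iter_partial is b)"
proof (induction "is")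
  case (Cons i "is")
  have "partial i (conv a (iter_partial is b)) y = conv a (iter_partial (i # is) b) y" for y
    using partial_eq[OF conv_has_derivative[OF assms], of i]
    by (simp add: axis_def if_distrib[of "\<lambda>c. c *\<^sub>R _"] sum.delta' cong: if_cong)
  with Cons show ?case by auto
qed auto

lemma smooth_conv:
  fixes a :: "real^'n::finite \<Rightarrow> complex"
  assumes "integrable lborel a" "b \<in> schwartz_space"
  shows "smooth (conv a b)"
  unfolding smooth_def iter_partial_conv[OF assms]
  using conv_has_derivative[OF assms] unfolding differentiable_def by blast

text \<open>Submultiplicativity of \<open>1 + \<bar>x\<bar>\<close> splits the weight between the two factors.\<close>

lemma weighted_norm_conv_le:
  fixes a :: "real^'n::finite \<Rightarrow> complex"
  assumes "rapid a" "b \<in> schwartz_space"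
  shows "(1 + norm y) ^ N * norm (iter_partial is (conv a b) y)
    \<le> (LBINT x. (1 + norm x) ^ N * norm (a x)) * schwartz_seminorm N is b"
proof -
  have a: "integrable lborel a"
    using assms(1) by (rule rapid_integrable)
  have "(1 + norm y) ^ N * norm (iter_partial is (conv a b) y)
      = norm (LBINT x. (1 + norm y) ^ N *\<^sub>R (a x * iter_partial is b (y - x)))"
    by (simp add: iter_partial_conv[OF a assms(2)] conv_def)
  also have "\<dots> \<le> (LBINT x. (1 + norm x) ^ N * norm (a x) * schwartz_seminorm N is b)"
  proof (rule Bochner_Integration.integral_norm_bound_integral)
    show "integrable lborel (\<lambda>x. (1 + norm y) ^ N *\<^sub>R (a x * iter_partial is b (y - x)))"
      using integrable_mult_schwartz[OF a assms(2), of "\<lambda>x. y - x"] by simp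
    show "integrable lborel (\<lambda>x. (1 + norm x) ^ N * norm (a x) * schwartz_seminorm N is b)"
      using assms(1) by (simp add: rapid_def)
    fix x
    have "(1 + norm y) ^ N \<le> (1 + norm x) ^ N * (1 + norm (y - x)) ^ N"
      unfolding power_mult_distrib[symmetric]
      using one_plus_norm_add_le[of x "y - x"] by (intro power_mono) auto
    then have "(1 + norm y) ^ N * (norm (a x) * norm (iter_partial is b (y - x)))
      \<le> ((1 + norm x) ^ N * (1 + norm (y - x)) ^ N) * (norm (a x) * norm (iter_partial is b (y - x)))"
      by (rule mult_right_mono) simp
    also have "\<dots> = ((1 + norm x) ^ N * norm (a x)) * ((1 + norm (y - x)) ^ N * norm (iter_partial is b (y - x)))"
      by simp
    also have "\<dots> \<le> (1 + norm x) ^ N * norm (a x) * schwartz_seminorm N is b"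
      by (intro mult_left_mono seminorm_upper assms) auto
    finally show "norm ((1 + norm y) ^ N *\<^sub>R (a x * iter_partial is b (y - x)))
      \<le> (1 + norm x) ^ N * norm (a x) * schwartz_seminorm N is b"
      by (simp add: norm_mult)
  qed
  finally show ?thesis by simp
qed

lemma schwartz_conv:
  fixes a :: "real^'n::finite \<Rightarrow> complex"
  assumes "rapid a" "b \<in> schwartz_space"
  shows "conv a b \<in> schwartz_space"
  using smooth_conv[OF rapid_integrable[OF assms(1)] assms(2)] weighted_norm_conv_le[OF assms]
  by (intro schwartzI) blast+

section \<open>Tempered distributions and integrals\<close>

lemma topspace_schwartz:
  "topspace schwartz_topology = (schwartz_space :: (real^'n::finite \<Rightarrow> complex) set)"
proof
  show "topspace schwartz_topology \<subseteq> (schwartz_space :: (real^'n \<Rightarrow> complex) set)"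
    unfolding schwartz_topology_def topology_generated_by_topspace by blast
  show "schwartz_space \<subseteq> topspace (schwartz_topology :: (real^'n \<Rightarrow> complex) topology)"
  proof
    fix \<psi> :: "real^'n \<Rightarrow> complex" assume \<psi>: "\<psi> \<in> schwartz_space"
    let ?U = "{\<psi>' \<in> schwartz_space. schwartz_seminorm 0 [] (\<lambda>x. \<psi>' x - \<psi> x) < 1}"
    have "schwartz_seminorm 0 [] (\<lambda>x. \<psi> x - \<psi> x) \<le> 0"
      by (rule seminorm_least) simp
    then have "\<psi> \<in> ?U" using \<psi> by simp
    moreover have "openin schwartz_topology ?U"
      unfolding schwartz_topology_def openin_topology_generated_by_iff
      by (rule generate_topology_on.Basis) (use \<psi> zero_less_one in blast)
    ultimately show "\<psi> \<in> topspace schwartz_topology"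
      using openin_subset by blast
  qed
qed

text \<open>It suffices to treat the subbasic sets that generate the topology, and for these the
  triangle inequality for the seminorm is enough.\<close>

lemma limitin_schwartz_topology:
  assumes S: "\<And>n. \<psi> n \<in> schwartz_space" "\<theta> \<in> schwartz_space"
    and lim: "\<And>N is. (\<lambda>n. schwartz_seminorm N is (\<lambda>x. \<psi> n x - \<theta> x)) \<longlonglongrightarrow> 0"
  shows "limitin schwartz_topology \<psi> \<theta> sequentially"
  unfolding limitin_def topspace_schwartz
proof (intro conjI allI impI)
  fix U assume "openin schwartz_topology U \<and> \<theta> \<in> U"
  then have "generate_topology_on {{\<psi> \<in> schwartz_space. schwartz_seminorm N is (\<lambda>x. \<psi> x - \<theta> x) < \<epsilon>} |N is \<theta> \<epsilon>.
        \<theta> \<in> schwartz_space \<and> \<epsilon> > 0} U" and "\<theta> \<in> U"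
    by (auto simp: schwartz_topology_def openin_topology_generated_by_iff)
  then show "\<forall>\<^sub>F n in sequentially. \<psi> n \<in> U"
  proof (induction rule: generate_topology_on.induct)
    case (Int a b)
    then show ?case by (auto intro: eventually_conj)
  next
    case (UN K)
    then obtain k where "k \<in> K" "\<forall>\<^sub>F n in sequentially. \<psi> n \<in> k" by blast
    then show ?case by (auto elim: eventually_mono)
  next
    case (Basis s)
    then obtain N "is" \<theta>' \<epsilon> where s: "s = {\<psi> \<in> schwartz_space. schwartz_seminorm N is (\<lambda>x. \<psi> x - \<theta>' x) < \<epsilon>}"
      and \<theta>': "\<theta>' \<in> schwartz_space" by blast
    then have "0 < \<epsilon> - schwartz_seminorm N is (\<lambda>x. \<theta> x - \<theta>' x)"
      using Basis by auto
    then have "\<forall>\<^sub>F n in sequentially. schwartz_seminorm N is (\<lambda>x. \<psi> n x - \<theta> x)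
        < \<epsilon> - schwartz_seminorm N is (\<lambda>x. \<theta> x - \<theta>' x)"
      using order_tendstoD(2)[OF lim] by blast
    then show ?case
    proof eventually_elim
      case (elim n)
      have "schwartz_seminorm N is (\<lambda>x. (\<psi> n x - \<theta> x) + (\<theta> x - \<theta>' x))
        \<le> schwartz_seminorm N is (\<lambda>x. \<psi> n x - \<theta> x) + schwartz_seminorm N is (\<lambda>x. \<theta> x - \<theta>' x)"
        by (intro seminorm_add_le schwartz_diff S \<theta>')
      with elim S show ?case by (simp add: s)
    qed
  qed auto
qed (use S in auto)

lemma tempered_tendsto:
  assumes "T \<in> tempered_distributions"
    and S: "\<And>n. \<psi> n \<in> schwartz_space" "\<theta> \<in> schwartz_space"
    and lim: "\<And>N is. (\<lambda>n. schwartz_seminorm N is (\<lambda>x. \<psi> n x - \<theta> x)) \<longlonglongrightarrow> 0"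
  shows "(\<lambda>n. T (\<psi> n)) \<longlonglongrightarrow> T \<theta>"
  using continuous_map_limit[OF _ limitin_schwartz_topology[OF S lim], of euclidean T] assms(1)
  by (simp add: tempered_distributions_def o_def limitin_canonical_iff)

lemma tempered_add:
  "T \<in> tempered_distributions \<Longrightarrow> \<psi> \<in> schwartz_space \<Longrightarrow> \<theta> \<in> schwartz_space \<Longrightarrow>
    T (\<lambda>x. \<psi> x + \<theta> x) = T \<psi> + T \<theta>"
  by (simp add: tempered_distributions_def)

lemma tempered_cmult:
  "T \<in> tempered_distributions \<Longrightarrow> \<psi> \<in> schwartz_space \<Longrightarrow> T (\<lambda>x. c * \<psi> x) = c * T \<psi>"
  by (simp add: tempered_distributions_def)

lemma tempered_zero: "T \<in> tempered_distributions \<Longrightarrow> T (\<lambda>x. 0) = 0"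
  using tempered_cmult[of T "\<lambda>x. 0" 0] by (simp add: schwartz_zero)

lemma tempered_sum:
  assumes "T \<in> tempered_distributions" "finite I" "\<And>i. i \<in> I \<Longrightarrow> \<psi> i \<in> schwartz_space"
  shows "T (\<lambda>x. \<Sum>i\<in>I. \<psi> i x) = (\<Sum>i\<in>I. T (\<psi> i))"
  using assms(2,3)
proof (induction I)
  case (insert i I)
  then show ?case
    using tempered_add[OF assms(1), of "\<psi> i" "\<lambda>x. \<Sum>i\<in>I. \<psi> i x"] by (simp add: schwartz_sum)
qed (simp add: tempered_zero assms(1))

lemma continuous_tempered_translate:
  fixes \<eta> :: "real^'n::finite \<Rightarrow> complex"
  assumes T: "T \<in> tempered_distributions" and \<eta>: "\<eta> \<in> schwartz_space"
  shows "continuous_on UNIV (\<lambda>x. T (translate x \<eta>))"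
proof (rule continuous_on_sequentiallyI)
  fix u and x :: "real^'n" assume u: "u \<longlonglongrightarrow> x"
  show "(\<lambda>n. T (translate (u n) \<eta>)) \<longlonglongrightarrow> T (translate x \<eta>)"
  proof (rule tempered_tendsto[OF T])
    fix N "is"
    let ?C = "\<Sum>i\<in>UNIV. schwartz_seminorm N (i # is) \<eta>"
    show "(\<lambda>n. schwartz_seminorm N is (\<lambda>y. translate (u n) \<eta> y - translate x \<eta> y)) \<longlonglongrightarrow> 0"
    proof (rule tendsto_sandwich[of "\<lambda>_. 0"])
      have "(\<lambda>n. norm (u n - x) * (1 + norm (u n) + norm x) ^ N * ?C) \<longlonglongrightarrow> norm (x - x) * (1 + norm x + norm x) ^ N * ?C"
        by (intro tendsto_intros u)
      then show "(\<lambda>n. norm (u n - x) * (1 + norm (u n) + norm x) ^ N * ?C) \<longlonglongrightarrow> 0"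
        by simp
    qed (auto intro!: always_eventually seminorm_translate_diff_le[OF \<eta>] seminorm_nonneg schwartz_diff schwartz_translate \<eta>)
  qed (auto intro: schwartz_translate \<eta>)
qed

text \<open>If the growth were faster than polynomial along some sequence \<open>x n\<close>, the translates of \<open>\<eta>\<close> by \<open>x n\<close>, divided by
  \<open>n (1 + \<bar>x n\<bar>)\<^sup>n\<close>, would tend to \<open>0\<close> in the Schwartz space, whereas the values of \<open>T\<close> on them exceed 1
  in absolute value.\<close>

lemma tempered_translate_growth:
  assumes T: "T \<in> tempered_distributions" and \<eta>: "\<eta> \<in> schwartz_space"
  shows "\<exists>N::nat. \<forall>x. norm (T (translate x \<eta>)) \<le> real N * (1 + norm x) ^ N"
proof (rule ccontr)
  assume "\<not> ?thesis"
  then have "\<forall>n::nat. \<exists>x. norm (T (translate x \<eta>)) > real n * (1 + norm x) ^ n"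
    by (simp add: not_le)
  then obtain x where x: "\<And>n::nat. norm (T (translate (x n) \<eta>)) > real n * (1 + norm (x n)) ^ n"
    by metis
  define r where "r n = real n * (1 + norm (x n)) ^ n" for n :: nat
  define \<psi> where "\<psi> n = (\<lambda>y. of_real (1 / r n) * translate (x n) \<eta> y)" for n
  have rpos: "r n > 0" if "n > 0" for n
    using that by (simp add: r_def add_pos_nonneg)
  have S: "\<psi> n \<in> schwartz_space" for n
    unfolding \<psi>_def by (intro schwartz_cmult schwartz_translate \<eta>)
  have "(\<lambda>n. T (\<psi> n)) \<longlonglongrightarrow> T (\<lambda>y. 0)"
  proof (rule tempered_tendsto[OF T S schwartz_zero])
    fix N "is"
    show "(\<lambda>n. schwartz_seminorm N is (\<lambda>y. \<psi> n y - 0)) \<longlonglongrightarrow> 0"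
    proof (rule tendsto_sandwich[of "\<lambda>_. 0"])
      show "\<forall>\<^sub>F n in sequentially. schwartz_seminorm N is (\<lambda>y. \<psi> n y - 0) \<le> schwartz_seminorm N is \<eta> / real n"
        using eventually_ge_at_top[of "Suc N"]
      proof eventually_elim
        case (elim n)
        then have n: "n > 0" by simp
        have "schwartz_seminorm N is (\<psi> n) \<le> norm (of_real (1 / r n) :: complex) * schwartz_seminorm N is (translate (x n) \<eta>)"
          unfolding \<psi>_def by (intro seminorm_cmult_le schwartz_translate \<eta>)
        also have "\<dots> \<le> (1 / r n) * ((1 + norm (x n)) ^ N * schwartz_seminorm N is \<eta>)"
          using rpos[OF n] unfolding norm_of_real
          by (intro mult_mono seminorm_translate_le seminorm_nonneg schwartz_translate \<eta>) auto
        also have "\<dots> \<le> (1 / r n) * ((1 + norm (x n)) ^ n * schwartz_seminorm N is \<eta>)"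
          using rpos[OF n] elim
          by (intro mult_left_mono mult_right_mono power_increasing seminorm_nonneg \<eta>) auto
        also have "\<dots> = schwartz_seminorm N is \<eta> / real n"
        proof -
          have "1 + norm (x n) \<noteq> 0" using norm_ge_zero[of "x n"] by linarith
          then show ?thesis using n by (simp add: r_def)
        qed
        finally show ?case by simp
      qed
      show "(\<lambda>n. schwartz_seminorm N is \<eta> / real n) \<longlonglongrightarrow> 0"
        by (rule lim_const_over_n)
    qed (auto intro!: always_eventually seminorm_nonneg S)
  qed
  then have "(\<lambda>n. norm (T (\<psi> n))) \<longlonglongrightarrow> 0"
    by (simp add: tempered_zero[OF T] tendsto_norm_zero_iff)
  then have "\<forall>\<^sub>F n in sequentially. norm (T (\<psi> n)) < 1"
    by (rule order_tendstoD) simp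
  then obtain M where "\<And>n. n \<ge> M \<Longrightarrow> norm (T (\<psi> n)) < 1"
    by (auto simp: eventually_sequentially)
  from this[of "Suc M"] have "norm (T (\<psi> (Suc M))) < 1" by simp
  moreover have "T (\<psi> (Suc M)) = of_real (1 / r (Suc M)) * T (translate (x (Suc M)) \<eta>)"
    unfolding \<psi>_def by (intro tempered_cmult T schwartz_translate \<eta>)
  ultimately have "norm (T (translate (x (Suc M)) \<eta>)) / r (Suc M) < 1"
    using rpos[of "Suc M"] by (simp add: norm_divide)
  then show False
    using x[of "Suc M"] rpos[of "Suc M"] unfolding r_def[symmetric] by simp
qed

section \<open>Rapid decrease\<close>

text \<open>A dyadic decomposition: on the shell where \<open>1 + \<bar>x\<bar>\<close> is about \<open>2\<^sup>n\<close> the integrand is about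
  \<open>2 ^ (- n (d + 1))\<close> and the volume is at most a constant times \<open>2 ^ (n d)\<close>.\<close>

lemma integrable_inverse_weight:
  "integrable lborel (\<lambda>x::'a::euclidean_space. 1 / (1 + norm x) ^ Suc DIM('a))"
proof (rule integrableI_bounded)
  let ?K = "Suc DIM('a)"
  define V where "V = unit_ball_vol (real DIM('a))"
  let ?g = "\<lambda>n (x::'a). ennreal (2 ^ ?K / 2 ^ (n * ?K)) * indicator (ball 0 (2 ^ n)) x"
  have V: "0 \<le> V" by (simp add: V_def unit_ball_vol_nonneg)
  have "(\<integral>\<^sup>+x. ennreal (norm (1 / (1 + norm (x::'a)) ^ ?K)) \<partial>lborel)
      \<le> (\<integral>\<^sup>+x. (\<Sum>n. ?g n x) \<partial>lborel)"
  proof (rule nn_integral_mono)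
    fix x :: 'a
    obtain m where "1 + norm x < 2 ^ m"
      using real_arch_pow[of 2 "1 + norm x"] by auto
    then have n: "1 + norm x < 2 ^ (LEAST m. 1 + norm x < 2 ^ m)"
      by (rule LeastI)
    define n where "n = (LEAST m. 1 + norm x < 2 ^ m)"
    have "n \<noteq> 0"
      using n norm_ge_zero[of x] by (auto simp: n_def[symmetric] intro!: Nat.gr0I)
    then obtain k where k: "n = Suc k" by (cases n) auto
    have le: "2 ^ k \<le> 1 + norm x"
      using not_less_Least[of k "\<lambda>m. 1 + norm x < 2 ^ m"] k by (simp add: n_def)
    have "1 / (1 + norm x) ^ ?K \<le> 1 / (2 ^ k) ^ ?K"
      using le by (intro divide_left_mono power_mono mult_pos_pos) (auto simp: add_pos_nonneg)
    also have "\<dots> = 2 ^ ?K / 2 ^ (n * ?K)"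
      by (simp add: k power_mult[symmetric] power_add algebra_simps)
    finally have "ennreal (1 / (1 + norm x) ^ ?K) \<le> ?g n x"
      using n by (simp add: n_def[symmetric] ennreal_leI)
    also have "f n \<le> suminf f" for f :: "nat \<Rightarrow> ennreal"
      using sum_le_suminf[of f "{n}"] by simp
    then have "?g n x \<le> (\<Sum>n. ?g n x)" .
    finally show "ennreal (norm (1 / (1 + norm x) ^ ?K)) \<le> (\<Sum>n. ?g n x)"
      by simp
  qed
  also have "\<dots> = (\<Sum>n. \<integral>\<^sup>+x. ?g n x \<partial>lborel)"
    by (rule nn_integral_suminf) (auto intro!: borel_measurable_times_ennreal borel_measurable_indicator)
  also have "\<dots> = (\<Sum>n. ennreal (2 ^ ?K * V * (1 / 2) ^ n))"
  proof (rule suminf_cong)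
    fix n
    have "(\<integral>\<^sup>+x. ?g n x \<partial>lborel) = ennreal (2 ^ ?K / 2 ^ (n * ?K)) * ennreal (V * (2 ^ n) ^ DIM('a))"
      by (simp add: nn_integral_cmult_indicator emeasure_ball V_def)
    also have "\<dots> = ennreal (2 ^ ?K * V * (1 / 2) ^ n)"
      using V by (simp add: ennreal_mult[symmetric] power_mult[symmetric] power_add power_divide)
    finally show "(\<integral>\<^sup>+x. ?g n x \<partial>lborel) = ennreal (2 ^ ?K * V * (1 / 2) ^ n)" .
  qed
  also have "\<dots> < \<infinity>"
    unfolding less_top[symmetric] infinity_ennreal_def using V
    by (intro ennreal_suminf_neq_top summable_mult summable_geometric) auto
  finally show "(\<integral>\<^sup>+x. ennreal (norm (1 / (1 + norm (x::'a)) ^ ?K)) \<partial>lborel) < \<infinity>" .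
qed measurable

lemma schwartz_rapid:
  fixes \<psi> :: "real^'n::finite \<Rightarrow> complex"
  assumes "\<psi> \<in> schwartz_space"
  shows "rapid \<psi>"
  unfolding rapid_def
proof (intro conjI allI)
  show [measurable]: "\<psi> \<in> borel_measurable borel"
    using schwartz_measurable[OF assms, of "[]"] by simp
  fix N
  let ?K = "Suc CARD('n)"
  show "integrable lborel (\<lambda>x. (1 + norm x) ^ N * norm (\<psi> x))"
  proof (rule Bochner_Integration.integrable_bound)
    show "integrable lborel (\<lambda>x::real^'n. schwartz_seminorm (N + ?K) [] \<psi> * (1 / (1 + norm x) ^ ?K))"
      using integrable_inverse_weight[where 'a="real^'n"]
      by (intro integrable_mult_right) (simp only: DIM_cart DIM_real mult_1_right)
    show "AE x in lborel. norm ((1 + norm x) ^ N * norm (\<psi> x))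
      \<le> norm (schwartz_seminorm (N + ?K) [] \<psi> * (1 / (1 + norm x) ^ ?K))"
    proof (rule AE_I2)
      fix x :: "real^'n"
      have "0 < (1 + norm x) ^ ?K" by (rule zero_less_power) (simp add: add_pos_nonneg)
      then show "norm ((1 + norm x) ^ N * norm (\<psi> x))
        \<le> norm (schwartz_seminorm (N + ?K) [] \<psi> * (1 / (1 + norm x) ^ ?K))"
        using seminorm_upper[OF assms, of x "N + ?K" "[]"] seminorm_nonneg[OF assms, of "N + ?K" "[]"]
        by (simp add: field_simps power_add abs_mult)
    qed
  qed measurable
qed

section \<open>Distributions under the integral sign\<close>

lemma integral_simple_range:
  fixes a :: "'a \<Rightarrow> complex"
  assumes a: "integrable M a" and s: "simple_function M s"
  shows "(\<integral>x. a x * F (s x) \<partial>M)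
    = (\<Sum>v\<in>s ` space M. (\<integral>x. indicator (s -` {v} \<inter> space M) x *\<^sub>R a x \<partial>M) * F v)"
proof -
  let ?A = "\<lambda>v. s -` {v} \<inter> space M"
  have fin: "finite (s ` space M)"
    using s by (rule simple_functionD)
  have eq: "a x * F (s x) = (\<Sum>v\<in>s ` space M. (indicator (?A v) x *\<^sub>R a x) * F v)" if "x \<in> space M" for x
  proof -
    have "(\<Sum>v\<in>s ` space M. (indicator (?A v) x *\<^sub>R a x) * F v)
      = (\<Sum>v\<in>s ` space M. if v = s x then a x * F v else 0)"
      using that by (intro sum.cong) (auto simp: indicator_def)
    then show ?thesis
      using fin that by (simp add: sum.delta)
  qed
  have int: "integrable M (\<lambda>x. indicator (?A v) x *\<^sub>R a x)" if "v \<in> s ` space M" for v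
    using a simple_functionD(2)[OF s] by (intro integrable_mult_indicator) auto
  have "(\<integral>x. a x * F (s x) \<partial>M) = (\<integral>x. (\<Sum>v\<in>s ` space M. (indicator (?A v) x *\<^sub>R a x) * F v) \<partial>M)"
    by (intro Bochner_Integration.integral_cong refl eq)
  also have "\<dots> = (\<Sum>v\<in>s ` space M. (\<integral>x. indicator (?A v) x *\<^sub>R a x \<partial>M) * F v)"
    by (subst Bochner_Integration.integral_sum)
       (auto simp only: integral_mult_left_zero intro!: integrable_mult_left int)
  finally show "(\<integral>x. a x * F (s x) \<partial>M)
    = (\<Sum>v\<in>s ` space M. (\<integral>x. indicator (?A v) x *\<^sub>R a x \<partial>M) * F v)" .
qed

text \<open>\<open>T\<close> may be applied under the integral sign of a convolution.  The identity map is approximated by simple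
  functions \<open>s n\<close>; replacing \<open>\<eta> (y - x)\<close> by \<open>\<eta> (y - s n x)\<close> turns the convolution into a finite sum of translates,
  for which the claim is linearity.  Both sides then converge by dominated convergence, on the left in the
  topology of the Schwartz space, on the right because \<open>T (translate x \<eta>)\<close> is continuous and of polynomial growth in \<open>x\<close>.\<close>

lemma tempered_conv:
  fixes a :: "real^'n::finite \<Rightarrow> complex"
  assumes T: "T \<in> tempered_distributions" and a: "rapid a" and \<eta>: "\<eta> \<in> schwartz_space"
  shows "T (conv a \<eta>) = (LBINT x. a x * T (translate x \<eta>))"
proof -
  have a1: "integrable lborel a" using a by (rule rapid_integrable)
  have [measurable]: "a \<in> borel_measurable borel" using a by (simp add: rapid_def)
  have [measurable]: "iter_partial is \<eta> \<in> borel_measurable borel" for "is"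
    using schwartz_measurable[OF \<eta>] .
  obtain s :: "nat \<Rightarrow> real^'n \<Rightarrow> real^'n" where s: "\<And>n. simple_function lborel (s n)"
    and lim: "\<And>x. (\<lambda>n. s n x) \<longlonglongrightarrow> x" and "\<And>n x. dist (s n x) 0 \<le> 2 * dist x 0"
    using borel_measurable_implies_sequence_metric[of "\<lambda>x::real^'n. x" lborel 0] by auto
  then have bound: "\<And>n x. norm (s n x) \<le> 2 * norm x" by simp
  have [measurable]: "s n \<in> borel \<rightarrow>\<^sub>M borel" for n
    using borel_measurable_simple_function[OF s, of n] by simp
  define c where "c n v = (LBINT x. indicator (s n -` {v} \<inter> space lborel) x *\<^sub>R a x)" for n v
  define S where "S n = (\<lambda>y. \<Sum>v\<in>range (s n). c n v * translate v \<eta> y)" for n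
  have fin: "finite (range (s n))" for n
    using simple_functionD(1)[OF s] by simp
  have summand: "(\<lambda>y. c n v * translate v \<eta> y) \<in> schwartz_space" for n v
    by (intro schwartz_cmult schwartz_translate \<eta>)
  have S: "S n \<in> schwartz_space" for n
    unfolding S_def by (intro schwartz_sum fin summand)
  have T_S: "T (S n) = (LBINT x. a x * T (translate (s n x) \<eta>))" for n
  proof -
    have "T (S n) = (\<Sum>v\<in>range (s n). T (\<lambda>y. c n v * translate v \<eta> y))"
      unfolding S_def by (rule tempered_sum[OF T fin summand])
    also have "\<dots> = (\<Sum>v\<in>range (s n). c n v * T (translate v \<eta>))"
      by (simp only: tempered_cmult[OF T schwartz_translate[OF \<eta>]])
    finally show ?thesis
      unfolding c_def using integral_simple_range[OF a1 s[of n], of "\<lambda>v. T (translate v \<eta>)"] by simp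
  qed
  have iter_S: "iter_partial is (S n) y = (LBINT x. a x * iter_partial is \<eta> (y - s n x))" for n "is" y
  proof -
    have "iter_partial is (S n) = (\<lambda>y. \<Sum>v\<in>range (s n). iter_partial is (\<lambda>y. c n v * translate v \<eta> y) y)"
      unfolding S_def by (rule iter_partial_sum[OF fin summand])
    also have "\<dots> = (\<lambda>y. \<Sum>v\<in>range (s n). c n v * iter_partial is \<eta> (y - v))"
      by (simp only: iter_partial_cmult[OF schwartz_smooth[OF schwartz_translate[OF \<eta>]]]
          iter_partial_translate[OF schwartz_smooth[OF \<eta>]] translate_def[of _ "iter_partial is \<eta>"])
    finally show ?thesis
      unfolding c_def using integral_simple_range[OF a1 s[of n], of "\<lambda>v. iter_partial is \<eta> (y - v)"] by simp
  qed
  have conv_S: "conv a \<eta> \<in> schwartz_space"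
    using a \<eta> by (rule schwartz_conv)
  have "(\<lambda>n. T (S n)) \<longlonglongrightarrow> T (conv a \<eta>)"
  proof (rule tempered_tendsto[OF T S conv_S])
    fix N "is"
    define C where "C = (\<Sum>i\<in>UNIV. schwartz_seminorm N (i # is) \<eta>)"
    have C: "0 \<le> C" unfolding C_def by (intro sum_nonneg seminorm_nonneg \<eta>)
    define D where "D n x = norm (a x) * (norm (s n x - x) * (1 + norm (s n x) + norm x) ^ N * C)" for n x
    define w where "w x = (3 ^ Suc N * C) * ((1 + norm x) ^ Suc N * norm (a x))" for x
    have w: "integrable lborel w"
      using a unfolding w_def[abs_def] rapid_def by (intro integrable_mult_right) blast
    have [measurable]: "D n \<in> borel_measurable lborel" for n
      unfolding D_def[abs_def] by measurable
    have D_le: "norm (D n x) \<le> w x" for n x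
    proof -
      have 1: "norm (s n x - x) \<le> 3 * (1 + norm x)"
        using norm_triangle_ineq4[of "s n x" x] bound[of n x] by simp
      have 2: "1 + norm (s n x) + norm x \<le> 3 * (1 + norm x)"
        using bound[of n x] by simp
      have "norm (s n x - x) * (1 + norm (s n x) + norm x) ^ N \<le> (3 * (1 + norm x)) * (3 * (1 + norm x)) ^ N"
        by (intro mult_mono power_mono 1 2) auto
      then have "norm (s n x - x) * (1 + norm (s n x) + norm x) ^ N \<le> 3 ^ Suc N * (1 + norm x) ^ Suc N"
        unfolding power_mult_distrib[symmetric] by simp
      then have "norm (a x) * (norm (s n x - x) * (1 + norm (s n x) + norm x) ^ N * C)
        \<le> norm (a x) * (3 ^ Suc N * (1 + norm x) ^ Suc N * C)"
        using C by (intro mult_left_mono mult_right_mono) auto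
      also have "\<dots> = w x" by (simp add: w_def)
      finally show ?thesis
        using C by (simp add: D_def abs_mult)
    qed
    have D_int: "integrable lborel (D n)" for n
      using D_le by (intro Bochner_Integration.integrable_bound[OF w]) (auto intro: order_trans[OF _ abs_ge_self])
    have "(\<lambda>n. LBINT x. D n x) \<longlonglongrightarrow> integral\<^sup>L lborel (\<lambda>x::real^'n. 0)"
    proof (rule integral_dominated_convergence[where w=w])
      show "AE x in lborel. (\<lambda>n. D n x) \<longlonglongrightarrow> 0"
      proof (rule AE_I2)
        fix x :: "real^'n"
        have "(\<lambda>n. D n x) \<longlonglongrightarrow> norm (a x) * (norm (x - x) * (1 + norm x + norm x) ^ N * C)"
          unfolding D_def by (intro tendsto_intros lim)
        then show "(\<lambda>n. D n x) \<longlonglongrightarrow> 0" by simp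
      qed
    qed (use w D_le in auto)
    then have D_lim: "(\<lambda>n. LBINT x. D n x) \<longlonglongrightarrow> 0" by simp
    have le: "schwartz_seminorm N is (\<lambda>y. S n y - conv a \<eta> y) \<le> (LBINT x. D n x)" for n
    proof (rule seminorm_least)
      fix y
      let ?\<Delta> = "\<lambda>x. iter_partial is \<eta> (y - s n x) - iter_partial is \<eta> (y - x)"
      have int: "integrable lborel (\<lambda>x. a x * iter_partial is \<eta> (y - s n x))"
        "integrable lborel (\<lambda>x. a x * iter_partial is \<eta> (y - x))"
        using integrable_mult_schwartz[OF a1 \<eta>] by auto
      have "(1 + norm y) ^ N * norm (iter_partial is (\<lambda>y. S n y - conv a \<eta> y) y)
        = norm ((1 + norm y) ^ N *\<^sub>R (iter_partial is (S n) y - iter_partial is (conv a \<eta>) y))"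
        by (simp add: iter_partial_diff schwartz_smooth S conv_S)
      also have "iter_partial is (S n) y - iter_partial is (conv a \<eta>) y
        = (LBINT x. a x * ?\<Delta> x)"
        using int by (simp add: iter_S iter_partial_conv[OF a1 \<eta>] conv_def right_diff_distrib)
      also have "(1 + norm y) ^ N *\<^sub>R \<dots>
        = (LBINT x. (1 + norm y) ^ N *\<^sub>R (a x * ?\<Delta> x))"
        by simp
      also have "norm \<dots> \<le> (LBINT x. D n x)"
      proof (rule Bochner_Integration.integral_norm_bound_integral)
        show "integrable lborel (\<lambda>x. (1 + norm y) ^ N *\<^sub>R (a x * ?\<Delta> x))"
          using int by (simp add: right_diff_distrib)
        fix x
        show "norm ((1 + norm y) ^ N *\<^sub>R (a x * ?\<Delta> x)) \<le> D n x"
          using mult_left_mono[OF schwartz_increment[OF \<eta>, of y N "is" "s n x" x], of "norm (a x)"]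
          by (simp add: D_def C_def norm_mult mult_ac)
      qed (rule D_int)
      finally show "(1 + norm y) ^ N * norm (iter_partial is (\<lambda>y. S n y - conv a \<eta> y) y) \<le> (LBINT x. D n x)" .
    qed
    show "(\<lambda>n. schwartz_seminorm N is (\<lambda>y. S n y - conv a \<eta> y)) \<longlonglongrightarrow> 0"
      by (rule tendsto_sandwich[OF always_eventually always_eventually tendsto_const D_lim])
         (use le in \<open>auto intro!: seminorm_nonneg schwartz_diff S conv_S\<close>)
  qed
  moreover have "(\<lambda>n. T (S n)) \<longlonglongrightarrow> (LBINT x. a x * T (translate x \<eta>))"
  proof -
    obtain N :: nat where N: "\<And>x. norm (T (translate x \<eta>)) \<le> real N * (1 + norm x) ^ N"
      using tempered_translate_growth[OF T \<eta>] by blast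
    have cont: "continuous_on UNIV (\<lambda>x. T (translate x \<eta>))"
      by (rule continuous_tempered_translate[OF T \<eta>])
    then have [measurable]: "(\<lambda>x. T (translate x \<eta>)) \<in> borel_measurable borel"
      by (rule borel_measurable_continuous_onI)
    show ?thesis
      unfolding T_S
    proof (rule integral_dominated_convergence[where w="\<lambda>x. (real N * 2 ^ N) * ((1 + norm x) ^ N * norm (a x))"])
      show "(\<lambda>x. a x * T (translate x \<eta>)) \<in> borel_measurable lborel" by measurable
      show "(\<lambda>x. a x * T (translate (s n x) \<eta>)) \<in> borel_measurable lborel" for n
        by measurable
      show "integrable lborel (\<lambda>x. (real N * 2 ^ N) * ((1 + norm x) ^ N * norm (a x)))"
        using a by (simp add: rapid_def)
      show "AE x in lborel. (\<lambda>n. a x * T (translate (s n x) \<eta>)) \<longlonglongrightarrow> a x * T (translate x \<eta>)"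
      proof (intro AE_I2 tendsto_mult_left)
        fix x :: "real^'n"
        show "(\<lambda>n. T (translate (s n x) \<eta>)) \<longlonglongrightarrow> T (translate x \<eta>)"
          using continuous_on_tendsto_compose[OF cont lim] by simp
      qed
      show "AE x in lborel. norm (a x * T (translate (s n x) \<eta>)) \<le> (real N * 2 ^ N) * ((1 + norm x) ^ N * norm (a x))" for n
      proof (rule AE_I2)
        fix x :: "real^'n"
        have "norm (T (translate (s n x) \<eta>)) \<le> real N * (1 + norm (s n x)) ^ N" by (rule N)
        also have "\<dots> \<le> real N * (2 * (1 + norm x)) ^ N"
          using bound[of n x] by (intro mult_left_mono power_mono) auto
        finally have "norm (a x) * norm (T (translate (s n x) \<eta>)) \<le> norm (a x) * (real N * (2 * (1 + norm x)) ^ N)"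
          by (rule mult_left_mono) simp
        then show "norm (a x * T (translate (s n x) \<eta>)) \<le> (real N * 2 ^ N) * ((1 + norm x) ^ N * norm (a x))"
          unfolding norm_mult power_mult_distrib by (simp only: mult_ac)
      qed
    qed
  qed
  ultimately show ?thesis by (rule LIMSEQ_unique)
qed

section \<open>Approximate identities\<close>

lemma schwartz_dilation:
  fixes \<eta> :: "real^'n::finite \<Rightarrow> complex"
  assumes "\<eta> \<in> schwartz_space" "t > 0"
  shows "dilation \<eta> t \<in> schwartz_space"
proof -
  have "dilation \<eta> t = (\<lambda>x. of_real (1 / t ^ CARD('n)) * \<eta> ((1 / t) *\<^sub>R x + 0))"
    unfolding dilation_def[abs_def] scaleR_conv_of_real by simp
  also have "\<dots> \<in> schwartz_space"
    using assms by (intro schwartz_cmult schwartz_affine) auto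
  finally show ?thesis .
qed

lemma conv_dilation:
  fixes \<eta> :: "real^'n::finite \<Rightarrow> complex"
  assumes [measurable]: "\<eta> \<in> borel_measurable borel" "b \<in> borel_measurable borel" and t: "t > 0"
  shows "conv (dilation \<eta> t) b y = (LBINT w. \<eta> w * b (y - t *\<^sub>R w))"
proof -
  have "conv (dilation \<eta> t) b y = t ^ CARD('n) *\<^sub>R (LBINT w. dilation \<eta> t (0 + t *\<^sub>R w) * b (y - (0 + t *\<^sub>R w)))"
    unfolding conv_def using t
    by (subst lborel_integral_affine(2)[of t _ 0]) (auto simp: dilation_def[abs_def])
  also have "\<dots> = (LBINT w. \<eta> w * b (y - t *\<^sub>R w))"
    using t by (simp add: dilation_def)
  finally show ?thesis .
qed

text \<open>Derivatives are moved to \<open>\<psi>\<close>, which does not depend on \<open>t\<close>; after rescaling, the increment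
  of \<open>\<psi>\<close> by \<open>t w\<close> produces the factor \<open>t\<close>.\<close>

lemma seminorm_approximate_identity:
  fixes \<eta> :: "real^'n::finite \<Rightarrow> complex"
  assumes \<eta>: "\<eta> \<in> schwartz_space" and \<eta>1: "(LBINT x. \<eta> x) = 1"
    and \<psi>: "\<psi> \<in> schwartz_space" and t: "0 < t" "t \<le> 1"
  shows "schwartz_seminorm N is (\<lambda>y. conv (dilation \<eta> t) \<psi> y - \<psi> y)
    \<le> t * ((LBINT w. (1 + norm w) ^ Suc N * norm (\<eta> w)) * (\<Sum>i\<in>UNIV. schwartz_seminorm N (i # is) \<psi>))"
proof (rule seminorm_least)
  fix y
  let ?\<Delta> = "\<lambda>w. iter_partial is \<psi> (y - t *\<^sub>R w) - iter_partial is \<psi> (y - 0)"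
  define C where "C = (\<Sum>i\<in>UNIV. schwartz_seminorm N (i # is) \<psi>)"
  have C: "0 \<le> C" unfolding C_def by (intro sum_nonneg seminorm_nonneg \<psi>)
  have \<eta>t: "dilation \<eta> t \<in> schwartz_space" using \<eta> t by (simp add: schwartz_dilation)
  have [measurable]: "\<eta> \<in> borel_measurable borel" "iter_partial is \<psi> \<in> borel_measurable borel"
    using schwartz_measurable[OF \<eta>, of "[]"] schwartz_measurable[OF \<psi>] by auto
  have \<eta>i: "integrable lborel \<eta>" using \<eta> by (intro rapid_integrable schwartz_rapid)
  have int: "integrable lborel (\<lambda>w. \<eta> w * iter_partial is \<psi> (y - t *\<^sub>R w))"
    using \<eta>i \<psi> by (rule integrable_mult_schwartz) simp
  have "iter_partial is (\<lambda>y. conv (dilation \<eta> t) \<psi> y - \<psi> y) y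
    = conv (dilation \<eta> t) (iter_partial is \<psi>) y - iter_partial is \<psi> y"
    using \<eta>t \<psi> by (subst iter_partial_diff)
      (auto simp: schwartz_smooth schwartz_conv schwartz_rapid iter_partial_conv rapid_integrable)
  also have "\<dots> = (LBINT w. \<eta> w * iter_partial is \<psi> (y - t *\<^sub>R w)) - (LBINT w. \<eta> w * iter_partial is \<psi> y)"
    using t \<eta>i by (simp add: conv_dilation \<eta>1)
  also have "\<dots> = (LBINT w. \<eta> w * ?\<Delta> w)"
    using int \<eta>i by (simp add: right_diff_distrib)
  finally have "(1 + norm y) ^ N * norm (iter_partial is (\<lambda>y. conv (dilation \<eta> t) \<psi> y - \<psi> y) y)
    = norm (LBINT w. (1 + norm y) ^ N *\<^sub>R (\<eta> w * ?\<Delta> w))"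
    by simp
  also have "\<dots> \<le> (LBINT w. (t * C) * ((1 + norm w) ^ Suc N * norm (\<eta> w)))"
  proof (rule Bochner_Integration.integral_norm_bound_integral)
    show "integrable lborel (\<lambda>w. (1 + norm y) ^ N *\<^sub>R (\<eta> w * ?\<Delta> w))"
      using int \<eta>i by (simp add: right_diff_distrib)
    show "integrable lborel (\<lambda>w. (t * C) * ((1 + norm w) ^ Suc N * norm (\<eta> w)))"
      using schwartz_rapid[OF \<eta>] unfolding rapid_def by (intro integrable_mult_right) blast
    fix w :: "real^'n"
    have "t * norm w \<le> norm w"
      using t by (simp add: mult_left_le_one_le)
    then have "norm (t *\<^sub>R w - 0) * (1 + norm (t *\<^sub>R w) + norm (0::real^'n)) ^ N \<le> (t * (1 + norm w)) * (1 + norm w) ^ N"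
      using t by (intro mult_mono power_mono) auto
    then have "norm (t *\<^sub>R w - 0) * (1 + norm (t *\<^sub>R w) + norm (0::real^'n)) ^ N * C \<le> t * (1 + norm w) ^ Suc N * C"
      using C by (intro mult_right_mono) (auto simp: mult.assoc)
    then have "(1 + norm y) ^ N * norm (?\<Delta> w) \<le> t * (1 + norm w) ^ Suc N * C"
      using schwartz_increment[OF \<psi>, of y N "is" "t *\<^sub>R w" 0] unfolding C_def by linarith
    from mult_left_mono[OF this, of "norm (\<eta> w)"]
    show "norm ((1 + norm y) ^ N *\<^sub>R (\<eta> w * ?\<Delta> w))
      \<le> (t * C) * ((1 + norm w) ^ Suc N * norm (\<eta> w))"
      by (simp add: norm_mult mult_ac)
  qed
  finally show "(1 + norm y) ^ N * norm (iter_partial is (\<lambda>y. conv (dilation \<eta> t) \<psi> y - \<psi> y) y)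
    \<le> t * ((LBINT w. (1 + norm w) ^ Suc N * norm (\<eta> w)) * (\<Sum>i\<in>UNIV. schwartz_seminorm N (i # is) \<psi>))"
    by (simp add: C_def[symmetric] mult_ac)
qed

lemma tempered_approximate_identity:
  fixes \<eta> :: "real^'n::finite \<Rightarrow> complex"
  assumes T: "T \<in> tempered_distributions"
    and \<eta>: "\<eta> \<in> schwartz_space" "(LBINT x. \<eta> x) = 1" and \<psi>: "\<psi> \<in> schwartz_space"
    and t: "\<And>n. 0 < t n" "\<And>n. t n \<le> 1" "t \<longlonglongrightarrow> 0"
  shows "(\<lambda>n. LBINT x. \<psi> x * T (translate x (dilation \<eta> (t n)))) \<longlonglongrightarrow> T \<psi>"
proof -
  have \<eta>t: "dilation \<eta> (t n) \<in> schwartz_space" for n using \<eta> t by (simp add: schwartz_dilation)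
  have "(LBINT x. \<psi> x * T (translate x (dilation \<eta> (t n)))) = T (conv (dilation \<eta> (t n)) \<psi>)" for n
    using tempered_conv[OF T schwartz_rapid[OF \<psi>] \<eta>t]
      conv_commute[OF schwartz_measurable[OF \<psi>, of "[]"] schwartz_measurable[OF \<eta>t, of "[]"]] by simp
  moreover have "(\<lambda>n. T (conv (dilation \<eta> (t n)) \<psi>)) \<longlonglongrightarrow> T \<psi>"
  proof (rule tempered_tendsto[OF T _ \<psi>])
    fix N "is"
    let ?C = "(LBINT w. (1 + norm w) ^ Suc N * norm (\<eta> w)) * (\<Sum>i\<in>UNIV. schwartz_seminorm N (i # is) \<psi>)"
    have lim: "(\<lambda>n. t n * ?C) \<longlonglongrightarrow> 0"
      using tendsto_mult_right[OF t(3), of ?C] by simp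
    show "(\<lambda>n. schwartz_seminorm N is (\<lambda>y. conv (dilation \<eta> (t n)) \<psi> y - \<psi> y)) \<longlonglongrightarrow> 0"
      by (rule tendsto_sandwich[OF always_eventually always_eventually tendsto_const lim])
         (auto simp del: power_Suc intro!: seminorm_nonneg schwartz_diff schwartz_conv schwartz_rapid \<eta>t \<psi>
           seminorm_approximate_identity[OF \<eta> \<psi> t(1,2)])
  qed (intro schwartz_conv schwartz_rapid \<eta>t \<psi>)
  ultimately show ?thesis by simp
qed

section \<open>Weak limits of dominated sequences\<close>

lemma tendsto_integral_indicator_decseq:
  fixes W :: "'a \<Rightarrow> real"
  assumes W: "integrable M W" and A: "range A \<subseteq> sets M" "decseq A" "(\<Inter>i. A i) = {}"
  shows "(\<lambda>i. \<integral>x. indicator (A i) x * W x \<partial>M) \<longlonglongrightarrow> 0"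
proof -
  have [measurable]: "A i \<in> sets M" for i using A by auto
  have [measurable]: "W \<in> borel_measurable M" using W by auto
  have "(\<lambda>i. \<integral>x. indicator (A i) x * W x \<partial>M) \<longlonglongrightarrow> (\<integral>x. 0 \<partial>M)"
  proof (rule integral_dominated_convergence[where w = "\<lambda>x. \<bar>W x\<bar>"])
    show "AE x in M. (\<lambda>i. indicator (A i) x * W x) \<longlonglongrightarrow> 0"
    proof (rule AE_I2)
      fix x
      have "(\<lambda>i. indicator (A i) x :: real) \<longlonglongrightarrow> indicator (\<Inter>i. A i) x"
        by (rule LIMSEQ_indicator_decseq[OF A(2)])
      then show "(\<lambda>i. indicator (A i) x * W x) \<longlonglongrightarrow> 0"
        using tendsto_mult_left_zero A(3) by fastforce
    qed
  qed (use W in \<open>auto simp: indicator_def\<close>)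
  then show ?thesis by simp
qed

lemma integrable_bounded_mult:
  fixes b f :: "'a \<Rightarrow> 'b::{real_normed_field, banach, second_countable_topology}"
  assumes "integrable M f" "b \<in> borel_measurable M" "\<And>x. x \<in> space M \<Longrightarrow> norm (b x) \<le> B"
  shows "integrable M (\<lambda>x. b x * f x)"
proof (rule Bochner_Integration.integrable_bound)
  show "integrable M (\<lambda>x. B * norm (f x))" using assms by simp
  show "AE x in M. norm (b x * f x) \<le> norm (B * norm (f x))"
    using assms(3)
    by (intro AE_I2) (auto simp: norm_mult abs_mult intro!: mult_right_mono intro: order_trans[OF _ abs_ge_self])
qed (use assms in auto)

text \<open>This plays the role of weak compactness of dominated families in \<open>L\<^sup>1\<close>.  Adding \<open>W\<close> makes the
  sequence nonnegative and bounded by \<open>2 W\<close>.  The limit \<open>L\<close> of the integrals over sets is then finitely additive and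
  bounded by the integral of \<open>2 W\<close>; continuity at the empty set follows, so \<open>L\<close> is a measure with a Radon-Nikodym density, and subtracting \<open>W\<close>
  again gives \<open>g\<close>.  Convergence extends from indicators to bounded functions by monotone
  approximation, uniformly in \<open>n\<close> because of the common majorant.\<close>

proposition dominated_weak_limit:
  fixes h :: "nat \<Rightarrow> 'a \<Rightarrow> real"
  assumes M: "sigma_finite_measure M" and h: "\<And>n. h n \<in> borel_measurable M"
    and W: "integrable M W" and dom: "\<And>n. AE x in M. \<bar>h n x\<bar> \<le> W x"
    and conv: "\<And>A. A \<in> sets M \<Longrightarrow> convergent (\<lambda>n. \<integral>x. indicator A x * h n x \<partial>M)"
  obtains g where "integrable M g" "AE x in M. \<bar>g x\<bar> \<le> W x"
    "\<And>b B. b \<in> borel_measurable M \<Longrightarrow> (\<And>x. \<bar>b x\<bar> \<le> B) \<Longrightarrow>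
      (\<lambda>n. \<integral>x. b x * h n x \<partial>M) \<longlonglongrightarrow> (\<integral>x. b x * g x \<partial>M)"
proof -
  interpret sigma_finite_measure M by fact
  have Wm [measurable]: "W \<in> borel_measurable M" using W by auto
  note h [measurable]
  have W0: "AE x in M. 0 \<le> W x" using dom[of 0] by eventually_elim auto
  have ih: "integrable M (h n)" for n
    by (rule Bochner_Integration.integrable_bound[OF W])
       (use dom[of n] in \<open>auto elim!: eventually_mono\<close>)
  have ind: "integrable M (\<lambda>x. indicator A x * f x)" if "integrable M f" "A \<in> sets M" for f :: "'a \<Rightarrow> real" and A
    using integrable_mult_indicator[OF that(2,1)] by simp
  define k where "k n x = h n x + W x" for n x
  have ik: "integrable M (k n)" for n unfolding k_def using ih W by auto
  have k: "AE x in M. 0 \<le> k n x \<and> k n x \<le> 2 * W x" for n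
    using dom[of n] by eventually_elim (auto simp: k_def)
  define L where "L A = lim (\<lambda>n. \<integral>x. indicator A x * k n x \<partial>M)" for A
  have L: "(\<lambda>n. \<integral>x. indicator A x * k n x \<partial>M) \<longlonglongrightarrow> L A" if A: "A \<in> sets M" for A
  proof -
    have "(\<integral>x. indicator A x * k n x \<partial>M) = (\<integral>x. indicator A x * h n x \<partial>M) + (\<integral>x. indicator A x * W x \<partial>M)" for n
      using ind[OF ih A] ind[OF W A] by (simp add: k_def distrib_left)
    then have "convergent (\<lambda>n. \<integral>x. indicator A x * k n x \<partial>M)"
      using conv[OF A] by (simp add: convergent_add_const_right_iff)
    then show ?thesis unfolding L_def by (rule convergent_LIMSEQ_iff[THEN iffD1])
  qed
  have L0: "0 \<le> L A" if "A \<in> sets M" for A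
  proof (rule LIMSEQ_le_const[OF L[OF that]])
    have "0 \<le> (\<integral>x. indicator A x * k n x \<partial>M)" for n
      using k[of n] by (intro integral_nonneg_AE) (auto elim: eventually_mono)
    then show "\<exists>N. \<forall>n\<ge>N. 0 \<le> (\<integral>x. indicator A x * k n x \<partial>M)" by blast
  qed
  have L_le: "L A \<le> (\<integral>x. indicator A x * (2 * W x) \<partial>M)" if A: "A \<in> sets M" for A
  proof (rule LIMSEQ_le_const2[OF L[OF A]])
    have "(\<integral>x. indicator A x * k n x \<partial>M) \<le> (\<integral>x. indicator A x * (2 * W x) \<partial>M)" for n
      using ind[OF ik A] ind[of "\<lambda>x. 2 * W x", OF _ A] W
      by (intro integral_mono_AE) (auto intro!: eventually_mono[OF k[of n]] mult_left_mono)
    then show "\<exists>N. \<forall>n\<ge>N. (\<integral>x. indicator A x * k n x \<partial>M) \<le> (\<integral>x. indicator A x * (2 * W x) \<partial>M)" by blast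
  qed
  have L_add: "L (A \<union> B) = L A + L B" if A: "A \<in> sets M" and B: "B \<in> sets M" and "A \<inter> B = {}" for A B
  proof (rule LIMSEQ_unique[OF L])
    have "(\<integral>x. indicator (A \<union> B) x * k n x \<partial>M) = (\<integral>x. indicator A x * k n x \<partial>M) + (\<integral>x. indicator B x * k n x \<partial>M)" for n
      using ind[OF ik A] ind[OF ik B] that(3)
      by (simp add: indicator_disj_union[of A B] distrib_right)
    then show "(\<lambda>n. \<integral>x. indicator (A \<union> B) x * k n x \<partial>M) \<longlonglongrightarrow> L A + L B"
      using tendsto_add[OF L[OF A] L[OF B]] by simp
  qed (use A B in auto)
  have Lempty: "L {} = 0" unfolding L_def by simp
  define N where "N = measure_of (space M) (sets M) (\<lambda>A. ennreal (L A))"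
  have sN: "sets N = sets M" unfolding N_def by simp
  have pos: "positive (sets M) (\<lambda>A. ennreal (L A))"
    by (simp add: positive_def Lempty)
  have "countably_additive (sets M) (\<lambda>A. ennreal (L A))"
  proof (rule sets.empty_continuous_imp_countably_additive[OF pos])
    show "additive (sets M) (\<lambda>A. ennreal (L A))"
      by (auto simp: additive_def L_add L0 ennreal_plus)
    fix A :: "nat \<Rightarrow> 'a set" assume A: "range A \<subseteq> sets M" "decseq A" "(\<Inter>i. A i) = {}"
    have lim: "(\<lambda>i. \<integral>x. indicator (A i) x * (2 * W x) \<partial>M) \<longlonglongrightarrow> 0"
      using W by (intro tendsto_integral_indicator_decseq A) auto
    have "(\<lambda>i. L (A i)) \<longlonglongrightarrow> 0"
      by (rule tendsto_sandwich[OF always_eventually always_eventually tendsto_const lim])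
         (use A in \<open>auto intro!: L0 L_le\<close>)
    then show "(\<lambda>i. ennreal (L (A i))) \<longlonglongrightarrow> 0"
      using tendsto_ennrealI by fastforce
  qed auto
  then have eN: "emeasure N A = ennreal (L A)" if "A \<in> sets M" for A
    using pos that unfolding N_def
    by (intro emeasure_measure_of_sigma sets.sigma_algebra_axioms) auto
  have "absolutely_continuous M N"
    unfolding absolutely_continuous_def
  proof
    fix A assume A: "A \<in> null_sets M"
    have "(\<integral>x. indicator A x * (2 * W x) \<partial>M) = 0"
      using AE_not_in[OF A] by (intro integral_eq_zero_AE) (auto elim!: eventually_mono)
    then have "L A = 0" using L0[of A] L_le[of A] A by (auto simp: null_sets_def)
    then show "A \<in> null_sets N" using A by (auto simp: null_sets_def eN sN)
  qed
  from Radon_Nikodym[OF this sN] obtain f where f [measurable]: "f \<in> borel_measurable M"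
    and fN: "density M f = N" by blast
  have f_int: "(\<integral>\<^sup>+x. f x * indicator A x \<partial>M) = ennreal (L A)" if "A \<in> sets M" for A
    using emeasure_density[OF f that] eN[OF that] fN by simp
  have f_fin: "AE x in M. f x \<noteq> \<infinity>"
  proof (rule nn_integral_noteq_infinite)
    have "(\<integral>\<^sup>+x. f x \<partial>M) = (\<integral>\<^sup>+x. f x * indicator (space M) x \<partial>M)"
      by (intro nn_integral_cong) auto
    also have "\<dots> = ennreal (L (space M))" by (rule f_int) simp
    finally show "(\<integral>\<^sup>+x. f x \<partial>M) \<noteq> \<infinity>" by simp
  qed simp
  define g0 where "g0 x = enn2real (f x)" for x
  have [measurable]: "g0 \<in> borel_measurable M" unfolding g0_def by measurable
  have g0_nn: "(\<integral>\<^sup>+x. ennreal (indicator A x * g0 x) \<partial>M) = ennreal (L A)" if A: "A \<in> sets M" for A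
  proof -
    have "(\<integral>\<^sup>+x. ennreal (indicator A x * g0 x) \<partial>M) = (\<integral>\<^sup>+x. f x * indicator A x \<partial>M)"
      by (rule nn_integral_cong_AE, use f_fin in eventually_elim) (auto simp: g0_def indicator_def less_top)
    then show ?thesis using f_int[OF A] by simp
  qed
  have g0_ind: "integrable M (\<lambda>x. indicator A x * g0 x)" "(\<integral>x. indicator A x * g0 x \<partial>M) = L A" if A: "A \<in> sets M" for A
  proof -
    have "has_bochner_integral M (\<lambda>x. indicator A x * g0 x) (L A)"
      by (rule has_bochner_integral_nn_integral) (use A L0[OF A] g0_nn[OF A] in \<open>auto simp: g0_def\<close>)
    then show "integrable M (\<lambda>x. indicator A x * g0 x)" "(\<integral>x. indicator A x * g0 x \<partial>M) = L A"
      by (auto simp: has_bochner_integral_iff)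
  qed
  have ig0: "integrable M g0"
    using g0_ind(1)[OF sets.top] by (rule Bochner_Integration.integrable_cong[THEN iffD1, rotated 2]) auto
  have g0_le: "AE x in M. g0 x \<le> 2 * W x"
  proof -
    \<comment> \<open>Integrating \<open>g0 - 2 W\<close> over the set where it is positive gives a value \<open>\<le> 0\<close>, so that set is null.\<close>
    define A where "A = {x \<in> space M. 2 * W x < g0 x}"
    have A: "A \<in> sets M" unfolding A_def by measurable
    have iA: "integrable M (\<lambda>x. indicator A x * (g0 x - 2 * W x))"
      using ig0 W A by (intro ind) auto
    have "(\<integral>x. indicator A x * (g0 x - 2 * W x) \<partial>M) = L A - (\<integral>x. indicator A x * (2 * W x) \<partial>M)"
      using g0_ind[OF A] ind[of "\<lambda>x. 2 * W x", OF _ A] W by (simp add: right_diff_distrib)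
    then have "(\<integral>x. indicator A x * (g0 x - 2 * W x) \<partial>M) \<le> 0" using L_le[OF A] by simp
    moreover have nn: "0 \<le> indicator A x * (g0 x - 2 * W x)" for x
      by (auto simp: A_def indicator_def)
    ultimately have "(\<integral>x. indicator A x * (g0 x - 2 * W x) \<partial>M) = 0"
      by (intro antisym integral_nonneg_AE) auto
    then have "AE x in M. indicator A x * (g0 x - 2 * W x) = 0"
      using integral_nonneg_eq_0_iff_AE[OF iA] nn by auto
    then show ?thesis
      using AE_space by eventually_elim (auto simp: A_def indicator_def split: if_splits)
  qed
  define g where "g x = g0 x - W x" for x
  have ig: "integrable M g" unfolding g_def using ig0 W by auto
  have g_le: "AE x in M. \<bar>g x\<bar> \<le> W x"
    using g0_le by eventually_elim (auto simp: g_def g0_def abs_le_iff)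
  have lim_ind: "(\<lambda>n. \<integral>x. indicator A x * h n x \<partial>M) \<longlonglongrightarrow> (\<integral>x. indicator A x * g x \<partial>M)" if A: "A \<in> sets M" for A
  proof -
    have "(\<lambda>n. (\<integral>x. indicator A x * k n x \<partial>M) - (\<integral>x. indicator A x * W x \<partial>M)) \<longlonglongrightarrow> L A - (\<integral>x. indicator A x * W x \<partial>M)"
      by (intro tendsto_intros L A)
    moreover have "(\<integral>x. indicator A x * k n x \<partial>M) - (\<integral>x. indicator A x * W x \<partial>M) = (\<integral>x. indicator A x * h n x \<partial>M)" for n
      using ind[OF ih A] ind[OF W A] by (simp add: k_def distrib_left)
    moreover have "L A - (\<integral>x. indicator A x * W x \<partial>M) = (\<integral>x. indicator A x * g x \<partial>M)"
      using g0_ind[OF A] ind[OF W A] by (simp add: g_def right_diff_distrib)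
    ultimately show ?thesis by simp
  qed
  have ib: "integrable M (\<lambda>x. b x * f x)"
    if "integrable M f" "b \<in> borel_measurable M" "\<And>x. x \<in> space M \<Longrightarrow> \<bar>b x\<bar> \<le> B" for b f :: "'a \<Rightarrow> real" and B
    using integrable_bounded_mult[of M f b B] that by simp
  have lim_nonneg: "(\<lambda>n. \<integral>x. b x * h n x \<partial>M) \<longlonglongrightarrow> (\<integral>x. b x * g x \<partial>M)"
    if "b \<in> borel_measurable M" "\<And>x. 0 \<le> b x" "\<And>x. x \<in> space M \<Longrightarrow> b x \<le> B" for b :: "'a \<Rightarrow> real" and B
    using that
  proof (induction b arbitrary: B rule: borel_measurable_induct_real)
    case (set A)
    then show ?case by (intro lim_ind)
  next
    case (mult u c)
    show ?case
    proof (cases "c = 0")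
      case False
      then have "\<And>x. x \<in> space M \<Longrightarrow> u x \<le> B / c"
        using mult by (auto simp: field_simps)
      from tendsto_mult_left[OF mult.IH[OF this], of c] show ?thesis
        by (simp add: mult.assoc)
    qed simp
  next
    case (add u v)
    have u: "\<And>x. x \<in> space M \<Longrightarrow> u x \<le> B" and v: "\<And>x. x \<in> space M \<Longrightarrow> v x \<le> B"
      using add by (smt (verit))+
    have iu: "integrable M (\<lambda>x. u x * f x)" and iv: "integrable M (\<lambda>x. v x * f x)" if "integrable M f" for f
      using that add u v by (auto intro!: ib[of _ _ B])
    show ?case
      using tendsto_add[OF add.IH(2)[OF v] add.IH(1)[OF u]]
      by (simp add: distrib_right iu iv ih ig)
  next
    case (seq U)
    have b [measurable]: "b \<in> borel_measurable M" by fact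
    have b0: "0 \<le> b x" for x by fact
    have U [measurable]: "U i \<in> borel_measurable M" for i by (rule seq.hyps(1))
    have Ub: "U i x \<le> b x" if "x \<in> space M" for i x
      by (rule incseq_le[OF _ seq.hyps(4)[OF that]]) (use seq.hyps(3) in \<open>auto simp: incseq_def le_fun_def\<close>)
    have bB: "\<bar>b x\<bar> \<le> B" and UB: "\<bar>U i x\<bar> \<le> B" if "x \<in> space M" for i x
      using b0[of x] seq.prems[OF that] seq.hyps(2)[of i x] Ub[OF that, of i] by auto
    define E where "E i = (\<integral>x. (b x - U i x) * W x \<partial>M)" for i
    have iE: "integrable M (\<lambda>x. (b x - U i x) * W x)" for i
      using Ub bB UB by (intro ib[OF W, of _ "2 * B"]) (auto simp: abs_le_iff, (smt (verit))+)
    have "E \<longlonglongrightarrow> (\<integral>x. 0 \<partial>M)"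
      unfolding E_def
    proof (rule integral_dominated_convergence[where w = "\<lambda>x. B * W x"])
      show "AE x in M. (\<lambda>i. (b x - U i x) * W x) \<longlonglongrightarrow> 0"
      proof (rule AE_I2)
        fix x assume "x \<in> space M"
        then have "(\<lambda>i. (b x - U i x) * W x) \<longlonglongrightarrow> (b x - b x) * W x"
          by (intro tendsto_intros seq.hyps(4))
        then show "(\<lambda>i. (b x - U i x) * W x) \<longlonglongrightarrow> 0" by simp
      qed
      show "AE x in M. norm ((b x - U i x) * W x) \<le> B * W x" for i
        using W0 AE_space
      proof eventually_elim
        case (elim x)
        have "\<bar>b x - U i x\<bar> \<le> B" using Ub[OF elim(2), of i] seq.hyps(2)[of i x] bB[OF elim(2)] by auto
        then show ?case using elim by (simp add: abs_mult mult_right_mono)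
      qed
    qed (use W in auto)
    then have E: "E \<longlonglongrightarrow> 0" by simp
    have diff: "\<bar>(\<integral>x. b x * f x \<partial>M) - (\<integral>x. U i x * f x \<partial>M)\<bar> \<le> E i"
      if f: "integrable M f" "AE x in M. \<bar>f x\<bar> \<le> W x" for f i
    proof -
      have "(\<integral>x. b x * f x \<partial>M) - (\<integral>x. U i x * f x \<partial>M) = (\<integral>x. (b x - U i x) * f x \<partial>M)"
        using ib[OF f(1) b bB] ib[OF f(1) U UB] by (simp add: left_diff_distrib)
      also have "\<bar>\<dots>\<bar> \<le> (\<integral>x. \<bar>(b x - U i x) * f x\<bar> \<partial>M)"
        by (rule integral_abs_bound)
      also have "\<dots> \<le> E i"
        unfolding E_def
      proof (rule integral_mono_AE)
        show "integrable M (\<lambda>x. \<bar>(b x - U i x) * f x\<bar>)"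
          using ib[OF f(1) b bB] ib[OF f(1) U UB] by (simp add: left_diff_distrib)
        show "AE x in M. \<bar>(b x - U i x) * f x\<bar> \<le> (b x - U i x) * W x"
          using f(2) AE_space by eventually_elim (auto simp: abs_mult Ub intro!: mult_left_mono)
      qed (rule iE)
      finally show ?thesis .
    qed
    show ?case
    proof (rule LIMSEQ_I)
      fix r :: real assume r: "0 < r"
      from order_tendstoD(2)[OF E, of "r / 3"] r obtain i where i: "E i < r / 3"
        by (auto simp: eventually_sequentially)
      have "\<And>x. x \<in> space M \<Longrightarrow> U i x \<le> B" using UB[of _ i] by (auto simp: abs_le_iff)
      from LIMSEQ_D[OF seq.IH[OF this], of "r / 3"] r
      obtain no where no: "\<And>n. n \<ge> no \<Longrightarrow> \<bar>(\<integral>x. U i x * h n x \<partial>M) - (\<integral>x. U i x * g x \<partial>M)\<bar> < r / 3"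
        by (auto simp: abs_le_iff)
      have "\<bar>(\<integral>x. b x * h n x \<partial>M) - (\<integral>x. b x * g x \<partial>M)\<bar> < r" if "n \<ge> no" for n
        using diff[OF ih dom, of n i] diff[OF ig g_le, of i] no[OF that] i by linarith
      then show "\<exists>no. \<forall>n\<ge>no. norm ((\<integral>x. b x * h n x \<partial>M) - (\<integral>x. b x * g x \<partial>M)) < r" by auto
    qed
  qed
  have "(\<lambda>n. \<integral>x. b x * h n x \<partial>M) \<longlonglongrightarrow> (\<integral>x. b x * g x \<partial>M)"
    if b: "b \<in> borel_measurable M" "\<And>x. \<bar>b x\<bar> \<le> B" for b :: "'a \<Rightarrow> real" and B
  proof -
    have B: "0 \<le> B" using b(2)[of undefined] by simp
    have "(\<lambda>n. (\<integral>x. (b x + B) * h n x \<partial>M) - (\<integral>x. B * h n x \<partial>M)) \<longlonglongrightarrow> (\<integral>x. (b x + B) * g x \<partial>M) - (\<integral>x. B * g x \<partial>M)"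
      using b B by (intro tendsto_diff lim_nonneg[of _ "2 * B"] lim_nonneg[of _ B])
        (auto simp: abs_le_iff, (smt (verit))+)
    moreover have "(\<integral>x. (b x + B) * f x \<partial>M) - (\<integral>x. B * f x \<partial>M) = (\<integral>x. b x * f x \<partial>M)" if "integrable M f" for f
    proof -
      have "integrable M (\<lambda>x. b x * f x)" by (rule ib[OF that b(1)]) (rule b(2))
      then show ?thesis using that by (simp add: distrib_right)
    qed
    ultimately show ?thesis by (simp add: ih ig)
  qed
  with ig g_le show thesis by (rule that)
qed

text \<open>The factor 2 comes from bounding real and imaginary part separately.\<close>

corollary dominated_weak_limit_complex:
  fixes h :: "nat \<Rightarrow> 'a \<Rightarrow> complex"
  assumes M: "sigma_finite_measure M" and h: "\<And>n. h n \<in> borel_measurable M"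
    and W: "integrable M W" and dom: "\<And>n. AE x in M. norm (h n x) \<le> W x"
    and conv: "\<And>A. A \<in> sets M \<Longrightarrow> convergent (\<lambda>n. \<integral>x. indicator A x *\<^sub>R h n x \<partial>M)"
  obtains g where "integrable M g" "AE x in M. norm (g x) \<le> 2 * W x"
    "\<And>b B. b \<in> borel_measurable M \<Longrightarrow> (\<And>x. norm (b x) \<le> B) \<Longrightarrow>
      (\<lambda>n. \<integral>x. b x * h n x \<partial>M) \<longlonglongrightarrow> (\<integral>x. b x * g x \<partial>M)"
proof -
  note h [measurable]
  have ih: "integrable M (h n)" for n
    by (rule Bochner_Integration.integrable_bound[OF W])
       (use dom[of n] in \<open>auto elim!: eventually_mono\<close>)
  have ind: "integrable M (\<lambda>x. indicator A x *\<^sub>R h n x)" if "A \<in> sets M" for A n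
    by (rule integrable_mult_indicator[OF that ih])
  have convRe: "convergent (\<lambda>n. \<integral>x. indicator A x * Re (h n x) \<partial>M)" if A: "A \<in> sets M" for A
  proof -
    obtain l where "(\<lambda>n. \<integral>x. indicator A x *\<^sub>R h n x \<partial>M) \<longlonglongrightarrow> l"
      using conv[OF A] by (auto simp: convergent_def)
    from tendsto_Re[OF this] show ?thesis
      by (auto simp: convergent_def integral_Re[OF ind[OF A], symmetric])
  qed
  have convIm: "convergent (\<lambda>n. \<integral>x. indicator A x * Im (h n x) \<partial>M)" if A: "A \<in> sets M" for A
  proof -
    obtain l where "(\<lambda>n. \<integral>x. indicator A x *\<^sub>R h n x \<partial>M) \<longlonglongrightarrow> l"
      using conv[OF A] by (auto simp: convergent_def)
    from tendsto_Im[OF this] show ?thesis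
      by (auto simp: convergent_def integral_Im[OF ind[OF A], symmetric])
  qed
  obtain g1 where g1: "integrable M g1" "AE x in M. \<bar>g1 x\<bar> \<le> W x"
    "\<And>b B. b \<in> borel_measurable M \<Longrightarrow> (\<And>x. \<bar>b x\<bar> \<le> B) \<Longrightarrow>
      (\<lambda>n. \<integral>x. b x * Re (h n x) \<partial>M) \<longlonglongrightarrow> (\<integral>x. b x * g1 x \<partial>M)"
  proof (rule dominated_weak_limit[OF M _ W _ convRe])
    show "AE x in M. \<bar>Re (h n x)\<bar> \<le> W x" for n
      using dom[of n] by eventually_elim (rule order_trans[OF abs_Re_le_cmod])
  qed (auto intro: that)
  obtain g2 where g2: "integrable M g2" "AE x in M. \<bar>g2 x\<bar> \<le> W x"
    "\<And>b B. b \<in> borel_measurable M \<Longrightarrow> (\<And>x. \<bar>b x\<bar> \<le> B) \<Longrightarrow>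
      (\<lambda>n. \<integral>x. b x * Im (h n x) \<partial>M) \<longlonglongrightarrow> (\<integral>x. b x * g2 x \<partial>M)"
  proof (rule dominated_weak_limit[OF M _ W _ convIm])
    show "AE x in M. \<bar>Im (h n x)\<bar> \<le> W x" for n
      using dom[of n] by eventually_elim (rule order_trans[OF abs_Im_le_cmod])
  qed (auto intro: that)
  define g where "g x = Complex (g1 x) (g2 x)" for x
  have g_eq: "g = (\<lambda>x. of_real (g1 x) + \<i> * of_real (g2 x))"
    by (auto simp: g_def complex_eq_iff)
  have ig: "integrable M g"
    unfolding g_eq using g1(1) g2(1) by (intro Bochner_Integration.integrable_add integrable_mult_right integrable_of_real)
  have g_le: "AE x in M. norm (g x) \<le> 2 * W x"
    using g1(2) g2(2)
  proof eventually_elim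
    case (elim x)
    then show ?case using cmod_le[of "g x"] by (simp add: g_def)
  qed
  have "(\<lambda>n. \<integral>x. b x * h n x \<partial>M) \<longlonglongrightarrow> (\<integral>x. b x * g x \<partial>M)"
    if b [measurable]: "b \<in> borel_measurable M" and bB: "\<And>x. norm (b x) \<le> B" for b B
  proof -
    have bR: "\<bar>Re (b x)\<bar> \<le> B" and bI: "\<bar>Im (b x)\<bar> \<le> B" for x
      using bB[of x] abs_Re_le_cmod[of "b x"] abs_Im_le_cmod[of "b x"] by linarith+
    have split: "(\<integral>x. b x * f x \<partial>M) = Complex
        ((\<integral>x. Re (b x) * Re (f x) \<partial>M) - (\<integral>x. Im (b x) * Im (f x) \<partial>M))
        ((\<integral>x. Re (b x) * Im (f x) \<partial>M) + (\<integral>x. Im (b x) * Re (f x) \<partial>M))"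
      if f: "integrable M f" for f
    proof -
      have [measurable]: "f \<in> borel_measurable M" using f by auto
      have int: "integrable M (\<lambda>x. b x * f x)"
        using integrable_bounded_mult[OF f b bB] .
      have "integrable M (\<lambda>x. Re (b x) * Re (f x))" "integrable M (\<lambda>x. Im (b x) * Im (f x))"
        "integrable M (\<lambda>x. Re (b x) * Im (f x))" "integrable M (\<lambda>x. Im (b x) * Re (f x))"
        using f bR bI by (auto intro!: integrable_bounded_mult[where B = B])
      then show ?thesis
        by (simp add: complex_eq_iff integral_Re[OF int, symmetric] integral_Im[OF int, symmetric])
    qed
    show ?thesis
      unfolding split[OF ih] split[OF ig] unfolding g_def
      by (simp, intro tendsto_Complex tendsto_diff tendsto_add g1(3) g2(3)) (auto intro: bR bI)
  qed
  with ig g_le show thesis by (rule that)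
qed

section \<open>Representing a distribution by a function\<close>

text \<open>The exponent is the least integer for which this weight is integrable on the whole space.\<close>

definition decay :: "'a::euclidean_space \<Rightarrow> real" where
  "decay x = 1 / (1 + norm x) ^ Suc DIM('a)"

lemma decay_pos: "0 < decay x"
  unfolding decay_def by (intro divide_pos_pos zero_less_power) (auto simp: add_pos_nonneg)

lemma decay_le_1: "decay (x::'a::euclidean_space) \<le> 1"
proof -
  have "1 \<le> (1 + norm x) ^ Suc DIM('a)" by (rule one_le_power) simp
  then have "1 / (1 + norm x) ^ Suc DIM('a) \<le> 1 / 1"
    by (intro divide_left_mono) auto
  then show ?thesis by (simp add: decay_def del: power_Suc)
qed

lemma continuous_decay: "continuous_on A decay"
  unfolding decay_def
  by (intro continuous_intros) (metis add_pos_nonneg norm_ge_zero zero_less_one zero_less_power less_irrefl)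

lemma measurable_decay [measurable]: "decay \<in> borel_measurable borel"
  by (rule borel_measurable_continuous_onI[OF continuous_decay])

lemma integrable_decay: "integrable lborel decay"
  unfolding decay_def by (rule integrable_inverse_weight)

lemma decay_shift_le:
  fixes x y :: "'a::euclidean_space"
  shows "decay (y - x) \<le> decay y * (1 + norm x) ^ Suc DIM('a)"
proof -
  let ?K = "Suc DIM('a)"
  have "1 + norm y \<le> (1 + norm (y - x)) * (1 + norm x)"
    using one_plus_norm_add_le[of "y - x" x] by simp
  then have "(1 + norm y) ^ ?K \<le> (1 + norm (y - x)) ^ ?K * (1 + norm x) ^ ?K"
    unfolding power_mult_distrib[symmetric] by (rule power_mono) simp
  moreover have "0 < (1 + norm y) ^ ?K" "0 < (1 + norm (y - x)) ^ ?K"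
    by (intro zero_less_power, simp add: add_pos_nonneg)+
  ultimately show ?thesis
    unfolding decay_def by (simp add: field_simps del: power_Suc)
qed

lemma schwartz_le_decay:
  fixes \<psi> :: "real^'n::finite \<Rightarrow> complex"
  assumes "\<psi> \<in> schwartz_space"
  shows "norm (\<psi> x) \<le> schwartz_seminorm (Suc CARD('n)) [] \<psi> * decay x"
  using schwartz_pointwise[OF assms, of "[]" x "Suc CARD('n)"] by (simp add: decay_def)

lemma convergent_of_approximations:
  fixes X :: "nat \<Rightarrow> 'a::banach"
  assumes Y: "\<And>k. convergent (Y k)" and E: "E \<longlonglongrightarrow> 0"
    and close: "\<And>k n. norm (X n - Y k n) \<le> E k"
  shows "convergent X"
proof -
  have "Cauchy X"
  proof (rule metric_CauchyI)
    fix e :: real assume "0 < e"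
    then have "0 < e / 3" by simp
    from order_tendstoD(2)[OF E this] obtain k where k: "E k < e / 3"
      by (auto simp: eventually_sequentially)
    have "Cauchy (Y k)" using Y by (simp add: Cauchy_convergent_iff)
    from metric_CauchyD[OF this \<open>0 < e / 3\<close>]
    obtain M where M: "\<And>m n. m \<ge> M \<Longrightarrow> n \<ge> M \<Longrightarrow> norm (Y k m - Y k n) < e / 3"
      by (auto simp: dist_norm)
    have "norm (X m - X n) < e" if "m \<ge> M" "n \<ge> M" for m n
    proof -
      have "X m - X n = (X m - Y k m) + (Y k m - Y k n) - (X n - Y k n)" by simp
      also have "norm \<dots> \<le> norm (X m - Y k m) + norm (Y k m - Y k n) + norm (X n - Y k n)"
        by (meson norm_triangle_ineq4 norm_triangle_ineq order_trans add_right_mono)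
      also have "\<dots> < e" using close[of m k] close[of n k] M[OF that] k by linarith
      finally show ?thesis .
    qed
    then show "\<exists>M. \<forall>m\<ge>M. \<forall>n\<ge>M. dist (X m) (X n) < e" by (auto simp: dist_norm)
  qed
  then show ?thesis by (simp add: Cauchy_convergent_iff)
qed

lemma conv_dilation_tendsto:
  fixes \<eta> a :: "real^'n::finite \<Rightarrow> complex"
  assumes \<eta>: "integrable lborel \<eta>" "(LBINT x. \<eta> x) = 1"
    and a [measurable]: "a \<in> borel_measurable borel" and B: "\<And>x. norm (a x) \<le> B"
    and cont: "isCont a y" and t: "\<And>k. 0 < t k" "t \<longlonglongrightarrow> 0"
  shows "(\<lambda>k. conv (dilation \<eta> (t k)) a y) \<longlonglongrightarrow> a y"
proof -
  have [measurable]: "\<eta> \<in> borel_measurable borel" using \<eta> by auto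
  have "(\<lambda>k. LBINT w. \<eta> w * a (y - t k *\<^sub>R w)) \<longlonglongrightarrow> (LBINT w. \<eta> w * a y)"
  proof (rule integral_dominated_convergence[where w = "\<lambda>w. B * norm (\<eta> w)"])
    show "AE w in lborel. (\<lambda>k. \<eta> w * a (y - t k *\<^sub>R w)) \<longlonglongrightarrow> \<eta> w * a y"
    proof (intro AE_I2 tendsto_mult_left)
      fix w :: "real^'n"
      have "(\<lambda>k. y - t k *\<^sub>R w) \<longlonglongrightarrow> y - 0 *\<^sub>R w" by (intro tendsto_intros t)
      then show "(\<lambda>k. a (y - t k *\<^sub>R w)) \<longlonglongrightarrow> a y"
        using isCont_tendsto_compose[OF cont] by simp
    qed
    show "AE w in lborel. norm (\<eta> w * a (y - t k *\<^sub>R w)) \<le> B * norm (\<eta> w)" for k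
      using B by (intro AE_I2) (simp add: norm_mult mult.commute[of B] mult_left_mono)
  qed (use \<eta> in auto)
  then show ?thesis
    using \<eta> by (simp add: conv_dilation t)
qed

lemma norm_conv_dilation_le:
  fixes \<eta> a :: "real^'n::finite \<Rightarrow> complex"
  assumes \<eta>: "rapid \<eta>" and a [measurable]: "a \<in> borel_measurable borel"
    and a_le: "\<And>x. norm (a x) \<le> decay x" and t: "0 < t" "t \<le> 1"
  shows "norm (conv (dilation \<eta> t) a y) \<le> (LBINT w. (1 + norm w) ^ Suc CARD('n) * norm (\<eta> w)) * decay y"
proof -
  let ?K = "Suc CARD('n)"
  have [measurable]: "\<eta> \<in> borel_measurable borel" using \<eta> by (simp add: rapid_def)
  have w: "integrable lborel (\<lambda>w. (1 + norm w) ^ ?K * norm (\<eta> w) * decay y)"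
    using \<eta> unfolding rapid_def by (intro integrable_mult_left) blast
  have le: "norm (\<eta> w * a (y - t *\<^sub>R w)) \<le> (1 + norm w) ^ ?K * norm (\<eta> w) * decay y" for w
  proof -
    have "norm (a (y - t *\<^sub>R w)) \<le> decay y * (1 + norm (t *\<^sub>R w)) ^ ?K"
      using a_le[of "y - t *\<^sub>R w"] decay_shift_le[of y "t *\<^sub>R w"] by simp
    also have "\<dots> \<le> decay y * (1 + norm w) ^ ?K"
      using t decay_pos[of y] by (intro mult_left_mono power_mono) (auto simp: mult_left_le_one_le)
    finally have "norm (\<eta> w) * norm (a (y - t *\<^sub>R w)) \<le> norm (\<eta> w) * (decay y * (1 + norm w) ^ ?K)"
      by (rule mult_left_mono) simp
    then show ?thesis unfolding norm_mult by (simp only: mult_ac)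
  qed
  have "norm (LBINT w. \<eta> w * a (y - t *\<^sub>R w)) \<le> (LBINT w. (1 + norm w) ^ ?K * norm (\<eta> w) * decay y)"
  proof (rule Bochner_Integration.integral_norm_bound_integral[OF _ w le])
    show "integrable lborel (\<lambda>w. \<eta> w * a (y - t *\<^sub>R w))"
      by (rule Bochner_Integration.integrable_bound[OF w])
         (auto intro!: AE_I2 order_trans[OF le] simp del: power_Suc)
  qed
  then show ?thesis
    using t by (simp add: conv_dilation del: power_Suc)
qed

lemma AE_not_box_frontier:
  fixes l v :: "'a::euclidean_space"
  shows "AE y in lborel. y \<in> box l v \<or> y \<notin> cbox l v"
proof -
  have "cbox l v - box l v \<in> null_sets lebesgue"
    using negligible_frontier_interval by (simp add: negligible_iff_null_sets)
  then have "cbox l v - box l v \<in> null_sets lborel"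
    by (simp add: null_sets_completion_iff)
  from AE_not_in[OF this] show ?thesis by eventually_elim auto
qed

text \<open>The common majorant makes the class of test functions \<open>a\<close> for which the integrals of \<open>a u\<^sub>n\<close> converge closed under
  pointwise limits dominated by \<open>decay\<close>.  Mollifying the weighted indicator of an open box gives Schwartz
  functions that converge to it off the boundary of the box, a null set; so boxes belong to the class, and the
  \<open>\<pi>\<close>-\<open>\<lambda>\<close> theorem extends this to all Borel sets.\<close>

lemma convergent_on_borel_indicators:
  fixes u :: "nat \<Rightarrow> real^'n::finite \<Rightarrow> complex" and \<eta> :: "real^'n \<Rightarrow> complex"
  assumes u [measurable]: "\<And>n. u n \<in> borel_measurable borel"
    and m [measurable]: "m \<in> borel_measurable borel"
    and dom: "\<And>n. AE x in lborel. norm (u n x) \<le> m x"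
    and int: "integrable lborel (\<lambda>x. m x * decay x)"
    and conv: "\<And>\<psi>. \<psi> \<in> schwartz_space \<Longrightarrow> convergent (\<lambda>n. LBINT x. \<psi> x * u n x)"
    and \<eta>: "\<eta> \<in> schwartz_space" "(LBINT x. \<eta> x) = 1"
    and A: "A \<in> sets borel"
  shows "convergent (\<lambda>n. LBINT x. of_real (indicator A x * decay x) * u n x)"
proof -
  let ?w = "\<lambda>A (x::real^'n). of_real (indicator A x * decay x) :: complex"
  have m0: "AE x in lborel. 0 \<le> m x"
    using dom[of 0] by eventually_elim (rule order_trans[OF norm_ge_zero])
  have ui: "integrable lborel (\<lambda>x. a x * u n x)"
    if [measurable]: "a \<in> borel_measurable borel" and le: "AE x in lborel. norm (a x) \<le> C * decay x" for a C n
  proof (rule Bochner_Integration.integrable_bound)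
    show "integrable lborel (\<lambda>x. C * (m x * decay x))" using int by simp
    show "AE x in lborel. norm (a x * u n x) \<le> norm (C * (m x * decay x))"
      using le dom[of n]
    proof eventually_elim
      case (elim x)
      have "norm (a x) * norm (u n x) \<le> (C * decay x) * m x"
        using elim by (intro mult_mono order_trans[OF norm_ge_zero elim(1)]) auto
      then show ?case by (simp add: norm_mult mult_ac)
    qed
  qed measurable
  have closure: "convergent (\<lambda>n. LBINT x. a x * u n x)"
    if c: "\<And>k. convergent (\<lambda>n. LBINT x. a' k x * u n x)"
      and lim: "AE x in lborel. (\<lambda>k. a' k x) \<longlonglongrightarrow> a x"
      and a' [measurable]: "\<And>k. a' k \<in> borel_measurable borel" and a [measurable]: "a \<in> borel_measurable borel"
      and le: "\<And>k x. norm (a' k x) \<le> C * decay x"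
    for a and a' :: "nat \<Rightarrow> real^'n \<Rightarrow> complex" and C
  proof -
    have a_le: "AE x in lborel. norm (a x) \<le> C * decay x"
      using lim by eventually_elim (rule LIMSEQ_le_const2[OF tendsto_norm], use le in auto)
    have diff_le: "AE x in lborel. norm (a x - a' k x) * m x \<le> 2 * C * (m x * decay x)" for k
      using a_le m0
    proof eventually_elim
      case (elim x)
      have "norm (a x - a' k x) \<le> 2 * C * decay x"
        using norm_triangle_ineq4[of "a x" "a' k x"] le[of k x] elim by simp
      from mult_right_mono[OF this elim(2)] show ?case by (simp add: mult_ac)
    qed
    have int2: "integrable lborel (\<lambda>x. 2 * C * (m x * decay x))" using int by simp
    \<comment> \<open>The error made by passing from \<open>a\<close> to the approximant is bounded by \<open>E k\<close> below, independently of \<open>n\<close>.\<close>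
    have idiff: "integrable lborel (\<lambda>x. norm (a x - a' k x) * m x)" for k
    proof (rule Bochner_Integration.integrable_bound[OF int2])
      show "AE x in lborel. norm (norm (a x - a' k x) * m x) \<le> norm (2 * C * (m x * decay x))"
        using diff_le[of k] m0
      proof eventually_elim
        case (elim x)
        then have "0 \<le> norm (a x - a' k x) * m x" by simp
        then show ?case using elim(1) unfolding real_norm_def by linarith
      qed
    qed measurable
    define E where "E k = (LBINT x. norm (a x - a' k x) * m x)" for k
    have "E \<longlonglongrightarrow> integral\<^sup>L lborel (\<lambda>x::real^'n. 0)"
      unfolding E_def
    proof (rule integral_dominated_convergence[OF _ _ int2])
      show "AE x in lborel. (\<lambda>k. norm (a x - a' k x) * m x) \<longlonglongrightarrow> 0"
        using lim
      proof eventually_elim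
        case (elim x)
        have "(\<lambda>k. norm (a x - a' k x) * m x) \<longlonglongrightarrow> norm (a x - a x) * m x"
          by (intro tendsto_intros elim)
        then show ?case by simp
      qed
      show "AE x in lborel. norm (norm (a x - a' k x) * m x) \<le> 2 * C * (m x * decay x)" for k
        using diff_le[of k] m0 by eventually_elim (simp add: abs_mult)
    qed measurable
    then have E: "E \<longlonglongrightarrow> 0" by simp
    have close: "norm ((LBINT x. a x * u n x) - (LBINT x. a' k x * u n x)) \<le> E k" for k n
    proof -
      have i1: "integrable lborel (\<lambda>x. a x * u n x)" using a a_le by (rule ui)
      have i2: "integrable lborel (\<lambda>x. a' k x * u n x)" using a' by (rule ui) (use le in auto)
      have "(LBINT x. a x * u n x) - (LBINT x. a' k x * u n x) = (LBINT x. (a x - a' k x) * u n x)"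
        using i1 i2 by (simp add: left_diff_distrib)
      also have "norm \<dots> \<le> (LBINT x. norm ((a x - a' k x) * u n x))" by (rule integral_norm_bound)
      also have "\<dots> \<le> E k"
        unfolding E_def
      proof (rule integral_mono_AE[OF _ idiff])
        show "integrable lborel (\<lambda>x. norm ((a x - a' k x) * u n x))"
          using i1 i2 by (simp add: left_diff_distrib)
        show "AE x in lborel. norm ((a x - a' k x) * u n x) \<le> norm (a x - a' k x) * m x"
          using dom[of n] by eventually_elim (simp add: norm_mult mult_left_mono)
      qed
      finally show ?thesis .
    qed
    show ?thesis by (rule convergent_of_approximations[OF c E close])
  qed
  let ?P = "\<lambda>A. convergent (\<lambda>n. LBINT x. ?w A x * u n x)"
  have ind_le: "norm (?w A x) \<le> 1 * decay x" for A and x :: "real^'n"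
    using decay_pos[of x] by (auto simp: indicator_def)
  have box: "?P (box l v)" for l v
  proof -
    define a :: "real^'n \<Rightarrow> complex" where "a x = of_real (indicator (box l v) x * decay x)" for x
    have [measurable]: "a \<in> borel_measurable borel" unfolding a_def by measurable
    have a_le: "norm (a x) \<le> decay x" for x using ind_le by (simp add: a_def)
    have a_le1: "norm (a x) \<le> 1" for x using a_le[of x] decay_le_1[of x] by simp
    have "rapid a"
      unfolding rapid_def
    proof (intro conjI allI)
      fix N
      obtain R where R: "\<And>x. x \<in> box l v \<Longrightarrow> norm x \<le> R"
        using bounded_box[of l v] by (auto simp: bounded_iff)
      show "integrable lborel (\<lambda>x. (1 + norm x) ^ N * norm (a x))"
      proof (rule Bochner_Integration.integrable_bound)
        show "integrable lborel (\<lambda>x. (1 + R) ^ N * indicator (box l v) x)"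
          by (intro integrable_mult_right integrable_real_indicator) (auto simp: emeasure_lborel_box_eq)
        show "AE x in lborel. norm ((1 + norm x) ^ N * norm (a x)) \<le> norm ((1 + R) ^ N * indicator (box l v) x :: real)"
        proof (rule AE_I2)
          fix x
          show "norm ((1 + norm x) ^ N * norm (a x)) \<le> norm ((1 + R) ^ N * indicator (box l v) x :: real)"
          proof (cases "x \<in> box l v")
            case True
            have "0 \<le> R" using order_trans[OF norm_ge_zero R[OF True]] .
            then have "(1 + norm x) ^ N * norm (a x) \<le> (1 + R) ^ N * 1"
              using R[OF True] by (intro mult_mono power_mono a_le1) auto
            then show ?thesis using True by simp
          qed (simp add: a_def)
        qed
      qed measurable
    qed measurable
    define t :: "nat \<Rightarrow> real" where "t k = 1 / real (Suc k)" for k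
    have t: "0 < t k" "t k \<le> 1" for k by (auto simp: t_def)
    have tlim: "t \<longlonglongrightarrow> 0" unfolding t_def using LIMSEQ_inverse_real_of_nat by (simp add: inverse_eq_divide)
    define a' where "a' k = conv (dilation \<eta> (t k)) a" for k
    have \<eta>t: "dilation \<eta> (t k) \<in> schwartz_space" for k using \<eta> t by (simp add: schwartz_dilation)
    have \<eta>m: "dilation \<eta> (t k) \<in> borel_measurable borel" for k
      using schwartz_measurable[OF \<eta>t, of "[]"] by simp
    have a'S: "a' k \<in> schwartz_space" for k
      unfolding a'_def conv_commute[OF \<eta>m \<open>a \<in> borel_measurable borel\<close>]
      using \<open>rapid a\<close> \<eta>t by (rule schwartz_conv)
    have "convergent (\<lambda>n. LBINT x. a x * u n x)"
    proof (rule closure)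
      show "convergent (\<lambda>n. LBINT x. a' k x * u n x)" for k using a'S by (rule conv)
      show "AE x in lborel. (\<lambda>k. a' k x) \<longlonglongrightarrow> a x"
        using AE_not_box_frontier[of l v]
      proof eventually_elim
        case (elim x)
        have "isCont a x"
          using elim
        proof
          assume x: "x \<in> box l v"
          have "continuous_on (box l v) (\<lambda>x. of_real (decay x) :: complex)"
            by (intro continuous_intros continuous_decay)
          then have "continuous_on (box l v) a"
            by (rule continuous_on_eq) (simp add: a_def)
          then show ?thesis using x by (simp add: continuous_on_eq_continuous_at open_box)
        next
          assume x: "x \<notin> cbox l v"
          have "continuous_on (- cbox l v) a"
            by (rule continuous_on_eq[of _ "\<lambda>x. 0"]) (use box_subset_cbox[of l v] in \<open>auto simp: a_def indicator_def\<close>)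
          moreover have "open (- cbox l v)" by (intro open_Compl closed_cbox)
          ultimately show ?thesis using x by (simp add: continuous_on_eq_continuous_at)
        qed
        then show ?case
          unfolding a'_def using \<eta> t tlim a_le1
          by (intro conv_dilation_tendsto rapid_integrable schwartz_rapid) auto
      qed
      show "a' k \<in> borel_measurable borel" for k using schwartz_measurable[OF a'S[of k], of "[]"] by simp
      show "norm (a' k x) \<le> (LBINT w. (1 + norm w) ^ Suc CARD('n) * norm (\<eta> w)) * decay x" for k x
        unfolding a'_def using schwartz_rapid[OF \<eta>(1)] _ a_le t by (rule norm_conv_dilation_le) measurable
    qed measurable
    then show ?thesis unfolding a_def .
  qed
  have P_lim: "?P A" if "\<And>k. ?P (B k)" "\<And>k. B k \<in> sets borel" "A \<in> sets borel"
      "\<And>x. (\<lambda>k. indicator (B k) x :: real) \<longlonglongrightarrow> indicator A x" for A and B :: "nat \<Rightarrow> (real^'n) set"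
  proof (rule closure[where a' = "\<lambda>k x. ?w (B k) x" and C = 1])
    show "AE x in lborel. (\<lambda>k. ?w (B k) x) \<longlonglongrightarrow> ?w A x"
      by (intro AE_I2 tendsto_intros that)
    show "(\<lambda>x. ?w A x) \<in> borel_measurable borel"
      using that(3) by measurable
    show "(\<lambda>x. ?w (B k) x) \<in> borel_measurable borel" for k
      using that(2)[of k] by measurable
  qed (use that(1) ind_le in auto)
  have Pi: "integrable lborel (\<lambda>x. ?w A x * u n x)" if A: "A \<in> sets borel" for A n
    by (rule ui[where C = 1]) (use A ind_le in \<open>auto simp: indicator_def\<close>)
  have UNIV: "?P UNIV"
  proof (rule P_lim[where B = "\<lambda>k. box (- real k *\<^sub>R One) (real k *\<^sub>R One)"])
    fix x :: "real^'n"
    have inc: "incseq (\<lambda>k. box (- real k *\<^sub>R One) (real k *\<^sub>R One) :: (real^'n) set)"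
      unfolding incseq_def
    proof (intro allI impI subsetI)
      fix i j :: nat and x :: "real^'n"
      assume "i \<le> j" and x: "x \<in> box (- real i *\<^sub>R One) (real i *\<^sub>R One)"
      then have ij: "real i \<le> real j" by simp
      show "x \<in> box (- real j *\<^sub>R One) (real j *\<^sub>R One)"
        unfolding mem_box
      proof
        fix b :: "real^'n" assume b: "b \<in> Basis"
        then have "- real i < x \<bullet> b \<and> x \<bullet> b < real i"
          using x unfolding mem_box by (auto simp: inner_simps)
        with ij b show "- real j *\<^sub>R One \<bullet> b < x \<bullet> b \<and> x \<bullet> b < real j *\<^sub>R One \<bullet> b"
          by (auto simp: inner_simps)
      qed
    qed
    have "(\<lambda>k. indicator (box (- real k *\<^sub>R One) (real k *\<^sub>R One)) x :: real)
      \<longlonglongrightarrow> indicator (\<Union>k::nat. box (- real k *\<^sub>R One) (real k *\<^sub>R One)) x"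
      using inc by (rule LIMSEQ_indicator_incseq)
    then show "(\<lambda>k. indicator (box (- real k *\<^sub>R One) (real k *\<^sub>R One)) x :: real) \<longlonglongrightarrow> indicator UNIV x"
      using UN_box_eq_UNIV[where 'a = "real^'n"] by simp
  qed (rule box, simp_all)
  define G where "G = range (\<lambda>(l, v). box l v :: (real^'n) set)"
  have stable: "Int_stable G"
    unfolding Int_stable_def G_def by (force simp: Int_interval box_Int_box)
  have sG: "sigma_sets UNIV G = sets borel"
    unfolding G_def borel_eq_box by (simp add: case_prod_unfold)
  have closed: "G \<subseteq> Pow UNIV" by simp
  have "A \<in> sigma_sets UNIV G" using A sG by simp
  from stable closed this show ?thesis
  proof (induction rule: sigma_sets_induct_disjoint)
    case (basic A)
    then show ?case using box by (auto simp: G_def)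
  next
    case empty
    then show ?case by (simp add: convergent_const)
  next
    case (compl A)
    have A: "A \<in> sets borel" using compl sG by simp
    have "(LBINT x. ?w (UNIV - A) x * u n x)
      = (LBINT x. ?w UNIV x * u n x) - (LBINT x. ?w A x * u n x)" for n
    proof -
      have eq: "(\<lambda>x. ?w (UNIV - A) x * u n x)
        = (\<lambda>x. ?w UNIV x * u n x - ?w A x * u n x)"
        by (auto simp: fun_eq_iff indicator_def)
      show ?thesis
        unfolding eq by (rule Bochner_Integration.integral_diff[OF Pi Pi[OF A]]) simp
    qed
    then show ?case using convergent_diff[OF UNIV compl(2)] by simp
  next
    case (union A)
    have A: "A i \<in> sets borel" for i using union sG by auto
    have fin: "?P (\<Union>i<k. A i)" for k :: nat
    proof (induction k)
      case (Suc k)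
      have U: "(\<Union>i<k. A i) \<in> sets borel" using A by auto
      have "A i \<inter> A k = {}" if "i < k" for i
        using union(1) that by (intro disjoint_family_onD[of A UNIV]) auto
      then have disj: "(\<Union>i<k. A i) \<inter> A k = {}" by auto
      have eq: "(\<Union>i<Suc k. A i) = (\<Union>i<k. A i) \<union> A k" by (auto simp: less_Suc_eq)
      have "(LBINT x. ?w (\<Union>i<Suc k. A i) x * u n x)
        = (LBINT x. ?w (\<Union>i<k. A i) x * u n x)
        + (LBINT x. ?w (A k) x * u n x)" for n
      proof -
        have eq': "(\<lambda>x. ?w (\<Union>i<Suc k. A i) x * u n x)
          = (\<lambda>x. ?w (\<Union>i<k. A i) x * u n x + ?w (A k) x * u n x)"
          unfolding eq indicator_disj_union[OF disj] by (simp add: distrib_right)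
        show ?thesis
          unfolding eq' by (rule Bochner_Integration.integral_add[OF Pi[OF U] Pi[OF A]])
      qed
      then show ?case using convergent_add[OF Suc union(3)] by simp
    qed (simp add: convergent_const)
    show ?case
      by (rule P_lim[OF fin]) (use A in \<open>auto intro: LIMSEQ_indicator_UN\<close>)
  qed
qed

proposition function_of_dominated_approximants:
  fixes u :: "nat \<Rightarrow> real^'n::finite \<Rightarrow> complex" and \<eta> :: "real^'n \<Rightarrow> complex"
  assumes u [measurable]: "\<And>n. u n \<in> borel_measurable borel"
    and m [measurable]: "m \<in> borel_measurable borel"
    and dom: "\<And>n. AE x in lborel. norm (u n x) \<le> m x"
    and int: "integrable lborel (\<lambda>x. m x * decay x)"
    and lim: "\<And>\<psi>. \<psi> \<in> schwartz_space \<Longrightarrow> (\<lambda>n. LBINT x. \<psi> x * u n x) \<longlonglongrightarrow> T \<psi>"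
    and \<eta>: "\<eta> \<in> schwartz_space" "(LBINT x. \<eta> x) = 1"
  obtains f where "f \<in> borel_measurable borel" "AE x in lborel. norm (f x) \<le> 2 * m x"
    "\<And>\<psi>. \<psi> \<in> schwartz_space \<Longrightarrow> T \<psi> = (LBINT x. f x * \<psi> x)"
proof -
  have dpos: "decay x \<noteq> 0" for x :: "real^'n" using decay_pos[of x] by simp
  define h where "h n x = of_real (decay x) * u n x" for n x
  obtain g where g: "integrable lborel g" "AE x in lborel. norm (g x) \<le> 2 * (m x * decay x)"
    and glim: "\<And>b B. b \<in> borel_measurable lborel \<Longrightarrow> (\<And>x. norm (b x) \<le> B) \<Longrightarrow>
      (\<lambda>n. LBINT x. b x * h n x) \<longlonglongrightarrow> (LBINT x. b x * g x)"
  proof (rule dominated_weak_limit_complex[OF _ _ int, of h])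
    show "sigma_finite_measure (lborel :: (real^'n) measure)" by (rule lborel.sigma_finite_measure_axioms)
    show "h n \<in> borel_measurable lborel" for n unfolding h_def by measurable
    show "AE x in lborel. norm (h n x) \<le> m x * decay x" for n
      using dom[of n]
    proof eventually_elim
      case (elim x)
      then show ?case using mult_right_mono[OF elim, of "decay x"] decay_pos[of x]
        by (simp add: h_def norm_mult mult.commute)
    qed
    show "convergent (\<lambda>n. LBINT x. indicator A x *\<^sub>R h n x)" if "A \<in> sets lborel" for A
    proof -
      have "convergent (\<lambda>n. LBINT x. \<psi> x * u n x)" if "\<psi> \<in> schwartz_space" for \<psi>
        using lim[OF that] by (auto simp: convergent_def)
      from convergent_on_borel_indicators[OF u m dom int this \<eta>, of A] that
      show ?thesis by (simp add: h_def scaleR_conv_of_real mult.assoc)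
    qed
  qed (auto intro: that)
  define f where "f x = g x / of_real (decay x)" for x
  have [measurable]: "g \<in> borel_measurable borel" using g(1) by auto
  have "f \<in> borel_measurable borel" unfolding f_def by measurable
  moreover have "AE x in lborel. norm (f x) \<le> 2 * m x"
    using g(2)
  proof eventually_elim
    case (elim x)
    then show ?case using decay_pos[of x] by (simp add: f_def norm_divide divide_le_eq mult.assoc)
  qed
  moreover have "T \<psi> = (LBINT x. f x * \<psi> x)" if \<psi>: "\<psi> \<in> schwartz_space" for \<psi>
  proof (rule LIMSEQ_unique[OF lim[OF \<psi>]])
    have [measurable]: "\<psi> \<in> borel_measurable borel" using schwartz_measurable[OF \<psi>, of "[]"] by simp
    define b where "b x = \<psi> x / of_real (decay x)" for x
    have "(\<lambda>n. LBINT x. b x * h n x) \<longlonglongrightarrow> (LBINT x. b x * g x)"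
    proof (rule glim)
      show "b \<in> borel_measurable lborel" unfolding b_def by measurable
      show "norm (b x) \<le> schwartz_seminorm (Suc CARD('n)) [] \<psi>" for x
        using schwartz_le_decay[OF \<psi>, of x] decay_pos[of x] by (simp add: b_def norm_divide divide_le_eq)
    qed
    moreover have "b x * h n x = \<psi> x * u n x" "b x * g x = f x * \<psi> x" for n x
      using dpos[of x] by (auto simp: b_def h_def f_def)
    ultimately show "(\<lambda>n. LBINT x. \<psi> x * u n x) \<longlonglongrightarrow> (LBINT x. f x * \<psi> x)" by simp
  qed
  ultimately show thesis by (rule that)
qed

section \<open>Amalgam norms\<close>

lemma ennpowr_1 [simp]: "ennpowr a 1 = a"
  by (cases "a = \<infinity>") (auto simp: ennpowr_def less_top)

lemma ennpowr_less_top_iff [simp]: "ennpowr a r < top \<longleftrightarrow> a < top"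
  by (auto simp: ennpowr_def less_top)

lemma ennpowr_mono: "a \<le> b \<Longrightarrow> 0 \<le> r \<Longrightarrow> ennpowr a r \<le> ennpowr b r"
  by (auto simp: ennpowr_def less_top top_unique intro!: ennreal_leI powr_mono2 enn2real_mono)

lemma ennpowr_cmult:
  assumes "0 < c"
  shows "ennpowr (ennreal c * a) r = ennreal (c powr r) * ennpowr a r"
proof (cases a)
  case (real x)
  then show ?thesis using assms
    by (simp add: ennpowr_def ennreal_mult[symmetric] powr_mult)
next
  case top
  then show ?thesis using assms
    by (simp add: ennpowr_def ennreal_mult_top ennreal_mult_eq_top_iff)
qed

text \<open>A crude form of the embedding of \<open>\<ell>\<^sup>p\<close> into bounded sequences: it bounds the integral over each single cube by one plus the
  \<open>p\<close>-th power of the amalgam norm.\<close>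

lemma le_one_plus_ennpowr:
  assumes "1 \<le> r"
  shows "a \<le> 1 + ennpowr a r"
proof (cases a)
  case (real x)
  have "x \<le> 1 + x powr r"
  proof (cases "x \<le> 1")
    case True
    then show ?thesis using powr_ge_zero[of x r] by linarith
  next
    case False
    then have "x powr 1 \<le> x powr r" using assms by (intro powr_mono) auto
    then show ?thesis using False by simp
  qed
  then have "ennreal x \<le> ennreal (1 + x powr r)" by (rule ennreal_leI)
  also have "\<dots> = 1 + ennreal (x powr r)" by (subst ennreal_plus) auto
  finally show ?thesis using real by (simp add: ennpowr_def)
qed (simp add: ennpowr_def)

lemma amalgam_norm_less_top_iff:
  "amalgam_norm 1 p F < \<infinity> \<longleftrightarrow>
    (\<integral>\<^sup>+ k. ennpowr (\<integral>\<^sup>+ x \<in> unit_cube k. F x \<partial>lborel) p \<partial>count_space UNIV) < \<infinity>"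
  by (simp add: amalgam_norm_def nn_integral_completion)

lemma ennpowr_le_sum:
  fixes F :: "real^'n::finite \<Rightarrow> ennreal"
  shows "ennpowr (\<integral>\<^sup>+ x \<in> unit_cube k. F x \<partial>lborel) p
    \<le> (\<integral>\<^sup>+ k. ennpowr (\<integral>\<^sup>+ x \<in> unit_cube k. F x \<partial>lborel) p \<partial>count_space UNIV)"
  by (rule nn_integral_ge_point) simp

lemma sets_unit_cube [measurable]: "unit_cube k \<in> sets borel"
  unfolding unit_cube_def by measurable

lemma box_subset_unit_cube:
  fixes k :: "int^'n::finite"
  shows "box (\<chi> i. of_int (k $ i)) (\<chi> i. of_int (k $ i) + 1) \<subseteq> unit_cube k"
  by (auto simp: unit_cube_def mem_box_cart less_imp_le)

lemma emeasure_unit_cube_ge: "1 \<le> emeasure lborel (unit_cube (k::int^'n::finite))"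
proof -
  let ?l = "(\<chi> i. of_int (k $ i)) :: real^'n" and ?v = "(\<chi> i. of_int (k $ i) + 1) :: real^'n"
  have 1: "(?v - ?l) \<bullet> b = 1" if "b \<in> Basis" for b
    using that by (auto simp: Basis_vec_def inner_axis)
  have "(\<Prod>b\<in>Basis. (?v - ?l) \<bullet> b) = 1"
    by (intro prod.neutral) (auto simp: 1)
  moreover have "?l \<bullet> b \<le> ?v \<bullet> b" if "b \<in> Basis" for b
    using 1[OF that] by (simp add: inner_diff_left)
  ultimately have "emeasure lborel (box ?l ?v) = 1" by simp
  then show ?thesis
    using emeasure_mono[OF box_subset_unit_cube[of k], of lborel] by simp
qed

lemma norm_diff_unit_cube_le:
  fixes x y :: "real^'n::finite"
  assumes "x \<in> unit_cube k" "y \<in> unit_cube k"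
  shows "norm (x - y) \<le> real CARD('n)"
proof -
  have "\<bar>(x - y) $ i\<bar> \<le> 1" for i
  proof -
    have "of_int (k $ i) \<le> x $ i" "x $ i < of_int (k $ i) + 1" "of_int (k $ i) \<le> y $ i" "y $ i < of_int (k $ i) + 1"
      using assms by (auto simp: unit_cube_def)
    then show ?thesis by (simp add: abs_le_iff)
  qed
  then have "(\<Sum>i\<in>UNIV. \<bar>(x - y) $ i\<bar>) \<le> (\<Sum>i\<in>(UNIV::'n set). 1)" by (intro sum_mono)
  then show ?thesis using norm_le_l1_cart[of "x - y"] by simp
qed

lemma nn_integral_unit_cubes:
  fixes F :: "real^'n::finite \<Rightarrow> ennreal"
  assumes [measurable]: "F \<in> borel_measurable borel"
  shows "(\<integral>\<^sup>+ x. F x \<partial>lborel) = (\<integral>\<^sup>+ k. (\<integral>\<^sup>+ x \<in> unit_cube k. F x \<partial>lborel) \<partial>count_space UNIV)"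
proof -
  have one: "(\<integral>\<^sup>+ k. F x * indicator (unit_cube k) x \<partial>count_space UNIV) = F x" for x
  proof -
    \<comment> \<open>The index of the only cube that contains \<open>x\<close>.\<close>
    define \<kappa> :: "int^'n" where "\<kappa> = (\<chi> i. \<lfloor>x $ i\<rfloor>)"
    have "x \<in> unit_cube k \<longleftrightarrow> \<kappa> = k" for k
      by (simp add: unit_cube_def \<kappa>_def vec_eq_iff floor_eq_iff)
    then have "(\<lambda>k. F x * indicator (unit_cube k) x) = (\<lambda>k. F x * indicator {\<kappa>} k)"
      by (auto simp: fun_eq_iff indicator_def)
    then show ?thesis by (simp add: nn_integral_cmult)
  qed
  have "(\<integral>\<^sup>+ x. F x \<partial>lborel) = (\<integral>\<^sup>+ x. (\<integral>\<^sup>+ k. F x * indicator (unit_cube k) x \<partial>count_space UNIV) \<partial>lborel)"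
    by (simp add: one)
  also have "\<dots> = (\<integral>\<^sup>+ k. (\<integral>\<^sup>+ x \<in> unit_cube k. F x \<partial>lborel) \<partial>count_space UNIV)"
    by (rule nn_integral_count_space_nn_integral) auto
  finally show ?thesis .
qed

text \<open>On a unit cube the weight \<open>decay\<close> is constant up to a factor \<open>C\<close>, and the integrals of \<open>F\<close>
  over the cubes are bounded uniformly.  So the weighted integral is at most a constant times the sum over the cubes of the integrals of
  \<open>decay\<close>, that is, of its integral over the whole space.\<close>

lemma amalgam_finite_imp_weighted:
  fixes F :: "real^'n::finite \<Rightarrow> ennreal"
  assumes F [measurable]: "F \<in> borel_measurable borel" and p: "1 \<le> p"
    and fin: "amalgam_norm 1 p F < \<infinity>"
  shows "(\<integral>\<^sup>+ x. F x * ennreal (decay x) \<partial>lborel) < \<infinity>"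
proof -
  define S where "S = (\<integral>\<^sup>+ k. ennpowr (\<integral>\<^sup>+ x \<in> unit_cube k. F x \<partial>lborel) p \<partial>count_space (UNIV::(int^'n) set))"
  have S: "S < \<infinity>" using fin unfolding S_def amalgam_norm_less_top_iff .
  have I_le: "(\<integral>\<^sup>+ x \<in> unit_cube k. F x \<partial>lborel) \<le> 1 + S" for k
    using le_one_plus_ennpowr[OF p, of "\<integral>\<^sup>+ x \<in> unit_cube k. F x \<partial>lborel"] ennpowr_le_sum[of F k p]
    unfolding S_def by (meson add_left_mono order_trans)
  define C where "C = (1 + real CARD('n)) ^ Suc CARD('n)"
  have C: "0 \<le> C" by (simp add: C_def)
  let ?D = "\<lambda>k. \<integral>\<^sup>+ y \<in> unit_cube k. ennreal (decay y) \<partial>(lborel :: (real^'n) measure)"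
  have decay_le: "ennreal (decay x) \<le> ennreal C * ?D k" if x: "x \<in> unit_cube k" for x :: "real^'n" and k
  proof -
    have le: "decay x \<le> C * decay y" if y: "y \<in> unit_cube k" for y
    proof -
      have "decay x \<le> decay y * (1 + norm (y - x)) ^ Suc CARD('n)"
        using decay_shift_le[of y "y - x"] by simp
      also have "\<dots> \<le> decay y * C"
        unfolding C_def using norm_diff_unit_cube_le[OF y x] decay_pos[of y]
        by (intro mult_left_mono power_mono) auto
      finally show ?thesis by (simp add: mult.commute)
    qed
    have "ennreal (decay x) \<le> ennreal (decay x) * emeasure lborel (unit_cube k)"
      using mult_left_mono[OF emeasure_unit_cube_ge[of k], of "ennreal (decay x)"] by simp
    also have "\<dots> = (\<integral>\<^sup>+ y. ennreal (decay x) * indicator (unit_cube k) y \<partial>lborel)"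
      by (simp add: nn_integral_cmult_indicator)
    also have "\<dots> \<le> (\<integral>\<^sup>+ y. ennreal C * (ennreal (decay y) * indicator (unit_cube k) y) \<partial>lborel)"
      using le C by (intro nn_integral_mono) (auto simp: indicator_def ennreal_mult'[symmetric] intro!: ennreal_leI)
    also have "\<dots> = ennreal C * ?D k"
      by (rule nn_integral_cmult) measurable
    finally show ?thesis .
  qed
  have "(\<integral>\<^sup>+ x. F x * ennreal (decay x) \<partial>lborel)
    = (\<integral>\<^sup>+ k. (\<integral>\<^sup>+ x \<in> unit_cube k. F x * ennreal (decay x) \<partial>lborel) \<partial>count_space UNIV)"
    by (rule nn_integral_unit_cubes) measurable
  also have "\<dots> \<le> (\<integral>\<^sup>+ k. ennreal C * (1 + S) * ?D k \<partial>count_space UNIV)"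
  proof (rule nn_integral_mono)
    fix k :: "int^'n"
    have "(\<integral>\<^sup>+ x \<in> unit_cube k. F x * ennreal (decay x) \<partial>lborel)
      \<le> (\<integral>\<^sup>+ x. (ennreal C * ?D k) * (F x * indicator (unit_cube k) x) \<partial>lborel)"
    proof (rule nn_integral_mono)
      fix x
      show "F x * ennreal (decay x) * indicator (unit_cube k) x \<le> (ennreal C * ?D k) * (F x * indicator (unit_cube k) x)"
      proof (cases "x \<in> unit_cube k")
        case True
        then show ?thesis
          using mult_left_mono[OF decay_le[OF True], of "F x"] by (simp add: mult_ac)
      qed simp
    qed
    also have "\<dots> = (ennreal C * ?D k) * (\<integral>\<^sup>+ x \<in> unit_cube k. F x \<partial>lborel)"
      by (rule nn_integral_cmult) measurable
    also have "\<dots> \<le> (ennreal C * ?D k) * (1 + S)"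
      by (intro mult_left_mono I_le) simp
    finally show "(\<integral>\<^sup>+ x \<in> unit_cube k. F x * ennreal (decay x) \<partial>lborel) \<le> ennreal C * (1 + S) * ?D k"
      by (simp add: mult_ac)
  qed
  also have "\<dots> = ennreal C * (1 + S) * (\<integral>\<^sup>+ k. ?D k \<partial>count_space UNIV)"
    by (rule nn_integral_cmult) simp
  also have "(\<integral>\<^sup>+ k. ?D k \<partial>count_space UNIV) = (\<integral>\<^sup>+ y. ennreal (decay y) \<partial>(lborel :: (real^'n) measure))"
    by (rule nn_integral_unit_cubes[where F = "\<lambda>y. ennreal (decay y)", symmetric]) measurable
  also have "ennreal C * (1 + S) * \<dots> < \<infinity>"
  proof -
    have "(\<integral>\<^sup>+ y. ennreal (decay y) \<partial>(lborel :: (real^'n) measure)) < \<infinity>"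
      using integrable_decay[where 'a = "real^'n"]
      by (simp add: integrable_iff_bounded abs_of_pos decay_pos)
    then show ?thesis using S by (simp add: ennreal_mult_less_top)
  qed
  finally show ?thesis .
qed

section \<open>The inclusion\<close>

lemma iter_partial_zero_outside:
  fixes \<phi> :: "real^'n::finite \<Rightarrow> complex"
  assumes "x \<notin> closure {x. \<phi> x \<noteq> 0}"
  shows "iter_partial is \<phi> x = 0"
  using assms
proof (induction "is" arbitrary: x)
  case Nil
  then show ?case using closure_subset[of "{x. \<phi> x \<noteq> 0}"] by auto
next
  case (Cons i "is")
  let ?U = "- closure {x. \<phi> x \<noteq> 0}"
  have "(iter_partial is \<phi> has_derivative (\<lambda>h. 0)) (at x)"
  proof (rule has_derivative_transform_within_open[OF has_derivative_const])
    show "open ?U" by (intro open_Compl closed_closure)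
    show "x \<in> ?U" using Cons by simp
    show "0 = iter_partial is \<phi> y" if "y \<in> ?U" for y using Cons.IH that by simp
  qed
  from partial_eq[OF this] show ?case by simp
qed

lemma test_function_schwartz:
  fixes \<phi> :: "real^'n::finite \<Rightarrow> complex"
  assumes smooth: "smooth \<phi>" and supp: "closure {x. \<phi> x \<noteq> 0} \<subseteq> ball 0 1"
  shows "\<phi> \<in> schwartz_space"
proof (rule schwartzI[OF smooth])
  fix N "is"
  let ?g = "\<lambda>x. (1 + norm x) ^ N * norm (iter_partial is \<phi> x)"
  have "continuous_on (cball 0 1) ?g"
    by (intro continuous_intros smooth_continuous_on smooth)
  then have "bounded (?g ` cball 0 1)"
    by (intro compact_imp_bounded compact_continuous_image) auto
  then obtain B where "\<forall>y\<in>?g ` cball 0 1. norm y \<le> B"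
    unfolding bounded_iff by blast
  then have B: "norm (?g x) \<le> B" if "x \<in> cball 0 1" for x using that by blast
  have "0 \<le> B" using order_trans[OF norm_ge_zero B[of 0]] by simp
  have "?g x \<le> B" for x
  proof (cases "x \<in> cball 0 1")
    case True
    then show ?thesis using B[OF True] by simp
  next
    case False
    then have "x \<notin> closure {x. \<phi> x \<noteq> 0}" using supp by auto
    then show ?thesis using \<open>0 \<le> B\<close> by (simp add: iter_partial_zero_outside)
  qed
  then show "\<exists>B. \<forall>x. ?g x \<le> B" by blast
qed

lemma distr_convolution_eq_translate:
  "distr_convolution T (dilation \<phi> t) x = T (translate x (dilation (\<lambda>z. \<phi> (- z)) t))"
  by (simp add: distr_convolution_def translate_def[abs_def] dilation_def algebra_simps)

lemma schwartz_reflect: "\<phi> \<in> schwartz_space \<Longrightarrow> (\<lambda>z. \<phi> (- z)) \<in> schwartz_space"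
  using schwartz_affine[of \<phi> "-1" 0] by simp

text \<open>A supremum of continuous functions is lower semicontinuous, which settles measurability although the supremum
  is over an uncountable set.\<close>

lemma measurable_maximal_function:
  fixes \<phi> :: "real^'n::finite \<Rightarrow> complex"
  assumes T: "T \<in> tempered_distributions" and \<phi>: "\<phi> \<in> schwartz_space"
  shows "maximal_function \<phi> T \<in> borel_measurable borel"
proof (rule borel_measurableI_greater)
  fix c
  have "open {x. c < ennreal (norm (distr_convolution T (dilation \<phi> t) x))}" if "t > 0" for t
  proof (rule open_Collect_less)
    have "continuous_on UNIV (distr_convolution T (dilation \<phi> t))"
      unfolding distr_convolution_eq_translate[abs_def]
      by (intro continuous_tempered_translate T schwartz_dilation schwartz_reflect \<phi> that)
    then show "continuous_on UNIV (\<lambda>x. ennreal (norm (distr_convolution T (dilation \<phi> t) x)))"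
      by (intro continuous_on_ennreal continuous_on_norm)
  qed simp
  moreover have "{x. c < maximal_function \<phi> T x}
    = (\<Union>t\<in>{0<..}. {x. c < ennreal (norm (distr_convolution T (dilation \<phi> t) x))})"
    by (auto simp: maximal_function_def less_SUP_iff)
  ultimately have "open {x. c < maximal_function \<phi> T x}" by auto
  then show "{x \<in> space borel. c < maximal_function \<phi> T x} \<in> sets borel"
    by simp
qed

proposition hardy_amalgam_subset:
  fixes \<phi> :: "real^'n::finite \<Rightarrow> complex"
  assumes \<phi>: "\<phi> \<in> schwartz_space" and \<phi>1: "(LBINT x. \<phi> x) = 1" and p: "1 \<le> p"
  shows "hardy_amalgam_space \<phi> 1 p \<subseteq> distribution_of ` amalgam_space 1 p"
proof
  fix T assume "T \<in> hardy_amalgam_space \<phi> 1 p"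
  then have T: "T \<in> tempered_distributions" and fin: "amalgam_norm 1 p (maximal_function \<phi> T) < \<infinity>"
    by (auto simp: hardy_amalgam_space_def)
  define M where "M = maximal_function \<phi> T"
  have [measurable]: "M \<in> borel_measurable borel"
    unfolding M_def using T \<phi> by (rule measurable_maximal_function)
  have Mfin: "(\<integral>\<^sup>+ x. M x * ennreal (decay x) \<partial>lborel) < \<infinity>"
    using fin p unfolding M_def[symmetric] by (intro amalgam_finite_imp_weighted) auto
  have M_AE: "AE x in lborel. M x < \<infinity>"
  proof -
    have "AE x in lborel. M x * ennreal (decay x) \<noteq> \<infinity>"
      using Mfin by (intro nn_integral_noteq_infinite) auto
    then show ?thesis
    proof eventually_elim
      case (elim x)
      then show ?case using decay_pos[of x] by (auto simp: ennreal_mult_eq_top_iff less_top)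
    qed
  qed
  \<comment> \<open>On the null set where \<open>M\<close> is infinite this puts \<open>m\<close> to 0, so bounds by \<open>m\<close> hold almost everywhere only.\<close>
  define m where "m x = enn2real (M x)" for x
  have [measurable]: "m \<in> borel_measurable borel" unfolding m_def by measurable
  define \<eta> where "\<eta> = (\<lambda>z. \<phi> (- z))"
  have \<eta>: "\<eta> \<in> schwartz_space" unfolding \<eta>_def using \<phi> by (rule schwartz_reflect)
  have [measurable]: "\<phi> \<in> borel_measurable borel" using schwartz_measurable[OF \<phi>, of "[]"] by simp
  have \<eta>1: "(LBINT x. \<eta> x) = 1"
    using lborel_integral_affine(2)[of "-1" \<phi> 0] \<phi>1 by (simp add: \<eta>_def)
  define t :: "nat \<Rightarrow> real" where "t k = 1 / real (Suc k)" for k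
  have t: "0 < t k" "t k \<le> 1" for k by (auto simp: t_def)
  have tlim: "t \<longlonglongrightarrow> 0" unfolding t_def using LIMSEQ_inverse_real_of_nat by (simp add: inverse_eq_divide)
  define u where "u n x = T (translate x (dilation \<eta> (t n)))" for n x
  have \<eta>t: "dilation \<eta> (t n) \<in> schwartz_space" for n using \<eta> t by (simp add: schwartz_dilation)
  have u_le: "ennreal (norm (u n x)) \<le> M x" for n x
    unfolding M_def maximal_function_def u_def \<eta>_def distr_convolution_eq_translate[symmetric]
    by (rule SUP_upper) (use t in auto)
  have dom: "AE x in lborel. norm (u n x) \<le> m x" for n
    using M_AE
  proof eventually_elim
    case (elim x)
    have "enn2real (ennreal (norm (u n x))) \<le> m x"
      unfolding m_def using u_le[of n x] elim by (intro enn2real_mono) auto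
    then show ?case by simp
  qed
  have int: "integrable lborel (\<lambda>x. m x * decay x)"
  proof (rule integrableI_bounded)
    have "(\<integral>\<^sup>+ x. ennreal (norm (m x * decay x)) \<partial>lborel) \<le> (\<integral>\<^sup>+ x. M x * ennreal (decay x) \<partial>lborel)"
    proof (rule nn_integral_mono)
      fix x
      have "ennreal (m x) \<le> M x" unfolding m_def by (cases "M x") auto
      then show "ennreal (norm (m x * decay x)) \<le> M x * ennreal (decay x)"
        using decay_pos[of x] by (simp add: m_def abs_mult ennreal_mult mult_right_mono)
    qed
    then show "(\<integral>\<^sup>+ x. ennreal (norm (m x * decay x)) \<partial>lborel) < \<infinity>" using Mfin by (rule order.strict_trans1)
  qed measurable
  obtain f where f [measurable]: "f \<in> borel_measurable borel" and f_le: "AE x in lborel. norm (f x) \<le> 2 * m x"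
    and Tf: "\<And>\<psi>. \<psi> \<in> schwartz_space \<Longrightarrow> T \<psi> = (LBINT x. f x * \<psi> x)"
  proof (rule function_of_dominated_approximants[OF _ _ dom int _ \<eta> \<eta>1])
    show "u n \<in> borel_measurable borel" for n
      unfolding u_def by (intro borel_measurable_continuous_onI continuous_tempered_translate T \<eta>t)
    show "(\<lambda>n. LBINT x. \<psi> x * u n x) \<longlonglongrightarrow> T \<psi>" if "\<psi> \<in> schwartz_space" for \<psi>
      unfolding u_def by (rule tempered_approximate_identity[OF T \<eta> \<eta>1 that t tlim])
  qed (auto intro: that)
  have f_M: "AE x in lborel. ennreal (norm (f x)) \<le> ennreal 2 * M x"
    using f_le M_AE
  proof eventually_elim
    case (elim x)
    have "ennreal (norm (f x)) \<le> ennreal (2 * m x)" using elim(1) by (rule ennreal_leI)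
    also have "\<dots> = ennreal 2 * M x"
      using elim(2) by (subst ennreal_mult) (auto simp: m_def less_top)
    finally show ?case .
  qed
  have "f \<in> amalgam_space 1 p"
    unfolding amalgam_space_def
  proof (intro CollectI conjI impI allI)
    show "f \<in> borel_measurable lebesgue" using f by (intro measurable_completion) simp
    fix K :: "(real^'n) set" assume K: "compact K"
    obtain R where R: "\<And>x. x \<in> K \<Longrightarrow> norm x \<le> R"
      using compact_imp_bounded[OF K] by (auto simp: bounded_iff)
    have [measurable]: "K \<in> sets borel" using K by (intro borel_compact)
    let ?C = "2 * (1 + \<bar>R\<bar>) ^ Suc CARD('n)"
    have "integrable lborel (\<lambda>x. indicator K x *\<^sub>R f x)"
    proof (rule Bochner_Integration.integrable_bound)
      show "integrable lborel (\<lambda>x. ?C * (m x * decay x))" using int by (intro integrable_mult_right)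
      show "AE x in lborel. norm (indicator K x *\<^sub>R f x) \<le> norm (?C * (m x * decay x))"
        using f_le
      proof eventually_elim
        case (elim x)
        show ?case
        proof (cases "x \<in> K")
          case True
          have m0: "0 \<le> m x" by (simp add: m_def)
          have "1 = decay (0::real^'n)" by (simp add: decay_def)
          also have "\<dots> \<le> decay x * (1 + norm x) ^ Suc CARD('n)"
            using decay_shift_le[of x x] by simp
          also have "\<dots> \<le> decay x * (1 + \<bar>R\<bar>) ^ Suc CARD('n)"
            using R[OF True] decay_pos[of x] by (intro mult_left_mono power_mono) auto
          finally have "2 * m x * 1 \<le> 2 * m x * (decay x * (1 + \<bar>R\<bar>) ^ Suc CARD('n))"
            using m0 by (intro mult_left_mono) auto
          also have "\<dots> = ?C * (m x * decay x)" by simp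
          finally show ?thesis using elim True by (simp del: power_Suc)
        qed simp
      qed
    qed measurable
    then show "set_integrable lebesgue K f"
      unfolding set_integrable_def by (subst integrable_completion) auto
  next
    let ?I = "\<lambda>F (k::int^'n). \<integral>\<^sup>+ x \<in> unit_cube k. F x \<partial>(lborel :: (real^'n) measure)"
    have "(\<integral>\<^sup>+ k. ennpowr (?I (\<lambda>x. ennreal (norm (f x))) k) p \<partial>count_space UNIV)
      \<le> (\<integral>\<^sup>+ k. ennreal (2 powr p) * ennpowr (?I M k) p \<partial>count_space UNIV)"
    proof (rule nn_integral_mono)
      fix k
      have "?I (\<lambda>x. ennreal (norm (f x))) k \<le> (\<integral>\<^sup>+ x. ennreal 2 * (M x * indicator (unit_cube k) x) \<partial>lborel)"
        by (rule nn_integral_mono_AE, use f_M in eventually_elim) (auto simp: indicator_def)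
      also have "\<dots> = ennreal 2 * ?I M k" by (rule nn_integral_cmult) measurable
      finally have "ennpowr (?I (\<lambda>x. ennreal (norm (f x))) k) p \<le> ennpowr (ennreal 2 * ?I M k) p"
        using p by (intro ennpowr_mono) auto
      then show "ennpowr (?I (\<lambda>x. ennreal (norm (f x))) k) p \<le> ennreal (2 powr p) * ennpowr (?I M k) p"
        by (subst (asm) ennpowr_cmult) auto
    qed
    also have "\<dots> = ennreal (2 powr p) * (\<integral>\<^sup>+ k. ennpowr (?I M k) p \<partial>count_space UNIV)"
      by (rule nn_integral_cmult) simp
    also have "\<dots> < \<infinity>"
      using fin unfolding amalgam_norm_less_top_iff M_def by (simp add: ennreal_mult_less_top)
    finally show "amalgam_norm 1 p (\<lambda>x. ennreal (norm (f x))) < \<infinity>"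
      unfolding amalgam_norm_less_top_iff .
  qed
  moreover have "T = distribution_of f"
  proof
    fix \<psi>
    show "T \<psi> = distribution_of f \<psi>"
    proof (cases "\<psi> \<in> schwartz_space")
      case True
      have [measurable]: "\<psi> \<in> borel_measurable borel" using schwartz_measurable[OF True, of "[]"] by simp
      show ?thesis
        using True Tf[OF True] by (simp add: distribution_of_def integral_completion)
    next
      case False
      then show ?thesis
        using T by (auto simp: distribution_of_def tempered_distributions_def extensional_def)
    qed
  qed
  ultimately show "T \<in> distribution_of ` amalgam_space 1 p" by blast
qed

section \<open>A function outside the Hardy-amalgam space\<close>

definition bump :: "real \<Rightarrow> real^'n::finite \<Rightarrow> real^'n \<Rightarrow> complex" where
  "bump e c y = of_real (indicator (ball c e) y / e ^ CARD('n))"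

lemma measurable_bump [measurable]: "bump e c \<in> borel_measurable borel"
proof -
  have [measurable]: "ball c e \<in> sets borel" by simp
  show ?thesis unfolding bump_def by measurable
qed

lemma norm_bump: "0 < e \<Longrightarrow> norm (bump e c y) = indicator (ball c e) y / e ^ CARD('n)" for c :: "real^'n::finite"
  by (simp add: bump_def indicator_def norm_divide norm_power)

lemma bump_integral:
  fixes c :: "real^'n::finite"
  assumes "0 < e"
  shows "integrable lborel (bump e c)"
    and "(LBINT y. bump e c y) = of_real (unit_ball_vol CARD('n))"
    and "(LBINT y. norm (bump e c y)) = unit_ball_vol CARD('n)"
proof -
  have fin: "emeasure lborel (ball c e) < \<infinity>" by (rule emeasure_lborel_ball_finite)
  have m: "measure lborel (ball c e) = unit_ball_vol CARD('n) * e ^ CARD('n)"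
    using assms by (simp add: content_ball)
  have int: "integrable lborel (\<lambda>y. indicator (ball c e) y / e ^ CARD('n) :: real)"
    using fin by (intro integrable_divide_zero integrable_real_indicator) auto
  have val: "(LBINT y. indicator (ball c e) y / e ^ CARD('n)) = unit_ball_vol CARD('n)"
    using assms m by simp
  show "integrable lborel (bump e c)"
    unfolding bump_def using int by (rule integrable_of_real)
  show "(LBINT y. bump e c y) = of_real (unit_ball_vol CARD('n))"
    unfolding bump_def integral_complex_of_real val ..
  show "(LBINT y. norm (bump e c y)) = unit_ball_vol CARD('n)"
    using val by (simp add: norm_bump assms)
qed

lemma dilation_measurable [measurable]:
  assumes [measurable]: "\<phi> \<in> borel_measurable borel"
  shows "dilation \<phi> t \<in> borel_measurable borel"
  unfolding dilation_def[abs_def] by measurable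

lemma integral_norm_dilation:
  fixes \<phi> :: "real^'n::finite \<Rightarrow> complex"
  assumes \<phi>: "integrable lborel \<phi>" and t: "0 < t"
  shows "integrable lborel (\<lambda>y. dilation \<phi> t (x - y))"
    and "(LBINT y. norm (dilation \<phi> t (x - y))) = (LBINT w. norm (\<phi> w))"
proof -
  have [measurable]: "\<phi> \<in> borel_measurable borel" using \<phi> by auto
  have eq: "dilation \<phi> t (x - (x + (- t) *\<^sub>R w)) = (1 / t ^ CARD('n)) *\<^sub>R \<phi> w" for w
    using t by (simp add: dilation_def)
  have "integrable lborel (\<lambda>w. dilation \<phi> t (x - (x + (- t) *\<^sub>R w)))"
    unfolding eq using \<phi> by simp
  then show "integrable lborel (\<lambda>y. dilation \<phi> t (x - y))"
    using t by (subst lborel_integral_affine(1)[of "- t" _ x]) auto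
  have "(LBINT y. norm (dilation \<phi> t (x - y)))
    = t ^ CARD('n) * (LBINT w. norm (dilation \<phi> t (x - (x + (- t) *\<^sub>R w))))"
    using t by (subst lborel_integral_affine(2)[of "- t" _ x]) auto
  also have "\<dots> = (LBINT w. norm (\<phi> w))"
    unfolding eq using t by simp
  finally show "(LBINT y. norm (dilation \<phi> t (x - y))) = (LBINT w. norm (\<phi> w))" .
qed

lemma bump_conv_integrable:
  fixes \<phi> :: "real^'n::finite \<Rightarrow> complex"
  assumes \<phi>: "\<phi> \<in> schwartz_space" and t: "0 < t" and e: "0 < e"
  shows "integrable lborel (\<lambda>y. bump e c y * dilation \<phi> t (x - y))"
  using integrable_mult_schwartz[OF bump_integral(1)[OF e] schwartz_dilation[OF \<phi> t], of "\<lambda>y. x - y" c "[]"]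
  by simp

text \<open>The height of the bump times the integral of \<open>\<bar>\<phi>\<bar>\<close>; this is the useful bound when \<open>t\<close> is small compared to \<open>e\<close>.\<close>

lemma bump_conv_wide:
  fixes \<phi> :: "real^'n::finite \<Rightarrow> complex"
  assumes \<phi>: "\<phi> \<in> schwartz_space" and t: "0 < t" and e: "0 < e"
  shows "norm (conv (bump e c) (dilation \<phi> t) x) \<le> (LBINT w. norm (\<phi> w)) / e ^ CARD('n)"
proof -
  have \<phi>i: "integrable lborel \<phi>" using \<phi> by (intro rapid_integrable schwartz_rapid)
  have "norm (LBINT y. bump e c y * dilation \<phi> t (x - y))
    \<le> (LBINT y. norm (dilation \<phi> t (x - y)) / e ^ CARD('n))"
  proof (rule Bochner_Integration.integral_norm_bound_integral[OF bump_conv_integrable[OF assms]])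
    show "integrable lborel (\<lambda>y. norm (dilation \<phi> t (x - y)) / e ^ CARD('n))"
      using integral_norm_dilation(1)[OF \<phi>i t] by simp
    show "norm (bump e c y * dilation \<phi> t (x - y)) \<le> norm (dilation \<phi> t (x - y)) / e ^ CARD('n)" for y
      using e by (simp add: norm_mult norm_bump indicator_def)
  qed
  then show ?thesis by (simp add: conv_def integral_norm_dilation(2)[OF \<phi>i t])
qed

text \<open>At scales \<open>t\<close> far above the width \<open>e\<close>, a bump acts like a point mass of size \<open>unit_ball_vol d\<close>.\<close>

lemma bump_conv_narrow:
  fixes \<phi> :: "real^'n::finite \<Rightarrow> complex"
  assumes \<phi>: "\<phi> \<in> schwartz_space" and t: "0 < t" and e: "0 < e" "e \<le> \<rho> * t"
    and near: "\<And>s. dist s s0 < 2 * \<rho> \<Longrightarrow> norm (\<phi> s - \<phi> s0) \<le> \<delta>"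
    and x: "dist x (c + t *\<^sub>R s0) < t * \<rho>"
  shows "norm (conv (bump e c) (dilation \<phi> t) x - of_real (unit_ball_vol CARD('n) / t ^ CARD('n)) * \<phi> s0)
    \<le> unit_ball_vol CARD('n) / t ^ CARD('n) * \<delta>"
proof -
  let ?d = "CARD('n)" and ?V = "unit_ball_vol CARD('n)"
  let ?k = "of_real (1 / t ^ ?d) * \<phi> s0"
  have "of_real (?V / t ^ ?d) * \<phi> s0 = (LBINT y. bump e c y * ?k)"
    using bump_integral[OF e(1), of c] by simp
  then have "conv (bump e c) (dilation \<phi> t) x - of_real (?V / t ^ ?d) * \<phi> s0
    = (LBINT y. bump e c y * dilation \<phi> t (x - y)) - (LBINT y. bump e c y * ?k)"
    by (simp add: conv_def)
  also have "\<dots> = (LBINT y. bump e c y * (dilation \<phi> t (x - y) - ?k))"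
    unfolding right_diff_distrib
    by (intro Bochner_Integration.integral_diff[symmetric] bump_conv_integrable \<phi> t e
        integrable_mult_left bump_integral)
  also have "norm \<dots> \<le> (LBINT y. norm (bump e c y) * (\<delta> / t ^ ?d))"
  proof (rule Bochner_Integration.integral_norm_bound_integral)
    show "integrable lborel (\<lambda>y. bump e c y * (dilation \<phi> t (x - y) - ?k))"
      using bump_integral(1)[OF e(1), of c] bump_conv_integrable[OF \<phi> t e(1), of c x]
      by (simp add: right_diff_distrib)
    show "integrable lborel (\<lambda>y. norm (bump e c y) * (\<delta> / t ^ ?d))"
      using bump_integral(1)[OF e(1), of c] by (intro integrable_mult_left integrable_norm)
    fix y
    show "norm (bump e c y * (dilation \<phi> t (x - y) - ?k)) \<le> norm (bump e c y) * (\<delta> / t ^ ?d)"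
    proof (cases "y \<in> ball c e")
      case True
      let ?s = "(1 / t) *\<^sub>R (x - y)"
      have "?s - s0 = (1 / t) *\<^sub>R ((x - (c + t *\<^sub>R s0)) + (c - y))"
        using t by (simp add: algebra_simps)
      then have "dist ?s s0 = (1 / t) * norm ((x - (c + t *\<^sub>R s0)) + (c - y))"
        using t by (simp add: dist_norm)
      also have "norm ((x - (c + t *\<^sub>R s0)) + (c - y)) < t * \<rho> + \<rho> * t"
        using x True e by (intro order.strict_trans1[OF norm_triangle_ineq] add_strict_mono) (auto simp: dist_norm)
      then have "(1 / t) * norm ((x - (c + t *\<^sub>R s0)) + (c - y)) < (1 / t) * (t * \<rho> + \<rho> * t)"
        using t by (intro mult_strict_left_mono) auto
      also have "\<dots> = 2 * \<rho>" using t by (simp add: field_simps)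
      finally have "norm (\<phi> ?s - \<phi> s0) \<le> \<delta>" by (rule near)
      then have "norm (of_real (1 / t ^ ?d) * (\<phi> ?s - \<phi> s0)) \<le> \<delta> / t ^ ?d"
        using t by (simp add: norm_mult norm_divide norm_power divide_right_mono)
      moreover have "dilation \<phi> t (x - y) - ?k = of_real (1 / t ^ ?d) * (\<phi> ?s - \<phi> s0)"
        by (simp add: dilation_def scaleR_conv_of_real right_diff_distrib)
      ultimately have "norm (dilation \<phi> t (x - y) - ?k) \<le> \<delta> / t ^ ?d" by simp
      then show ?thesis unfolding norm_mult by (intro mult_left_mono) auto
    qed (simp add: bump_def)
  qed
  also have "\<dots> = ?V / t ^ ?d * \<delta>" using bump_integral(3)[OF e(1), of c] by simp
  finally show ?thesis .
qed

text \<open>The exponents grow by a factor 4, so that about \<open>4\<^sup>j\<close> dyadic scales lie between consecutive radii; this beats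
  the weights \<open>2\<^sup>-\<^sup>j\<close> of \<open>spike\<close>.\<close>

definition radius :: "nat \<Rightarrow> real" where
  "radius j = (1 / 2) ^ (4 ^ j)"

text \<open>At the centre itself the series diverges; the value taken there is arbitrary and concerns a single point.\<close>

definition spike :: "real^'n::finite \<Rightarrow> real^'n \<Rightarrow> complex" where
  "spike c y = (\<Sum>j. (1 / 2) ^ j * bump (radius j) c y)"

lemma radius_pos: "0 < radius j" by (simp add: radius_def)

lemma radius_mono: "i \<le> j \<Longrightarrow> radius j \<le> radius i"
  unfolding radius_def by (intro power_decreasing power_increasing) auto

lemma radius_le_half: "radius j \<le> 1 / 2"
  using radius_mono[of 0 j] by (simp add: radius_def)

lemma le_four_power: "j \<le> 4 ^ j" for j :: nat
  by (rule less_imp_le[OF less_exp[THEN order.strict_trans2]]) (auto intro: power_mono)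

lemma radius_tendsto_0: "radius \<longlonglongrightarrow> 0"
proof (rule tendsto_sandwich[OF always_eventually always_eventually tendsto_const])
  show "(\<lambda>j. (1 / 2) ^ j :: real) \<longlonglongrightarrow> 0" by (intro LIMSEQ_realpow_zero) auto
  show "\<forall>j. radius j \<le> (1 / 2) ^ j"
    unfolding radius_def by (intro allI power_decreasing le_four_power) auto
qed (auto simp: radius_pos less_imp_le)

lemma spike_summable:
  assumes "y \<noteq> c"
  shows "summable (\<lambda>j. norm ((1 / 2) ^ j * bump (radius j) c y * z))"
proof -
  have "0 < dist c y" using assms by simp
  from order_tendstoD(2)[OF radius_tendsto_0 this] obtain N where N: "\<And>j. j \<ge> N \<Longrightarrow> radius j < dist c y"
    by (auto simp: eventually_sequentially)
  have "bump (radius j) c y = 0" if "j \<ge> N" for j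
    using N[OF that] by (auto simp: bump_def)
  then show ?thesis by (intro summable_finite[of "{..<N}"]) (auto simp: not_less)
qed

lemma measurable_spike [measurable]: "spike c \<in> borel_measurable borel"
  unfolding spike_def by measurable

lemma spike_zero: "y \<notin> ball c (1 / 2) \<Longrightarrow> spike c y = 0"
proof -
  assume "y \<notin> ball c (1 / 2)"
  then have "bump (radius j) c y = 0" for j
    using radius_le_half[of j] by (auto simp: bump_def)
  then show ?thesis by (simp add: spike_def)
qed

lemma integrable_spike: "integrable lborel (spike (c :: real^'n::finite))"
  unfolding spike_def
proof (rule integrable_suminf)
  show "integrable lborel (\<lambda>y. (1 / 2) ^ j * bump (radius j) c y)" for j
    by (intro integrable_mult_right bump_integral radius_pos)
  show "AE y in lborel. summable (\<lambda>j. norm ((1 / 2) ^ j * bump (radius j) c y))"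
    using AE_lborel_singleton[of c]
  proof eventually_elim
    case (elim y)
    then show ?case using spike_summable[of y c 1] by simp
  qed
  show "summable (\<lambda>j. LBINT y. norm ((1 / 2) ^ j * bump (radius j) c y))"
    by (simp add: norm_mult norm_power norm_divide bump_integral(3) radius_pos summable_mult2 summable_geometric)
qed

lemma spike_conv:
  fixes \<phi> :: "real^'n::finite \<Rightarrow> complex"
  assumes \<phi>: "\<phi> \<in> schwartz_space" and t: "0 < t"
  shows "(\<lambda>j. (1 / 2) ^ j * conv (bump (radius j) c) (dilation \<phi> t) x)
     sums conv (spike c) (dilation \<phi> t) x"
proof -
  define g where "g j y = (1 / 2) ^ j * bump (radius j) c y * dilation \<phi> t (x - y)" for j y
  define B where "B = schwartz_seminorm 0 [] (dilation \<phi> t)"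
  have B: "norm (dilation \<phi> t z) \<le> B" for z
    using schwartz_bounded[OF schwartz_dilation[OF \<phi> t], of "[]"] by (simp add: B_def)
  have int: "integrable lborel (g j)" for j
    unfolding g_def[abs_def] mult.assoc
    by (intro integrable_mult_right bump_conv_integrable \<phi> t radius_pos)
  have AE: "AE y in lborel. summable (\<lambda>j. norm (g j y))"
    using AE_lborel_singleton[of c]
  proof eventually_elim
    case (elim y)
    then show ?case unfolding g_def by (rule spike_summable)
  qed
  have le: "(LBINT y. norm (g j y)) \<le> (1 / 2) ^ j * (unit_ball_vol CARD('n) * B)" for j
  proof -
    have "(LBINT y. norm (g j y)) \<le> (LBINT y. (1 / 2) ^ j * (norm (bump (radius j) c y) * B))"
    proof (rule integral_mono)
      show "integrable lborel (\<lambda>y. norm (g j y))" using int by simp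
      show "integrable lborel (\<lambda>y. (1 / 2) ^ j * (norm (bump (radius j) c y) * B))"
        by (intro integrable_mult_right integrable_mult_left integrable_norm bump_integral radius_pos)
      show "norm (g j y) \<le> (1 / 2) ^ j * (norm (bump (radius j) c y) * B)" for y
        using B[of "x - y"] by (simp add: g_def norm_mult norm_power norm_divide mult_left_mono mult.assoc)
    qed
    then show ?thesis by (simp add: bump_integral(3) radius_pos)
  qed
  have sum: "summable (\<lambda>j. LBINT y. norm (g j y))"
  proof (rule summable_comparison_test')
    show "summable (\<lambda>j. (1 / 2) ^ j * (unit_ball_vol CARD('n) * B))"
      by (intro summable_mult2 summable_geometric) simp
    have "0 \<le> (LBINT y. norm (g j y))" for j
      by (intro integral_nonneg_AE AE_I2 norm_ge_zero)
    then show "norm (LBINT y. norm (g j y)) \<le> (1 / 2) ^ j * (unit_ball_vol CARD('n) * B)" if "j \<ge> 0" for j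
      using le[of j] unfolding real_norm_def by (simp only: abs_of_nonneg)
  qed
  have sums: "(\<lambda>j. LBINT y. g j y) sums (LBINT y. (\<Sum>j. g j y))"
    using sums_integral[of lborel g, OF int AE sum] .
  have "(LBINT y. (\<Sum>j. g j y)) = (LBINT y. spike c y * dilation \<phi> t (x - y))"
  proof (rule integral_cong_AE)
    show "AE y in lborel. (\<Sum>j. g j y) = spike c y * dilation \<phi> t (x - y)"
      using AE_lborel_singleton[of c]
    proof eventually_elim
      case (elim y)
      have "summable (\<lambda>j. (1 / 2) ^ j * bump (radius j) c y)"
        using summable_norm_cancel[OF spike_summable[OF elim, of 1]] by simp
      then show ?case unfolding spike_def g_def by (rule suminf_mult2[symmetric])
    qed
    have [measurable]: "\<phi> \<in> borel_measurable borel" using schwartz_measurable[OF \<phi>, of "[]"] by simp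
    show "(\<lambda>y. \<Sum>j. g j y) \<in> borel_measurable lborel" unfolding g_def by measurable
    show "(\<lambda>y. spike c y * dilation \<phi> t (x - y)) \<in> borel_measurable lborel" by measurable
  qed
  with sums show ?thesis by (simp add: conv_def g_def mult.assoc)
qed

lemma sums_norm_le:
  fixes f :: "nat \<Rightarrow> 'a::banach"
  assumes "f sums a" "g sums b" "\<And>n. norm (f n) \<le> g n"
  shows "norm a \<le> b"
  using norm_suminf_le[of f g] assms by (simp add: sums_iff)

text \<open>The scale \<open>t\<close> lies between \<open>radius (Suc J)\<close> and \<open>radius J\<close>.  The bumps beyond \<open>J\<close> act together as a
  point mass of weight \<open>2\<^sup>-\<^sup>J\<close>, up to a relative error of one half; the remaining ones are flat at this scale and contribute at most a
  quarter of that size.\<close>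

lemma spike_conv_lower_bound:
  fixes \<phi> :: "real^'n::finite \<Rightarrow> complex"
  assumes \<phi>: "\<phi> \<in> schwartz_space" and t: "0 < t"
    and near: "\<And>s. dist s s0 < 2 * \<rho> \<Longrightarrow> norm (\<phi> s - \<phi> s0) \<le> norm (\<phi> s0) / 2"
    and x: "dist x (c + t *\<^sub>R s0) < t * \<rho>"
    and narrow: "radius (Suc J) \<le> \<rho> * t"
    and wide: "2 * ((LBINT w. norm (\<phi> w)) / radius J ^ CARD('n))
      \<le> (1 / 2) ^ J * (unit_ball_vol CARD('n) / t ^ CARD('n)) * norm (\<phi> s0) / 4"
  shows "(1 / 2) ^ J * (unit_ball_vol CARD('n) / t ^ CARD('n)) * norm (\<phi> s0) / 4
    \<le> norm (conv (spike c) (dilation \<phi> t) x)"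
proof -
  define I where "I j = conv (bump (radius j) c) (dilation \<phi> t) x" for j
  define q where "q = unit_ball_vol CARD('n) / t ^ CARD('n)"
  have q0: "0 \<le> q" using t by (simp add: q_def)
  define E where "E = (LBINT w. norm (\<phi> w)) / radius J ^ CARD('n)"
  have sums: "(\<lambda>j. (1 / 2) ^ j * I j) sums conv (spike c) (dilation \<phi> t) x"
    unfolding I_def using \<phi> t by (rule spike_conv)
  have geo: "(\<lambda>j. (1 / 2) ^ (j + Suc J)) sums ((1 / 2) ^ J :: real)"
    using sums_mult2[OF geometric_sums[of "1 / 2 :: real"], of "(1 / 2) ^ Suc J"] by (simp add: power_add)
  have head: "norm (\<Sum>j<Suc J. (1 / 2) ^ j * I j) \<le> 2 * E"
  proof -
    have E0: "0 \<le> E" unfolding E_def using radius_pos[of J] by (intro divide_nonneg_pos zero_less_power) auto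
    have "norm (\<Sum>j<Suc J. (1 / 2) ^ j * I j) \<le> (\<Sum>j<Suc J. (1 / 2) ^ j * E)"
    proof (rule sum_norm_le)
      fix j assume "j \<in> {..<Suc J}"
      then have "radius J \<le> radius j" by (intro radius_mono) auto
      then have "(LBINT w. norm (\<phi> w)) / radius j ^ CARD('n) \<le> E"
        unfolding E_def using radius_pos by (intro divide_left_mono power_mono mult_pos_pos zero_less_power) (auto simp: less_imp_le)
      then have "norm (I j) \<le> E"
        using bump_conv_wide[OF \<phi> t radius_pos, of j c x] unfolding I_def by linarith
      then show "norm ((1 / 2) ^ j * I j) \<le> (1 / 2) ^ j * E"
        by (simp add: norm_mult norm_power norm_divide mult_left_mono)
    qed
    also have "\<dots> = (\<Sum>j<Suc J. (1 / 2) ^ j) * E" by (rule sum_distrib_right[symmetric])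
    also have "\<dots> \<le> 2 * E"
      using E0 by (intro mult_right_mono) (simp_all add: geometric_sum del: sum.lessThan_Suc)
    finally show ?thesis .
  qed
  have tail_sums: "(\<lambda>j. (1 / 2) ^ (j + Suc J) * I (j + Suc J)) sums
      (conv (spike c) (dilation \<phi> t) x - (\<Sum>j<Suc J. (1 / 2) ^ j * I j))"
    by (rule sums_split_initial_segment[OF sums])
  have geo': "(\<lambda>j. (1 / 2) ^ (j + Suc J) * (of_real q * \<phi> s0)) sums ((1 / 2) ^ J * (of_real q * \<phi> s0))"
    using sums_mult2[OF sums_of_real[OF geo, where 'a = complex], of "of_real q * \<phi> s0"] by simp
  have diff_sums: "(\<lambda>j. (1 / 2) ^ (j + Suc J) * (I (j + Suc J) - of_real q * \<phi> s0)) sums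
      (conv (spike c) (dilation \<phi> t) x - (\<Sum>j<Suc J. (1 / 2) ^ j * I j) - (1 / 2) ^ J * (of_real q * \<phi> s0))"
    using sums_diff[OF tail_sums geo'] by (simp add: right_diff_distrib)
  have tail: "norm (conv (spike c) (dilation \<phi> t) x - (\<Sum>j<Suc J. (1 / 2) ^ j * I j) - (1 / 2) ^ J * (of_real q * \<phi> s0))
    \<le> (1 / 2) ^ J * (q * (norm (\<phi> s0) / 2))"
  proof (rule sums_norm_le[OF diff_sums sums_mult2[OF geo]])
    fix j
    have "radius (j + Suc J) \<le> \<rho> * t"
      using radius_mono[of "Suc J" "j + Suc J"] narrow by simp
    from bump_conv_narrow[OF \<phi> t radius_pos this near x]
    have "norm (I (j + Suc J) - of_real q * \<phi> s0) \<le> q * (norm (\<phi> s0) / 2)"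
      unfolding I_def q_def by blast
    then show "norm ((1 / 2) ^ (j + Suc J) * (I (j + Suc J) - of_real q * \<phi> s0)) \<le> (1 / 2) ^ (j + Suc J) * (q * (norm (\<phi> s0) / 2))"
      unfolding norm_mult by (intro mult_mono) (auto simp: norm_power norm_divide)
  qed
  let ?X = "conv (spike c) (dilation \<phi> t) x"
  let ?H = "\<Sum>j<Suc J. (1 / 2) ^ j * I j"
  let ?Z = "(1 / 2) ^ J * (of_real q * \<phi> s0) :: complex"
  have "norm ?Z = (1 / 2) ^ J * q * norm (\<phi> s0)"
    using q0 by (simp add: norm_mult norm_power norm_divide)
  moreover have "norm ?Z \<le> norm ?X + norm ?H + norm (?X - ?H - ?Z)"
  proof -
    have *: "norm (A - B - D) \<le> norm A + norm B + norm D" for A B D :: complex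
      using norm_triangle_ineq4[of "A - B" D] norm_triangle_ineq4[of A B] by linarith
    show ?thesis using *[of ?X ?H "?X - ?H - ?Z"] by simp
  qed
  moreover have "2 * E \<le> (1 / 2) ^ J * q * norm (\<phi> s0) / 4"
    using wide unfolding E_def q_def .
  ultimately show ?thesis
    using head tail unfolding q_def[symmetric] by (simp add: mult.assoc)
qed

abbreviation cube_center :: "real^'n::finite" where
  "cube_center \<equiv> (\<chi> i. 1 / 2)"

lemma ball_subset_unit_cube: "ball cube_center (1 / 2) \<subseteq> unit_cube (0 :: int^'n::finite)"
proof
  fix x :: "real^'n" assume x: "x \<in> ball cube_center (1 / 2)"
  have b: "\<bar>x $ i - 1 / 2\<bar> < 1 / 2" for i
    using component_le_norm_cart[of "x - cube_center" i] x by (simp add: dist_norm norm_minus_commute)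
  then show "x \<in> unit_cube 0"
    unfolding unit_cube_def
  proof (intro CollectI allI)
    fix i
    have "0 \<le> x $ i \<and> x $ i < 1" using b[of i] by linarith
    then show "of_int ((0 :: int^'n) $ i) \<le> x $ i \<and> x $ i < of_int ((0 :: int^'n) $ i) + 1" by simp
  qed
qed

lemma unit_cube_disjoint: "x \<in> unit_cube k \<Longrightarrow> x \<in> unit_cube l \<Longrightarrow> k = l"
  by (simp add: unit_cube_def vec_eq_iff) (metis floor_eq_iff)

lemma spike_amalgam: "spike (cube_center :: real^'n::finite) \<in> amalgam_space 1 p"
  unfolding amalgam_space_def
proof (intro CollectI conjI impI allI)
  show "spike cube_center \<in> borel_measurable lebesgue"
    by (rule measurable_completion) simp
  show "set_integrable lebesgue K (spike cube_center)" if "compact K" for K :: "(real^'n) set"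
  proof -
    have "integrable lebesgue (spike (cube_center :: real^'n))"
      using integrable_spike[of "cube_center :: real^'n"]
        integrable_completion[of "spike (cube_center :: real^'n)" lborel] by simp
    moreover have "K \<in> sets lebesgue"
      by (rule sets_completionI_sets) (simp add: borel_compact[OF that])
    ultimately show ?thesis
      unfolding set_integrable_def by (rule integrable_mult_indicator[rotated])
  qed
  let ?F = "\<lambda>x. ennreal (norm (spike (cube_center :: real^'n) x))"
  let ?I = "\<lambda>k::int^'n. \<integral>\<^sup>+ x \<in> unit_cube k. ?F x \<partial>lborel"
  have other: "?I k = 0" if "k \<noteq> 0" for k
  proof -
    have zero: "?F x * indicator (unit_cube k) x = 0" for x
    proof (cases "x \<in> unit_cube k")
      case True
      then have "x \<notin> ball cube_center (1 / 2)"
        using that unit_cube_disjoint[OF True subsetD[OF ball_subset_unit_cube]] by auto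
      then show ?thesis by (simp add: spike_zero)
    qed simp
    show ?thesis unfolding zero by simp
  qed
  have single: "ennpowr (?I k) p = ennpowr (?I 0) p * indicator {0} k" for k
  proof (cases "k = 0")
    case False
    show ?thesis unfolding other[OF False] using False by (simp add: ennpowr_def)
  qed simp
  have "(\<integral>\<^sup>+ k. ennpowr (?I k) p \<partial>count_space UNIV)
    = (\<integral>\<^sup>+ k. ennpowr (?I 0) p * indicator {0} k \<partial>count_space (UNIV :: (int^'n) set))"
    by (rule nn_integral_cong) (rule single)
  also have "\<dots> = ennpowr (?I 0) p"
    by (subst nn_integral_cmult_indicator) auto
  also have "\<dots> < \<infinity>"
  proof -
    have "?I 0 \<le> (\<integral>\<^sup>+ x. ?F x \<partial>lborel)"
      by (intro nn_integral_mono) (auto simp: indicator_def)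
    also have "\<dots> < \<infinity>" using integrable_spike by (simp add: integrable_iff_bounded)
    finally show ?thesis by simp
  qed
  finally show "amalgam_norm 1 p ?F < \<infinity>"
    unfolding amalgam_norm_less_top_iff .
qed

lemma norm_conv_le_maximal_function:
  fixes \<phi> f :: "real^'n::finite \<Rightarrow> complex"
  assumes \<phi>: "\<phi> \<in> schwartz_space" and t: "0 < t" and [measurable]: "f \<in> borel_measurable borel"
  shows "ennreal (norm (conv f (dilation \<phi> t) x)) \<le> maximal_function \<phi> (distribution_of f) x"
proof -
  have S: "(\<lambda>y. dilation \<phi> t (x - y)) \<in> schwartz_space"
    using schwartz_affine[OF schwartz_dilation[OF \<phi> t], of "-1" x] by simp
  have [measurable]: "(\<lambda>y. dilation \<phi> t (x - y)) \<in> borel_measurable borel"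
    using schwartz_measurable[OF S, of "[]"] by simp
  have "distr_convolution (distribution_of f) (dilation \<phi> t) x = conv f (dilation \<phi> t) x"
    using S by (simp add: distr_convolution_def distribution_of_def conv_def integral_completion)
  then show ?thesis
    unfolding maximal_function_def using t by (intro SUP_upper2[of t]) auto
qed

text \<open>The bound on \<open>\<rho>\<close> by \<open>\<bar>s0\<bar> / 4\<close> makes the dilates of the ball around \<open>s0\<close> by powers of two disjoint.\<close>

lemma nonvanishing_ball:
  fixes \<phi> :: "real^'n::finite \<Rightarrow> complex"
  assumes \<phi>: "\<phi> \<in> schwartz_space" and \<phi>1: "(LBINT x. \<phi> x) = 1"
  obtains s0 \<rho> where "\<phi> s0 \<noteq> 0" "0 < \<rho>" "\<rho> \<le> norm s0 / 4"
    "\<And>s. dist s s0 < 2 * \<rho> \<Longrightarrow> norm (\<phi> s - \<phi> s0) \<le> norm (\<phi> s0) / 2"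
proof -
  have "\<exists>s0. s0 \<noteq> 0 \<and> \<phi> s0 \<noteq> 0"
  proof (rule ccontr)
    assume "\<nexists>s0. s0 \<noteq> 0 \<and> \<phi> s0 \<noteq> 0"
    then have "AE x in lborel. \<phi> x = 0"
      using AE_lborel_singleton[of "0 :: real^'n"] by (auto elim: eventually_mono)
    then have "(LBINT x. \<phi> x) = 0" by (rule integral_eq_zero_AE)
    with \<phi>1 show False by simp
  qed
  then obtain s0 where s0: "s0 \<noteq> 0" "\<phi> s0 \<noteq> 0" by blast
  have "isCont \<phi> s0"
    using smooth_continuous_on[OF schwartz_smooth[OF \<phi>], of UNIV "[]"]
    by (simp add: continuous_on_eq_continuous_at)
  then obtain \<delta> where \<delta>: "0 < \<delta>" "\<And>s. dist s s0 < \<delta> \<Longrightarrow> dist (\<phi> s) (\<phi> s0) < norm (\<phi> s0) / 2"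
    using s0(2) unfolding continuous_at_eps_delta by (metis half_gt_zero zero_less_norm_iff)
  define \<rho> where "\<rho> = min (\<delta> / 2) (norm s0 / 4)"
  show thesis
  proof (rule that[OF s0(2), of \<rho>])
    show "0 < \<rho>" "\<rho> \<le> norm s0 / 4" using \<delta>(1) s0(1) by (auto simp: \<rho>_def)
    show "norm (\<phi> s - \<phi> s0) \<le> norm (\<phi> s0) / 2" if "dist s s0 < 2 * \<rho>" for s
    proof -
      have "\<rho> \<le> \<delta> / 2" by (simp add: \<rho>_def)
      then show ?thesis using \<delta>(2)[of s] that by (simp add: dist_norm)
    qed
  qed
qed

text \<open>On the ball \<open>A n\<close> of radius \<open>t n \<rho>\<close>, with \<open>t n = 2\<^sup>-\<^sup>n\<close>, the maximal function is at least \<open>low J n\<close>, where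
  \<open>J\<close> is determined by the window \<open>W J\<close> containing \<open>n\<close>.  The product of this bound with the volume of \<open>A n\<close> is
  independent of \<open>n\<close>, namely \<open>2\<^sup>-\<^sup>J K\<close>, and the window has \<open>4\<^sup>J\<close> elements.\<close>

proposition spike_not_hardy:
  fixes \<phi> :: "real^'n::finite \<Rightarrow> complex"
  assumes \<phi>: "\<phi> \<in> schwartz_space" and \<phi>1: "(LBINT x. \<phi> x) = 1"
    and supp: "\<And>x. \<phi> x \<noteq> 0 \<Longrightarrow> norm x < 1"
  shows "distribution_of (spike cube_center) \<notin> hardy_amalgam_space \<phi> 1 p"
proof
  assume "distribution_of (spike cube_center) \<in> hardy_amalgam_space \<phi> 1 p"
  define M where "M = maximal_function \<phi> (distribution_of (spike cube_center))"
  have "amalgam_norm 1 p M < \<infinity>"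
    using \<open>_ \<in> hardy_amalgam_space \<phi> 1 p\<close> by (simp add: hardy_amalgam_space_def M_def)
  then have "ennpowr (\<integral>\<^sup>+ x \<in> unit_cube 0. M x \<partial>lborel) p < \<infinity>"
    unfolding amalgam_norm_less_top_iff by (rule order.strict_trans1[OF ennpowr_le_sum])
  then have fin: "(\<integral>\<^sup>+ x \<in> unit_cube 0. M x \<partial>lborel) < \<infinity>" by simp
  obtain s0 \<rho> where s0: "\<phi> s0 \<noteq> 0" and \<rho>: "0 < \<rho>" "\<rho> \<le> norm s0 / 4"
    and near: "\<And>s. dist s s0 < 2 * \<rho> \<Longrightarrow> norm (\<phi> s - \<phi> s0) \<le> norm (\<phi> s0) / 2"
    using nonvanishing_ball[OF \<phi> \<phi>1] by blast
  have s0_1: "norm s0 < 1" using supp s0 by blast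
  have s0_0: "0 < norm s0" using \<rho> by linarith
  let ?d = "CARD('n)"
  define V where "V = unit_ball_vol (real ?d)"
  define C1 where "C1 = (LBINT w. norm (\<phi> w))"
  have V: "0 < V" by (simp add: V_def)
  have C1: "0 \<le> C1" by (simp add: C1_def)
  obtain L1 where L1: "8 * C1 / (V * norm (\<phi> s0)) < 2 ^ L1"
    using real_arch_pow[of 2] by auto
  obtain L2 where L2: "(1 / 2) ^ L2 < \<rho>"
    using real_arch_pow_inv[OF \<rho>(1), of "1 / 2"] by auto
  \<comment> \<open>One margin for three purposes: \<open>L1\<close> makes the wide bumps negligible, \<open>L2\<close> makes the narrow ones point-like, and 2 keeps the balls inside the unit cube.\<close>
  define L where "L = L1 + L2 + 2"
  have Vs0: "0 < V * norm (\<phi> s0)" using V s0 by simp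
  have L_wide: "8 * C1 \<le> 2 ^ L * (V * norm (\<phi> s0))"
  proof -
    have "8 * C1 < 2 ^ L1 * (V * norm (\<phi> s0))"
      using L1 unfolding pos_divide_less_eq[OF Vs0] .
    also have "\<dots> \<le> 2 ^ L * (V * norm (\<phi> s0))"
      using Vs0 by (intro mult_right_mono power_increasing) (auto simp: L_def)
    finally show ?thesis by simp
  qed
  have "(1 / 2 :: real) ^ L \<le> (1 / 2) ^ L2" unfolding L_def by (intro power_decreasing) auto
  then have L_narrow: "(1 / 2) ^ L \<le> \<rho>" using L2 by linarith
  define t :: "nat \<Rightarrow> real" where "t n = (1 / 2) ^ n" for n
  have t: "0 < t n" for n by (simp add: t_def)
  define A where "A n = ball (cube_center + t n *\<^sub>R s0) (t n * \<rho>)" for n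
  define W where "W J = {4 ^ J + J + L ..< 4 ^ J + J + L + 4 ^ J}" for J :: nat
  define low where "low J n = (1 / 2) ^ J * (V / t n ^ ?d) * norm (\<phi> s0) / 4" for J n
  have low0: "0 \<le> low J n" for J n using V t[of n] by (simp add: low_def)
  have lower: "ennreal (low J n) \<le> M x" if J: "2 * L \<le> J" and n: "n \<in> W J" and x: "x \<in> A n" for J n x
  proof -
    have n1: "4 ^ J + J + L \<le> n" using n by (simp add: W_def)
    have n2: "n + L \<le> 4 ^ Suc J"
    proof -
      have "n + L \<le> 4 ^ J + J + L + 4 ^ J + L" using n by (simp add: W_def)
      also have "\<dots> \<le> 4 ^ J + J + 4 ^ J + J" using J by simp
      also have "\<dots> \<le> 4 * 4 ^ J" using le_four_power[of J] by linarith
      finally show ?thesis by simp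
    qed
    have "low J n \<le> norm (conv (spike cube_center) (dilation \<phi> (t n)) x)"
      unfolding low_def V_def
    proof (rule spike_conv_lower_bound[OF \<phi> t near])
      show "dist x (cube_center + t n *\<^sub>R s0) < t n * \<rho>" using x by (simp add: A_def dist_commute)
      have "radius (Suc J) \<le> (1 / 2) ^ (n + L)"
        unfolding radius_def using n2 by (intro power_decreasing) auto
      also have "\<dots> = (1 / 2) ^ L * t n" by (simp add: power_add t_def)
      also have "\<dots> \<le> \<rho> * t n" using L_narrow t[of n] by (intro mult_right_mono) auto
      finally show "radius (Suc J) \<le> \<rho> * t n" .
      have "t n \<le> radius J * (1 / 2) ^ (J + L)"
        unfolding t_def radius_def power_add[symmetric] using n1 by (intro power_decreasing) auto
      then have "t n ^ ?d \<le> (radius J * (1 / 2) ^ (J + L)) ^ ?d"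
        using t[of n] by (intro power_mono) auto
      also have "\<dots> \<le> radius J ^ ?d * (1 / 2) ^ (J + L)"
      proof -
        have "((1 / 2 :: real) ^ (J + L)) ^ ?d \<le> ((1 / 2) ^ (J + L)) ^ 1"
          by (intro power_decreasing) (auto simp: power_le_one Suc_le_eq)
        then show ?thesis
          unfolding power_mult_distrib using radius_pos[of J] by (intro mult_left_mono) auto
      qed
      finally have td: "t n ^ ?d \<le> radius J ^ ?d * (1 / 2) ^ (J + L)" .
      have "8 * C1 * t n ^ ?d \<le> (2 ^ L * (V * norm (\<phi> s0))) * (radius J ^ ?d * (1 / 2) ^ (J + L))"
        by (rule mult_mono[OF L_wide td]) (use Vs0 t[of n] in auto)
      also have "\<dots> = (1 / 2) ^ J * V * norm (\<phi> s0) * radius J ^ ?d"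
        by (simp add: power_add power_one_over)
      finally have "8 * C1 * t n ^ ?d \<le> (1 / 2) ^ J * V * norm (\<phi> s0) * radius J ^ ?d" .
      moreover have "0 < t n ^ ?d" "0 < radius J ^ ?d" using t radius_pos by auto
      ultimately show "2 * ((LBINT w. norm (\<phi> w)) / radius J ^ ?d)
        \<le> (1 / 2) ^ J * (unit_ball_vol (real ?d) / t n ^ ?d) * norm (\<phi> s0) / 4"
        unfolding C1_def[symmetric] V_def[symmetric] by (simp add: field_simps)
    qed
    then have "ennreal (low J n) \<le> ennreal (norm (conv (spike cube_center) (dilation \<phi> (t n)) x))"
      by (rule ennreal_leI)
    also have "\<dots> \<le> M x"
      unfolding M_def by (intro norm_conv_le_maximal_function \<phi> t) simp
    finally show ?thesis .
  qed
  have A_bounds: "3 / 4 * (t n * norm s0) < dist x cube_center" "dist x cube_center < 5 / 4 * (t n * norm s0)"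
    if "x \<in> A n" for x n
  proof -
    have "norm ((x - cube_center) - t n *\<^sub>R s0) < t n * \<rho>"
      using that by (simp add: A_def dist_norm norm_minus_commute algebra_simps)
    also have "\<dots> \<le> t n * (norm s0 / 4)" using \<rho> t[of n] by (intro mult_left_mono) auto
    finally have *: "norm ((x - cube_center) - t n *\<^sub>R s0) < t n * norm s0 / 4" by simp
    have "norm (t n *\<^sub>R s0) = t n * norm s0" using t[of n] by simp
    then show "3 / 4 * (t n * norm s0) < dist x cube_center" "dist x cube_center < 5 / 4 * (t n * norm s0)"
      using * norm_triangle_ineq3[of "x - cube_center" "t n *\<^sub>R s0"]
      unfolding dist_norm by linarith+
  qed
  have A_disjoint: "n = n'" if "x \<in> A n" "x \<in> A n'" for x n n'
  proof (rule ccontr)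
    have contra: False if "x \<in> A i" "x \<in> A j" "i < j" for i j
    proof -
      have "t j \<le> (1 / 2) ^ Suc i" unfolding t_def using that by (intro power_decreasing) auto
      then have "t j * norm s0 \<le> t i * norm s0 / 2" using s0_0 by (simp add: t_def)
      moreover have "0 < t i * norm s0" using t s0_0 by simp
      ultimately show False using A_bounds(1)[OF that(1)] A_bounds(2)[OF that(2)] by linarith
    qed
    assume "n \<noteq> n'"
    then show False using contra that by (metis linorder_neqE_nat)
  qed
  have A_cube: "x \<in> unit_cube 0" if "x \<in> A n" "2 \<le> n" for x n
  proof -
    have "t n \<le> (1 / 2) ^ 2" unfolding t_def using that by (intro power_decreasing) auto
    then have "t n * norm s0 \<le> 1 / 4 * 1" using s0_1 t[of n] by (intro mult_mono) (auto simp: power2_eq_square)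
    then have "dist x cube_center < 1 / 2" using A_bounds(2)[OF that(1)] by linarith
    then show ?thesis using ball_subset_unit_cube by (auto simp: dist_commute)
  qed
  define K where "K = V * norm (\<phi> s0) / 4 * (V * \<rho> ^ ?d)"
  have K: "0 < K" using V s0 \<rho> by (simp add: K_def)
  have big: "ennreal (2 ^ J * K) \<le> (\<integral>\<^sup>+ x \<in> unit_cube 0. M x \<partial>lborel)" if J: "2 * L \<le> J" for J
  proof -
    have "(\<integral>\<^sup>+ x. (\<Sum>n\<in>W J. ennreal (low J n) * indicator (A n) x) \<partial>lborel)
      \<le> (\<integral>\<^sup>+ x. M x * indicator (unit_cube 0) x \<partial>lborel)"
    proof (rule nn_integral_mono)
      fix x
      show "(\<Sum>n\<in>W J. ennreal (low J n) * indicator (A n) x) \<le> M x * indicator (unit_cube 0) x"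
      proof (cases "\<exists>n\<in>W J. x \<in> A n")
        case True
        then obtain n where n: "n \<in> W J" "x \<in> A n" by blast
        have "(\<Sum>i\<in>W J. ennreal (low J i) * indicator (A i) x) = (\<Sum>i\<in>W J. if i = n then ennreal (low J n) else 0)"
          using A_disjoint n by (intro sum.cong) (auto simp: indicator_def)
        also have "\<dots> = ennreal (low J n)" using n by (simp add: W_def)
        also have "\<dots> \<le> M x" using lower[OF J n] .
        also have "\<dots> = M x * indicator (unit_cube 0) x"
          using A_cube[OF n(2)] n(1) by (simp add: W_def L_def)
        finally show ?thesis .
      next
        case False
        then have "(\<Sum>n\<in>W J. ennreal (low J n) * indicator (A n) x) = 0"
          by (intro sum.neutral) (auto simp: indicator_def)
        then show ?thesis by simp
      qed
    qed
    moreover have "(\<integral>\<^sup>+ x. (\<Sum>n\<in>W J. ennreal (low J n) * indicator (A n) x) \<partial>lborel)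
      = (\<Sum>n\<in>W J. ennreal (low J n) * emeasure lborel (A n))"
      by (subst nn_integral_sum) (auto simp: A_def nn_integral_cmult_indicator
          intro!: borel_measurable_times_ennreal borel_measurable_indicator)
    moreover have "ennreal (low J n) * emeasure lborel (A n) = ennreal ((1 / 2) ^ J * K)" for n
    proof -
      have "emeasure lborel (A n) = ennreal (V * (t n * \<rho>) ^ ?d)"
        unfolding A_def V_def using t[of n] \<rho> by (subst emeasure_ball) auto
      moreover have "low J n * (V * (t n * \<rho>) ^ ?d) = (1 / 2) ^ J * K"
        using t[of n] by (simp add: low_def K_def power_mult_distrib)
      ultimately show ?thesis using low0[of J n] V t[of n] \<rho> by (simp add: ennreal_mult[symmetric])
    qed
    moreover have "(\<Sum>n\<in>W J. ennreal ((1 / 2) ^ J * K)) = ennreal (2 ^ J * K)"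
    proof -
      have "(\<Sum>n\<in>W J. ennreal ((1 / 2) ^ J * K)) = ennreal (\<Sum>n\<in>W J. (1 / 2) ^ J * K)"
        using K by (intro sum_ennreal) auto
      also have "(\<Sum>n\<in>W J. (1 / 2) ^ J * K) = (4 ^ J * (1 / 2) ^ J) * K" by (simp add: W_def)
      also have "(4::real) ^ J * (1 / 2) ^ J = 2 ^ J" unfolding power_mult_distrib[symmetric] by simp
      finally show ?thesis .
    qed
    ultimately show ?thesis by simp
  qed
  obtain r where r: "0 \<le> r" "(\<integral>\<^sup>+ x \<in> unit_cube 0. M x \<partial>lborel) = ennreal r"
    using fin by (cases "\<integral>\<^sup>+ x \<in> unit_cube 0. M x \<partial>lborel") auto
  obtain J where J: "r / K < 2 ^ J" using real_arch_pow[of 2] by auto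
  have "r < 2 ^ J * K" using J unfolding pos_divide_less_eq[OF K] .
  also have "\<dots> \<le> 2 ^ (J + 2 * L) * K"
    using K by (intro mult_right_mono power_increasing) auto
  finally have "r < 2 ^ (J + 2 * L) * K" .
  moreover have "2 ^ (J + 2 * L) * K \<le> r"
    using big[of "J + 2 * L"] r by (simp add: ennreal_le_iff)
  ultimately show False by simp
qed

theorem mainTheorem1:
  fixes \<phi> :: "real^'n::finite \<Rightarrow> complex" and p :: real
  assumes "smooth \<phi>"
    and "closure {x. \<phi> x \<noteq> 0} \<subseteq> ball 0 1"
    and "(\<integral>x. \<phi> x \<partial>lebesgue) = 1"
    and "1 \<le> p"
  shows "hardy_amalgam_space \<phi> 1 p \<subset> distribution_of ` amalgam_space 1 p"
proof -
  have \<phi>: "\<phi> \<in> schwartz_space"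
    using assms(1,2) by (rule test_function_schwartz)
  have "\<phi> \<in> borel_measurable lborel" using schwartz_measurable[OF \<phi>, of "[]"] by simp
  then have \<phi>1: "(\<integral>x. \<phi> x \<partial>lborel) = 1"
    using assms(3) by (simp add: integral_completion)
  have supp: "norm x < 1" if "\<phi> x \<noteq> 0" for x
    using that assms(2) closure_subset[of "{x. \<phi> x \<noteq> 0}"] by auto
  have "distribution_of (spike cube_center) \<notin> hardy_amalgam_space \<phi> 1 p"
    using \<phi> \<phi>1 supp by (rule spike_not_hardy)
  moreover have "distribution_of (spike cube_center) \<in> distribution_of ` amalgam_space 1 p"
    using spike_amalgam by blast
  ultimately show ?thesis
    using hardy_amalgam_subset[OF \<phi> \<phi>1 assms(4)] by blast
qed

end
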